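(* Let $G$ be a finite group, $p$ a prime, and $S$ a Sylow $p$-subgroup of $G$. Assume that there exists a subgroup $D$ of $S$ with $1<|D|<|S|$ such that every subgroup of $S$ of order $|D|$ is abelian and satisfies the $S$-subnormalizer condition in $G$, and every subgroup of $S$ of order $p|D|$ is abelian. If $S$ is non-abelian, $p=2$ and $|D|=2$, assume moreover that every cyclic subgroup of $S$ of order $4$ satisfies the $S$-subnormalizer condition in $G$. Then $\mathcal{F}_S(G)$ is supersolvable.
   Context: For a finite group $G$ and $S\in\mathrm{Syl}_p(G)$, a subgroup $H\le S$ satisfies the $S$-subnormalizer condition in $G$ if $N_G(K)\le N_G(H)$ for every subgroup $K$ with $H\le K\le S$. $\mathcal{F}_S(G)$ is the (saturated) fusion system on $S$ whose objects are the subgroups of $S$ and whose morphisms $P\to Q$ are the maps $x\mapsto x^g$ with $g\in G$, $P^g\le Q$. Supersolvable: a saturated fusion system $\mathcal{F}$ on $S$ is supersolvable if there is a series of subgroups $1=S_0\le S_1\le\cdots\le S_n=S$ such that each $S_i$ ($0\le i\le n$) is strongly $\mathcal{F}$-closed and $S_{i+1}/S_i$ is cyclic for $0\le i\le n-1$. (A subgroup $T\le S$ is strongly $\mathcal{F}$-closed if for every $P\le T$ and every morphism $\phi\in\mathrm{Hom}_{\mathcal{F}}(P,S)$ one has $P^{\phi}\le T$.) *)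

theory Defs
  imports "HOL-Algebra.Algebra"
begin

definition sylow_subgroup :: "('a, 'b) monoid_scheme \<Rightarrow> nat \<Rightarrow> 'a set \<Rightarrow> bool" where
  "sylow_subgroup G p S \<longleftrightarrow> subgroup S G \<and> card S = p ^ multiplicity p (order G)"

definition subnormalizer_condition ::
    "('a, 'b) monoid_scheme \<Rightarrow> 'a set \<Rightarrow> 'a set \<Rightarrow> bool" where
  "subnormalizer_condition G S H \<longleftrightarrow>
     (\<forall>K. subgroup K G \<longrightarrow> H \<subseteq> K \<longrightarrow> K \<subseteq> S \<longrightarrow> normalizer G K \<subseteq> normalizer G H)"

text \<open>A fusion system on a subgroup \<open>S\<close> of \<open>G\<close> is represented by its morphism sets: \<open>F P Q\<close> is
  the set of morphisms from \<open>P\<close> to \<open>Q\<close>, where \<open>P\<close> and \<open>Q\<close> range over the subgroups of \<open>S\<close>.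
  Morphisms are extensional on their domain. Outside the subgroups of \<open>S\<close> there are none.\<close>

type_synonym 'a fusion = "'a set \<Rightarrow> 'a set \<Rightarrow> ('a \<Rightarrow> 'a) set"

text \<open>Conjugation acts from the right: \<open>x\<close> is sent to \<open>x\<^sup>g = g\<^sup>-\<^sup>1xg\<close>.\<close>

definition group_fusion :: "('a, 'b) monoid_scheme \<Rightarrow> 'a set \<Rightarrow> 'a fusion" where
  "group_fusion G S P Q =
     {\<phi>. subgroup P G \<and> P \<subseteq> S \<and> subgroup Q G \<and> Q \<subseteq> S \<and>
         (\<exists>g\<in>carrier G. \<phi> = (\<lambda>x\<in>P. inv\<^bsub>G\<^esub> g \<otimes>\<^bsub>G\<^esub> x \<otimes>\<^bsub>G\<^esub> g) \<and> \<phi> ` P \<subseteq> Q)}"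

definition strongly_closed ::
    "('a, 'b) monoid_scheme \<Rightarrow> 'a set \<Rightarrow> 'a fusion \<Rightarrow> 'a set \<Rightarrow> bool" where
  "strongly_closed G S F T \<longleftrightarrow>
     subgroup T G \<and> T \<subseteq> S \<and>
     (\<forall>P. subgroup P G \<longrightarrow> P \<subseteq> T \<longrightarrow> (\<forall>\<phi>\<in>F P S. \<phi> ` P \<subseteq> T))"

text \<open>This notion is meant for saturated fusion systems, such as the \<open>group_fusion G S\<close> of a
  Sylow subgroup \<open>S\<close> of a finite group \<open>G\<close>. In a fusion system on \<open>S\<close>, conjugation by elements
  of \<open>S\<close> is a morphism, so the strongly closed subgroups are normal in \<open>S\<close> and the quotients
  below are groups.\<close>

definition supersolvable_fusion ::
    "('a, 'b) monoid_scheme \<Rightarrow> 'a set \<Rightarrow> 'a fusion \<Rightarrow> bool" where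
  "supersolvable_fusion G S F \<longleftrightarrow>
     (\<exists>(n::nat) (s :: nat \<Rightarrow> 'a set).
        s 0 = {\<one>\<^bsub>G\<^esub>} \<and> s n = S \<and>
        (\<forall>i<n. s i \<subseteq> s (Suc i)) \<and>
        (\<forall>i\<le>n. strongly_closed G S F (s i)) \<and>
        (\<forall>i<n. cyclic_group ((G\<lparr>carrier := s (Suc i)\<rparr>) Mod s i)))"

end

theory Submission
  imports Defs "HOL-Number_Theory.Residues"
begin

text \<open>Let \<open>R\<close> be a \<open>p\<close>-subgroup of \<open>G\<close> with normaliser \<open>N\<close>, and \<open>d = |D|\<close>. After conjugation into \<open>S\<close>, the
  hypothesis says that \<open>N\<close> stabilises every subgroup of \<open>R\<close> of order \<open>d\<close>.

  If \<open>|R| \<ge> p d\<close>, then \<open>R\<close> has a chain of \<open>N\<close>-stable subgroups with factors of order \<open>p\<close>. The chain starts inside a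
  cyclic subgroup of order \<open>d\<close> or, if there is none, inside a non-cyclic abelian subgroup of order \<open>p d\<close>. It is
  extended from \<open>M\<close> to a minimal stable \<open>Q > M\<close> as follows. If \<open>C\<^sub>Q(M) \<le> M\<close>, commutators with elements of \<open>M\<close>
  embed the chief factor \<open>Q / M\<close> into a factor of the chain of \<open>M\<close>. Otherwise \<open>Q = M C\<^sub>Q(M)\<close>, and either
  some \<open>t \<in> Q - M\<close> of order \<open>p\<close> (or \<open>4\<close>) lies in a stable subgroup of \<open>M\<langle>t\<rangle>\<close>, or the power map
  \<open>x \<mapsto> x ^ p\<close> on \<open>C\<^sub>Q(M)\<close> gives such an embedding. In all cases \<open>|Q / M| = p\<close>.

  Given such a chain, the \<open>p\<close>-elements of \<open>N / C\<^sub>G(R)\<close> are those acting trivially on its factors. They form a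
  normal \<open>p\<close>-subgroup, and Burnside's argument then shows that two Sylow subgroups containing \<open>R\<close> are
  conjugate in \<open>C\<^sub>G(R)\<close>; for small \<open>R\<close> the abelian overgroups of order \<open>p d\<close> serve instead.
  Hence the strongly closed subgroups of \<open>S\<close> are the \<open>N\<^sub>G(S)\<close>-stable ones, and the chain of \<open>S\<close> is the series
  required.\<close>

section \<open>Conjugation and p-subgroups\<close>

context group
begin

text \<open>A subgroup of order \<open>d\<close> is stable, but the hypothesis says nothing about
  the subgroups inside it, so it need not be a place to start a chain. A cyclic one is harmless,
  because every automorphism of a cyclic group is a power map. Without a cyclic one, order
  \<open>p * d\<close> is the right size: all maximal subgroups then have order \<open>d\<close> and
  are stable, which pins the action down modulo p-th powers.

  The prime 2 is exceptional because of the class-two identity (x y)^p = x^p y^p k^(p choose 2),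
  where k is the commutator and k^p = 1. For odd p the last factor vanishes. For p = 2 it is k
  itself, so squaring is multiplicative only modulo elements of order at most 2, and the elements to
  be controlled are those with t^4 = 1. An element of order 4 fits into a subgroup of order
  \<open>d\<close> unless \<open>d = 2\<close>; this is the origin of the extra hypothesis.

  Chains are built for the normaliser of every sufficiently large p-subgroup and not only for that
  of S, because Burnside's induction runs over all p-subgroups common to two Sylow
  subgroups.\<close>

definition cj :: "'a \<Rightarrow> 'a \<Rightarrow> 'a" where
  "cj g x = g \<otimes> x \<otimes> inv g"

definition stable :: "'a set \<Rightarrow> 'a set \<Rightarrow> bool" where
  "stable N H \<longleftrightarrow> (\<forall>g\<in>N. \<forall>h\<in>H. cj g h \<in> H)"

definition cent :: "'a set \<Rightarrow> 'a set" where
  "cent A = {g \<in> carrier G. \<forall>a\<in>A. cj g a = a}"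

text \<open>Inclusion replaces equality, which keeps membership elementwise. In a finite group the
  set is still closed under inverses (\<open>nrm_subgroup\<close>), and for a subgroup it is the
  library's \<open>normalizer\<close> (\<open>normalizer_eq_nrm\<close>).\<close>

definition nrm :: "'a set \<Rightarrow> 'a set" where
  "nrm A = {g \<in> carrier G. \<forall>a\<in>A. cj g a \<in> A}"

lemma cj_closed [simp, intro]: "g \<in> carrier G \<Longrightarrow> x \<in> carrier G \<Longrightarrow> cj g x \<in> carrier G"
  by (simp add: cj_def)

lemma cj_one [simp]: "g \<in> carrier G \<Longrightarrow> cj g \<one> = \<one>"
  by (simp add: cj_def)

lemma cj_by_one [simp]: "x \<in> carrier G \<Longrightarrow> cj \<one> x = x"
  by (simp add: cj_def)

lemma cj_mult: "g \<in> carrier G \<Longrightarrow> x \<in> carrier G \<Longrightarrow> y \<in> carrier G \<Longrightarrow> cj g (x \<otimes> y) = cj g x \<otimes> cj g y"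
  by (simp add: cj_def m_assoc) (metis inv_closed l_inv l_one m_assoc m_closed)

lemma cj_cj: "g \<in> carrier G \<Longrightarrow> h \<in> carrier G \<Longrightarrow> x \<in> carrier G \<Longrightarrow> cj g (cj h x) = cj (g \<otimes> h) x"
  by (simp add: cj_def m_assoc inv_mult_group)

lemma cj_inv_cj [simp]: "g \<in> carrier G \<Longrightarrow> x \<in> carrier G \<Longrightarrow> cj (inv g) (cj g x) = x"
  by (simp add: cj_cj)

lemma cj_cj_inv [simp]: "g \<in> carrier G \<Longrightarrow> x \<in> carrier G \<Longrightarrow> cj g (cj (inv g) x) = x"
  by (simp add: cj_cj)

lemma cj_eq_iff [simp]:
  "g \<in> carrier G \<Longrightarrow> x \<in> carrier G \<Longrightarrow> y \<in> carrier G \<Longrightarrow> cj g x = cj g y \<longleftrightarrow> x = y"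
  by (metis cj_inv_cj)

lemma cj_inv: "g \<in> carrier G \<Longrightarrow> x \<in> carrier G \<Longrightarrow> cj g (inv x) = inv (cj g x)"
  by (simp add: cj_def m_assoc inv_mult_group)

lemma cj_pow: "g \<in> carrier G \<Longrightarrow> x \<in> carrier G \<Longrightarrow> cj g (x [^] (n::nat)) = cj g x [^] n"
  by (induction n) (simp_all add: cj_mult)

lemma cj_fix_iff: "g \<in> carrier G \<Longrightarrow> x \<in> carrier G \<Longrightarrow> cj g x = x \<longleftrightarrow> g \<otimes> x = x \<otimes> g"
  unfolding cj_def by (metis inv_closed inv_solve_right m_closed)

lemma cj_inj_on: "g \<in> carrier G \<Longrightarrow> A \<subseteq> carrier G \<Longrightarrow> inj_on (cj g) A"
  by (rule inj_onI) (metis cj_eq_iff subsetD)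

lemma card_cj_image [simp]: "g \<in> carrier G \<Longrightarrow> A \<subseteq> carrier G \<Longrightarrow> card (cj g ` A) = card A"
  by (rule card_image) (rule cj_inj_on)

lemma cj_image_cj_image:
  "g \<in> carrier G \<Longrightarrow> h \<in> carrier G \<Longrightarrow> A \<subseteq> carrier G \<Longrightarrow> cj g ` cj h ` A = cj (g \<otimes> h) ` A"
  unfolding image_image by (rule image_cong) (auto simp: cj_cj)

lemma cj_image_inv [simp]:
  "g \<in> carrier G \<Longrightarrow> A \<subseteq> carrier G \<Longrightarrow> cj (inv g) ` cj g ` A = A"
  by (subst cj_image_cj_image) (auto simp: image_iff subset_iff)

lemma cj_image_subgroup:
  assumes "subgroup H G" "g \<in> carrier G"
  shows "subgroup (cj g ` H) G"
proof (rule subgroupI)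
  show "cj g ` H \<subseteq> carrier G" using assms subgroup.subset by fastforce
  show "cj g ` H \<noteq> {}" using assms subgroup.one_closed by blast
  show "inv a \<in> cj g ` H" if "a \<in> cj g ` H" for a
    using that assms by (auto simp: cj_inv [symmetric] subgroup.mem_carrier intro!: imageI subgroup.m_inv_closed [OF assms(1)])
  show "a \<otimes> b \<in> cj g ` H" if "a \<in> cj g ` H" "b \<in> cj g ` H" for a b
    using that assms by (auto simp: cj_mult [symmetric] subgroup.mem_carrier intro!: imageI subgroup.m_closed [OF assms(1)])
qed

lemma stableD: "stable N H \<Longrightarrow> g \<in> N \<Longrightarrow> h \<in> H \<Longrightarrow> cj g h \<in> H"
  by (simp add: stable_def)

lemma stable_mono: "stable N H \<Longrightarrow> N' \<subseteq> N \<Longrightarrow> stable N' H"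
  by (auto simp: stable_def)

lemma stable_self: "subgroup H G \<Longrightarrow> stable H H"
  by (simp add: stable_def cj_def subgroup.m_closed subgroup.m_inv_closed)

lemma nrm_carrier: "nrm A \<subseteq> carrier G"
  by (auto simp: nrm_def)

lemma stable_nrm: "stable (nrm A) A"
  by (simp add: stable_def nrm_def)

lemma subset_nrm_iff: "N \<subseteq> carrier G \<Longrightarrow> N \<subseteq> nrm A \<longleftrightarrow> stable N A"
  by (auto simp: stable_def nrm_def)

lemma cent_subset_nrm: "cent A \<subseteq> nrm A"
  by (auto simp: cent_def nrm_def)

lemma cent_mono: "A \<subseteq> B \<Longrightarrow> cent B \<subseteq> cent A"
  by (auto simp: cent_def)

lemma cent_carrier: "cent A \<subseteq> carrier G"
  by (auto simp: cent_def)

lemma centD: "g \<in> cent A \<Longrightarrow> a \<in> A \<Longrightarrow> cj g a = a"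
  by (auto simp: cent_def)

lemma cent_commute: "A \<subseteq> carrier G \<Longrightarrow> g \<in> cent A \<Longrightarrow> a \<in> A \<Longrightarrow> g \<otimes> a = a \<otimes> g"
  by (metis cj_fix_iff centD cent_carrier subsetD)

lemma cent_subgroup:
  assumes "A \<subseteq> carrier G"
  shows "subgroup (cent A) G"
proof (rule subgroupI)
  show "cent A \<noteq> {}" using assms by (auto simp: cent_def subset_iff intro!: exI[of _ \<one>])
  show "inv a \<in> cent A" if "a \<in> cent A" for a
    using that assms unfolding cent_def by simp (metis cj_inv_cj subsetD)
  show "a \<otimes> b \<in> cent A" if "a \<in> cent A" "b \<in> cent A" for a b
    using that assms by (auto simp: cent_def cj_cj [symmetric] subset_iff)
qed (auto simp: cent_def)

lemma cent_cj:
  assumes "A \<subseteq> carrier G" "g \<in> nrm A" "c \<in> cent A" "inv g \<in> nrm A"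
  shows "cj g c \<in> cent A"
proof -
  have g: "g \<in> carrier G" and c: "c \<in> carrier G" using assms by (auto simp: nrm_def cent_def)
  have "cj (cj g c) a = a" if "a \<in> A" for a
  proof -
    have a: "a \<in> carrier G" using that assms by auto
    have "cj (inv g) a \<in> A" using assms(4) that by (simp add: nrm_def)
    then have "cj c (cj (inv g) a) = cj (inv g) a" using assms(3) by (simp add: cent_def)
    then have "cj g (cj c (cj (inv g) a)) = a" using g a by simp
    moreover have "cj g (cj c (cj (inv g) a)) = cj (cj g c) a"
      using g c a by (simp add: cj_cj m_assoc) (simp add: cj_def m_assoc)
    ultimately show ?thesis by simp
  qed
  then show ?thesis using g c by (simp add: cent_def)
qed

lemma stable_Int: "stable N A \<Longrightarrow> stable N B \<Longrightarrow> stable N (A \<inter> B)"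
  by (auto simp: stable_def)

lemma cj_inv_mem:
  "subgroup N G \<Longrightarrow> stable N H \<Longrightarrow> g \<in> N \<Longrightarrow> h \<in> H \<Longrightarrow> cj (inv g) h \<in> H"
  by (meson stableD subgroup.m_inv_closed)

lemma subgroup_pow_closed: "subgroup H G \<Longrightarrow> x \<in> H \<Longrightarrow> x [^] (n::nat) \<in> H"
  by (induction n) (auto simp: subgroup.one_closed subgroup.m_closed)

lemma card_subgroup_dvd:
  assumes "subgroup H G" "subgroup K G" "H \<subseteq> K"
  shows "card H dvd card K"
proof -
  interpret K: group "G\<lparr>carrier := K\<rparr>" using assms(2) subgroup_imp_group by blast
  have "subgroup H (G\<lparr>carrier := K\<rparr>)" using assms subgroup_incl by blast
  from K.lagrange [OF this] have "card K = card (rcosets\<^bsub>G\<lparr>carrier := K\<rparr>\<^esub> H) * card H"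
    by (simp add: order_def)
  then show ?thesis by simp
qed

end

section \<open>p-subgroups of a finite group and adjunction of one element\<close>

locale finite_group_prime = group +
  fixes p :: nat
  assumes fin: "finite (carrier G)"
    and prime_p: "Factorial_Ring.prime p"
begin

lemma p_gt_1: "1 < p" using prime_p prime_gt_1_nat by blast
lemma p_gt_0: "0 < p" using p_gt_1 by simp

lemma fin_sub: "subgroup H G \<Longrightarrow> finite H"
  using fin finite_subset subgroup.subset by blast

lemma card_subgroup_pos: "subgroup H G \<Longrightarrow> 0 < card H"
  using fin_sub subgroup.one_closed by (metis card_gt_0_iff empty_iff)

lemma subgroup_mult_closedI:
  assumes "A \<subseteq> carrier G" "A \<noteq> {}" "\<And>a b. a \<in> A \<Longrightarrow> b \<in> A \<Longrightarrow> a \<otimes> b \<in> A"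
  shows "subgroup A G"
proof (rule subgroupI)
  fix a assume a: "a \<in> A"
  have pw: "a [^] (Suc n) \<in> A" for n by (induction n) (use a assms in auto)
  have ac: "a \<in> carrier G" using a assms by auto
  have o: "0 < order G" using fin order_gt_0_iff_finite by blast
  have "a [^] (order G - 1) \<otimes> a = a [^] order G"
    using o by (metis Suc_diff_1 nat_pow_Suc)
  then have "a [^] (order G - 1) \<otimes> a = \<one>" using ac pow_order_eq_1 by simp
  then have "inv a = a [^] (order G - 1)" using ac by (simp add: inv_equality)
  \<comment> \<open>\<open>pw\<close> covers positive exponents only; adding \<open>order G\<close>
    makes the exponent positive also when the group is trivial.\<close>
  also have "\<dots> = a [^] (order G - 1 + order G)" using ac by (simp add: nat_pow_mult [symmetric] pow_order_eq_1)
  also have "\<dots> \<in> A" using pw[of "order G - 1 + (order G - 1)"] o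
    by (metis Suc_diff_1 add_Suc_right)
  finally show "inv a \<in> A" .
qed (use assms in auto)

lemma nrm_subgroup:
  assumes "A \<subseteq> carrier G"
  shows "subgroup (nrm A) G"
proof (rule subgroup_mult_closedI)
  have "\<one> \<in> nrm A" using assms by (auto simp: nrm_def subset_iff)
  then show "nrm A \<noteq> {}" by auto
  show "a \<otimes> b \<in> nrm A" if "a \<in> nrm A" "b \<in> nrm A" for a b
    using that assms by (auto simp: nrm_def cj_cj [symmetric] subset_iff)
qed (auto simp: nrm_def)

definition psub :: "'a set \<Rightarrow> bool" where
  "psub H \<longleftrightarrow> subgroup H G \<and> (\<exists>j. card H = p ^ j)"

lemma psub_subgroup: "psub H \<Longrightarrow> subgroup H G"
  by (simp add: psub_def)

lemma psub_carrier: "psub H \<Longrightarrow> H \<subseteq> carrier G"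
  by (simp add: psub_def subgroup.subset)

lemma psub_sub: "psub R \<Longrightarrow> subgroup H G \<Longrightarrow> H \<subseteq> R \<Longrightarrow> psub H"
  unfolding psub_def using card_subgroup_dvd divides_primepow_nat prime_p by metis

lemma psub_cj: "psub R \<Longrightarrow> g \<in> carrier G \<Longrightarrow> psub (cj g ` R)"
  unfolding psub_def by (simp add: cj_image_subgroup subgroup.subset)

lemma psub_index_dvd:
  assumes "psub B" "subgroup A G" "A \<subset> B"
  shows "p * card A dvd card B"
proof -
  obtain i where i: "card A = p ^ i" using psub_sub assms psub_def by blast
  obtain j where j: "card B = p ^ j" using assms psub_def by blast
  have "card A < card B" using assms fin_sub psub_subgroup psubset_card_mono by metis
  then have "i < j" using i j p_gt_1 power_less_imp_less_exp by metis
  then have "p ^ Suc i dvd p ^ j" by (intro le_imp_power_dvd) simp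
  then show ?thesis using i j by simp
qed

lemma pow_card_eq_one:
  assumes "subgroup R G" "x \<in> R"
  shows "x [^] card R = \<one>"
proof -
  interpret R: group "G\<lparr>carrier := R\<rparr>" using assms subgroup_imp_group by blast
  have "x [^]\<^bsub>G\<lparr>carrier := R\<rparr>\<^esub> order (G\<lparr>carrier := R\<rparr>) = \<one>"
    using R.pow_order_eq_1 [of x] assms by simp
  then show ?thesis by (simp add: order_def nat_pow_consistent [symmetric])
qed

lemma psub_pow_eq_one: "psub R \<Longrightarrow> x \<in> R \<Longrightarrow> \<exists>m. x [^] (p ^ m) = \<one>"
  using pow_card_eq_one unfolding psub_def by metis

text \<open>By Bezout, t is a product of integer powers of \<open>t [^] a\<close> and
  \<open>t [^] b\<close>.\<close>

lemma pow_mem_coprime: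
  assumes "subgroup A G" "t \<in> carrier G" "t [^] (a::nat) \<in> A" "t [^] (b::nat) \<in> A" "coprime a b"
  shows "t \<in> A"
proof -
  have 1: "t [^] (int a) \<in> A" "t [^] (int b) \<in> A" using assms by (simp_all add: int_pow_int)
  obtain u v where uv: "u * int a + v * int b = 1"
    using assms(5) bezout_int[of "int a" "int b"] by auto
  have "t [^] (u * int a + v * int b) = (t [^] (int a)) [^] u \<otimes> (t [^] (int b)) [^] v"
    unfolding int_pow_mult [OF assms(2)] int_pow_pow [OF assms(2)] by (simp add: mult.commute)
  also have "\<dots> \<in> A" using 1 assms(1) by (meson int_pow_closed subgroup.m_closed subgroup_int_pow_closed)
  finally show ?thesis using uv assms(2) by (simp add: int_pow_1)
qed

text \<open>When t normalises the subgroup A, this is the subgroup generated by A and t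
  (\<open>adj_subgroup\<close>, \<open>adj_least\<close>); natural exponents suffice because t has
  finite order.\<close>

definition adj :: "'a set \<Rightarrow> 'a \<Rightarrow> 'a set" where
  "adj A t = {t [^] (i::nat) \<otimes> a | i a. a \<in> A}"

lemma cj_pow_stable:
  assumes "subgroup A G" "t \<in> carrier G" "\<And>a. a \<in> A \<Longrightarrow> cj t a \<in> A" "a \<in> A"
  shows "a \<otimes> t [^] (j::nat) \<in> (\<lambda>b. t [^] j \<otimes> b) ` A"
proof -
  have N: "t \<in> nrm A" using assms by (simp add: nrm_def)
  have "inv (t [^] j) \<in> nrm A"
    by (meson N assms(1) nrm_subgroup subgroup.m_inv_closed subgroup.subset subgroup_pow_closed)
  then have *: "cj (inv (t [^] j)) a \<in> A" using assms by (simp add: nrm_def)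
  have "t [^] j \<otimes> cj (inv (t [^] j)) a = a \<otimes> t [^] j"
    using assms subgroup.mem_carrier[OF assms(1) assms(4)]
    by (simp add: cj_def m_assoc[symmetric])
  then show ?thesis using * by (metis image_eqI)
qed

lemma adj_subgroup:
  assumes "subgroup A G" "t \<in> carrier G" "\<And>a. a \<in> A \<Longrightarrow> cj t a \<in> A"
  shows "subgroup (adj A t) G"
proof (rule subgroup_mult_closedI)
  show "adj A t \<subseteq> carrier G" using assms by (auto simp: adj_def subgroup.mem_carrier)
  show "adj A t \<noteq> {}" using assms subgroup.one_closed unfolding adj_def by blast
  fix x y assume "x \<in> adj A t" "y \<in> adj A t"
  then obtain i a j b where x: "x = t [^] (i::nat) \<otimes> a" "a \<in> A" and y: "y = t [^] (j::nat) \<otimes> b" "b \<in> A"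
    unfolding adj_def by blast
  obtain a' where a': "a' \<in> A" "a \<otimes> t [^] j = t [^] j \<otimes> a'"
    using cj_pow_stable[OF assms x(2), of j] by auto
  have c: "a \<in> carrier G" "b \<in> carrier G" "a' \<in> carrier G" using assms x y a' subgroup.mem_carrier by metis+
  have "x \<otimes> y = t [^] i \<otimes> (a \<otimes> t [^] j) \<otimes> b" using c x y assms by (simp add: m_assoc)
  also have "\<dots> = t [^] (i + j) \<otimes> (a' \<otimes> b)" using c a' assms by (simp add: m_assoc nat_pow_mult[symmetric])
  finally have "x \<otimes> y = t [^] (i + j) \<otimes> (a' \<otimes> b)" .
  moreover have "a' \<otimes> b \<in> A" using a' y assms(1) by (simp add: subgroup.m_closed)
  ultimately show "x \<otimes> y \<in> adj A t" unfolding adj_def by blast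
qed

lemma adj_contains: "subgroup A G \<Longrightarrow> t \<in> carrier G \<Longrightarrow> A \<subseteq> adj A t \<and> t \<in> adj A t"
proof (intro conjI subsetI)
  show "a \<in> adj A t" if "subgroup A G" "t \<in> carrier G" "a \<in> A" for a
    using that unfolding adj_def by (auto simp: subgroup.mem_carrier intro!: exI[of _ "0::nat"] exI[of _ a])
  show "t \<in> adj A t" if "subgroup A G" "t \<in> carrier G"
    using that unfolding adj_def by (auto simp: subgroup.one_closed intro!: exI[of _ "1::nat"] exI[of _ \<one>])
qed

lemma adj_least: "subgroup B G \<Longrightarrow> A \<subseteq> B \<Longrightarrow> t \<in> B \<Longrightarrow> adj A t \<subseteq> B"
  unfolding adj_def by (auto intro!: subgroup.m_closed subgroup_pow_closed)

text \<open>The cosets t^i A with i < p are distinct: otherwise t^(j-i) lies in A for some 0 < j-i <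
  p, and since this exponent is coprime to p, so does t. Exponents can be reduced below p because
  t^p lies in A.\<close>

lemma adj_card:
  assumes A: "subgroup A G" and t: "t \<in> carrier G" "t \<notin> A" "t [^] p \<in> A"
  shows "card (adj A t) = p * card A"
proof -
  let ?f = "\<lambda>(i::nat, a). t [^] i \<otimes> a"
  have Ac: "a \<in> carrier G" if "a \<in> A" for a using that A subgroup.mem_carrier by metis
  have key: False if "i < j" "j < p" "a \<in> A" "b \<in> A" "t [^] i \<otimes> a = t [^] j \<otimes> b" for i j a b
  proof -
    have "t [^] j = t [^] i \<otimes> t [^] (j - i)" using that t by (simp add: nat_pow_mult)
    then have "t [^] i \<otimes> a = t [^] i \<otimes> (t [^] (j - i) \<otimes> b)" using that t Ac by (simp add: m_assoc)
    then have "a = t [^] (j - i) \<otimes> b" using that t Ac by simp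
    then have "t [^] (j - i) = a \<otimes> inv b" using that t Ac by (simp add: m_assoc)
    then have "t [^] (j - i) \<in> A" using that A by (simp add: subgroup.m_closed subgroup.m_inv_closed)
    moreover have "coprime (j - i) p"
    proof -
      have "\<not> p dvd (j - i)" using that by (intro nat_dvd_not_less) auto
      then show ?thesis using prime_imp_coprime [OF prime_p] coprime_commute by blast
    qed
    ultimately show False using pow_mem_coprime A t by blast
  qed
  have "inj_on ?f ({..<p} \<times> A)"
  proof (rule inj_onI, clarify)
    fix i a j b assume h: "i < p" "j < p" "a \<in> A" "b \<in> A" "t [^] i \<otimes> a = t [^] j \<otimes> b"
    then have "i = j" using key[of i j a b] key[of j i b a] by (metis nat_neq_iff)
    then show "i = j \<and> a = b" using h Ac t by simp
  qed
  then have "card (?f ` ({..<p} \<times> A)) = p * card A" by (simp add: card_image card_cartesian_product)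
  moreover have "?f ` ({..<p} \<times> A) = adj A t"
  proof
    show "?f ` ({..<p} \<times> A) \<subseteq> adj A t" unfolding adj_def by auto
    show "adj A t \<subseteq> ?f ` ({..<p} \<times> A)"
    proof
      fix x assume "x \<in> adj A t"
      then obtain i a where x: "x = t [^] (i::nat) \<otimes> a" "a \<in> A" unfolding adj_def by blast
      have "t [^] i = t [^] (i mod p) \<otimes> (t [^] p) [^] (i div p)"
        using t by (simp add: nat_pow_pow nat_pow_mult)
      then have "x = t [^] (i mod p) \<otimes> ((t [^] p) [^] (i div p) \<otimes> a)"
        using x t Ac by (simp add: m_assoc)
      moreover have "(t [^] p) [^] (i div p) \<otimes> a \<in> A"
        using x t A by (simp add: subgroup.m_closed subgroup_pow_closed)
      moreover have "i mod p < p" using p_gt_0 by simp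
      ultimately show "x \<in> ?f ` ({..<p} \<times> A)" by (force intro!: rev_image_eqI)
    qed
  qed
  ultimately show ?thesis by simp
qed

end

section \<open>Sylow's theorems\<close>

text \<open>By the orbit-stabiliser theorem an orbit has p-power size. The orbits of size 1 are the
  fixed points, and all others contribute multiples of p.\<close>

lemma (in group) p_group_action_fixed_points:
  assumes order: "card (carrier G) = p ^ b" and p: "Factorial_Ring.prime (p::nat)" and E: "finite E"
    and closed: "\<And>g x. g \<in> carrier G \<Longrightarrow> x \<in> E \<Longrightarrow> act g x \<in> E"
    and one: "\<And>x. x \<in> E \<Longrightarrow> act \<one> x = x"
    and mult: "\<And>g h x. g \<in> carrier G \<Longrightarrow> h \<in> carrier G \<Longrightarrow> x \<in> E \<Longrightarrow> act (g \<otimes> h) x = act g (act h x)"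
  shows "card E mod p = card {x \<in> E. \<forall>g\<in>carrier G. act g x = x} mod p"
proof -
  \<comment> \<open>The restriction to E makes each map extensional, as membership in
    \<open>Bij E\<close> demands.\<close>
  define \<phi> where "\<phi> g = (\<lambda>x\<in>E. act g x)" for g
  have inv: "act (inv g) (act g x) = x" if "g \<in> carrier G" "x \<in> E" for g x
    using that mult[of "inv g" g x] one by simp
  have inv': "act g (act (inv g) x) = x" if "g \<in> carrier G" "x \<in> E" for g x
    using that mult[of g "inv g" x] one by simp
  have bij: "\<phi> g \<in> Bij E" if g: "g \<in> carrier G" for g
  proof -
    have "bij_betw (\<phi> g) E E"
      by (rule bij_betw_byWitness [where f' = "act (inv g)"]) (use g inv inv' closed in \<open>auto simp: \<phi>_def\<close>)
    then show ?thesis by (simp add: Bij_def \<phi>_def)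
  qed
  have "group_hom G (BijGroup E) \<phi>"
  proof (intro group_hom.intro group_hom_axioms.intro is_group group_BijGroup homI)
    show "\<phi> g \<in> carrier (BijGroup E)" if "g \<in> carrier G" for g
      using bij that by (simp add: BijGroup_def)
    show "\<phi> (g \<otimes> h) = \<phi> g \<otimes>\<^bsub>BijGroup E\<^esub> \<phi> h" if "g \<in> carrier G" "h \<in> carrier G" for g h
      using that bij by (auto simp: BijGroup_def \<phi>_def compose_def mult closed restrict_def fun_eq_iff)
  qed
  then interpret A: group_action G E \<phi> by (rule group_action.intro)
  define Fx where "Fx = {x \<in> E. \<forall>g\<in>carrier G. act g x = x}"
  have Fx: "Fx \<subseteq> E" by (auto simp: Fx_def)
  have orb: "orbit G \<phi> x = (\<lambda>g. act g x) ` carrier G" if "x \<in> E" for x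
    using that by (auto simp: orbit_def \<phi>_def)
  have card_orb: "p dvd card (orbit G \<phi> x)" if x: "x \<in> E - Fx" for x
  proof -
    have "card (orbit G \<phi> x) dvd p ^ b"
      using A.orbit_stabilizer_theorem [of x] x order unfolding order_def by (metis Diff_iff dvd_triv_left)
    then obtain i where i: "card (orbit G \<phi> x) = p ^ i" using p divides_primepow_nat by blast
    have "i \<noteq> 0"
    proof
      assume "i = 0"
      then obtain y where y: "orbit G \<phi> x = {y}" using i card_1_singletonE by auto
      have "x \<in> orbit G \<phi> x" using A.orbit_refl x by blast
      then have "act g x = x" if "g \<in> carrier G" for g using y orb x that by auto
      then show False using x by (simp add: Fx_def)
    qed
    then show ?thesis using i by (simp add: dvd_power)
  qed
  let ?C = "orbit G \<phi> ` (E - Fx)"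
  have sub: "orbit G \<phi> x \<subseteq> E - Fx" if x: "x \<in> E - Fx" for x
  proof
    fix y assume y: "y \<in> orbit G \<phi> x"
    then obtain g where g: "g \<in> carrier G" "y = act g x" using orb x by auto
    have "x = act (inv g) y" using g inv x by auto
    moreover have "act (inv g) y = y" if "y \<in> Fx" using that g by (simp add: Fx_def)
    ultimately have "y \<notin> Fx" using x by auto
    then show "y \<in> E - Fx" using g closed x by auto
  qed
  have U: "\<Union>?C = E - Fx"
    using sub A.orbit_refl by blast
  have "p dvd card (\<Union>?C)"
  proof (rule dvd_partition)
    show "finite (\<Union>?C)" using U E by simp
    show "\<forall>c\<in>?C. p dvd card c" using card_orb by blast
    show "\<forall>c1\<in>?C. \<forall>c2\<in>?C. c1 \<noteq> c2 \<longrightarrow> c1 \<inter> c2 = {}"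
      using A.disjoint_union unfolding orbits_def by blast
  qed
  then have "p dvd card E - card Fx" using U Fx E by (simp add: card_Diff_subset finite_subset)
  moreover have "card Fx \<le> card E" using Fx E card_mono by blast
  ultimately show ?thesis unfolding Fx_def using mod_eq_dvd_iff_nat by blast
qed

context finite_group_prime
begin

section \<open>Actions on left cosets: conjugation into Sylow subgroups, growth of
  normalisers\<close>

lemma lcos_eq_iff:
  assumes "subgroup P G" "a \<in> carrier G" "b \<in> carrier G"
  shows "a <# P = b <# P \<longleftrightarrow> inv a \<otimes> b \<in> P"
proof
  assume "a <# P = b <# P"
  moreover have "b \<in> b <# P" using assms by (auto simp: l_coset_def subgroup.one_closed intro!: bexI[of _ \<one>])
  ultimately obtain h where "h \<in> P" "b = a \<otimes> h" by (auto simp: l_coset_def)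
  then show "inv a \<otimes> b \<in> P" using assms by (simp add: m_assoc[symmetric] subgroup.mem_carrier[OF assms(1)])
next
  assume h: "inv a \<otimes> b \<in> P"
  have b: "b = a \<otimes> (inv a \<otimes> b)" using assms by (simp add: m_assoc[symmetric])
  have "b \<in> a <# P" unfolding l_coset_def using b h by blast
  then show "a <# P = b <# P" using l_repr_independence assms by blast
qed

lemma card_lcosets:
  assumes "subgroup P G" "subgroup K G" "P \<subseteq> K"
  shows "card ((\<lambda>k. k <# P) ` K) * card P = card K"
proof -
  have U: "\<Union>((\<lambda>k. k <# P) ` K) = K"
  proof
    show "\<Union>((\<lambda>k. k <# P) ` K) \<subseteq> K"
      using assms subgroup.m_closed [OF assms(2)] by (auto simp: l_coset_def)
    show "K \<subseteq> \<Union>((\<lambda>k. k <# P) ` K)"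
    proof
      fix k assume k: "k \<in> K"
      then have "k \<otimes> \<one> \<in> k <# P" unfolding l_coset_def using assms subgroup.one_closed by blast
      then show "k \<in> \<Union>((\<lambda>k. k <# P) ` K)" using k assms subgroup.mem_carrier [OF assms(2)] by auto
    qed
  qed
  have "card P * card ((\<lambda>k. k <# P) ` K) = card (\<Union>((\<lambda>k. k <# P) ` K))"
  proof (rule card_partition)
    show "finite ((\<lambda>k. k <# P) ` K)" using assms fin_sub by blast
    show "finite (\<Union>((\<lambda>k. k <# P) ` K))" using assms fin_sub U by simp
    show "card c = card P" if c: "c \<in> (\<lambda>k. k <# P) ` K" for c
    proof -
      obtain k where k: "k \<in> K" "c = (\<otimes>) k ` P" using c by (auto simp: l_coset_def)
      have "inj_on ((\<otimes>) k) P"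
        using k assms by (intro inj_onI) (simp add: subgroup.mem_carrier)
      then show ?thesis using k card_image by blast
    qed
    show "c1 \<inter> c2 = {}" if c: "c1 \<in> (\<lambda>k. k <# P) ` K" "c2 \<in> (\<lambda>k. k <# P) ` K" "c1 \<noteq> c2" for c1 c2
    proof (rule ccontr)
      assume "c1 \<inter> c2 \<noteq> {}"
      then obtain x where x: "x \<in> c1" "x \<in> c2" by blast
      obtain k l where k: "k \<in> K" "c1 = k <# P" "l \<in> K" "c2 = l <# P" using c by auto
      have "k \<in> carrier G" "l \<in> carrier G" using k subgroup.mem_carrier [OF assms(2)] by auto
      then have "k <# P = x <# P" "l <# P = x <# P"
        using l_repr_independence [of x k P] l_repr_independence [of x l P] x k(2,4) assms(1) by blast+
      then show False using c k by simp
    qed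
  qed
  then show ?thesis using U by (simp add: mult.commute)
qed

text \<open>B acts on the left cosets of P in K by left multiplication, and kP is fixed iff the
  conjugate of B by \<open>inv k\<close> lies in P. With P a Sylow subgroup this yields conjugation
  into P; with B = P it yields growth of normalisers.\<close>

lemma lcosets_fixed_points:
  assumes B: "psub B" and P: "subgroup P G" and K: "subgroup K G" and "P \<subseteq> K" "B \<subseteq> K"
  shows "card ((\<lambda>k. k <# P) ` K) mod p =
    card ((\<lambda>k. k <# P) ` {k \<in> K. \<forall>b\<in>B. cj (inv k) b \<in> P}) mod p"
proof -
  let ?X = "(\<lambda>k. k <# P) ` K"
  have Bs: "subgroup B G" using B psub_def by blast
  have Kc: "k \<in> carrier G" if "k \<in> K" for k using that K subgroup.mem_carrier by metis
  interpret B: group "G\<lparr>carrier := B\<rparr>" using Bs subgroup_imp_group by blast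
  obtain b where b: "card B = p ^ b" using B psub_def by blast
  have "card ?X mod p = card {x \<in> ?X. \<forall>g\<in>carrier (G\<lparr>carrier := B\<rparr>). g <# x = x} mod p"
  proof (rule B.p_group_action_fixed_points [of _ b])
    show "card (carrier (G\<lparr>carrier := B\<rparr>)) = p ^ b" using b by simp
    show "finite ?X" using K fin_sub by blast
    show "g <# x \<in> ?X" if gx: "g \<in> carrier (G\<lparr>carrier := B\<rparr>)" "x \<in> ?X" for g x
    proof -
      obtain k where k: "k \<in> K" "x = k <# P" using gx by blast
      have g: "g \<in> K" using gx assms by auto
      have "g <# x = (g \<otimes> k) <# P" using k g Kc lcos_m_assoc subgroup.subset[OF P] by simp
      moreover have "g \<otimes> k \<in> K" using k g K by (simp add: subgroup.m_closed)
      ultimately show ?thesis by blast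
    qed
    show "\<one>\<^bsub>G\<lparr>carrier := B\<rparr>\<^esub> <# x = x" if "x \<in> ?X" for x
      using that Kc by (auto simp: lcos_m_assoc subgroup.subset[OF P])
    show "(g \<otimes>\<^bsub>G\<lparr>carrier := B\<rparr>\<^esub> h) <# x = g <# (h <# x)"
      if ghx: "g \<in> carrier (G\<lparr>carrier := B\<rparr>)" "h \<in> carrier (G\<lparr>carrier := B\<rparr>)" "x \<in> ?X" for g h x
    proof -
      obtain k where k: "k \<in> carrier G" "x = k <# P" using ghx(3) Kc by blast
      have gh: "g \<in> carrier G" "h \<in> carrier G" using ghx Kc assms(5) by auto
      have "h <# (k <# P) = (h \<otimes> k) <# P" using k gh lcos_m_assoc subgroup.subset[OF P] by blast
      then show ?thesis using k gh by (simp add: lcos_m_assoc subgroup.subset[OF P] m_assoc)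
    qed
  qed (use prime_p in auto)
  moreover have "{x \<in> ?X. \<forall>g\<in>carrier (G\<lparr>carrier := B\<rparr>). g <# x = x} =
    (\<lambda>k. k <# P) ` {k \<in> K. \<forall>b\<in>B. cj (inv k) b \<in> P}"
  proof -
    have "(\<forall>b\<in>B. b <# (k <# P) = k <# P) \<longleftrightarrow> (\<forall>b\<in>B. cj (inv k) b \<in> P)" if k: "k \<in> K" for k
    proof (intro ball_cong refl)
      fix b assume "b \<in> B"
      then have bc: "b \<in> carrier G" using Bs subgroup.mem_carrier by metis
      have "b <# (k <# P) = (b \<otimes> k) <# P" using lcos_m_assoc bc Kc k subgroup.subset[OF P] by simp
      then show "b <# (k <# P) = k <# P \<longleftrightarrow> cj (inv k) b \<in> P"
        using lcos_eq_iff [OF P, of k "b \<otimes> k"] bc Kc[OF k] by (auto simp: cj_def m_assoc)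
    qed
    then show ?thesis by auto
  qed
  ultimately show ?thesis by simp
qed

lemma sylow_exists:
  assumes "subgroup K G"
  obtains P where "psub P" "P \<subseteq> K" "card P = p ^ multiplicity p (card K)"
proof -
  interpret K: group "G\<lparr>carrier := K\<rparr>" using assms subgroup_imp_group by blast
  have "card K \<noteq> 0" using assms card_subgroup_pos by fastforce
  then obtain m where m: "card K = p ^ multiplicity p (card K) * m"
    using multiplicity_decompose' multiplicity_dvd by blast
  have "\<exists>H. subgroup H (G\<lparr>carrier := K\<rparr>) \<and> card H = p ^ multiplicity p (card K)"
    by (rule sylow_thm [of p _ _ m]) (use prime_p m K.is_group assms fin_sub in \<open>auto simp: order_def\<close>)
  then obtain H where H: "subgroup H (G\<lparr>carrier := K\<rparr>)" "card H = p ^ multiplicity p (card K)" by blast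
  then have "H \<subseteq> K" "subgroup H G"
    using subgroup.subset[OF H(1)] incl_subgroup [OF assms H(1)] by auto
  then show ?thesis using H that by (auto simp: psub_def)
qed

text \<open>The number of cosets of P is prime to p, so B fixes at least one of them.\<close>

lemma conj_into_sylow:
  assumes K: "subgroup K G" and P: "psub P" "P \<subseteq> K" "\<not> p dvd card K div card P" and B: "psub B" "B \<subseteq> K"
  obtains k where "k \<in> K" "cj k ` B \<subseteq> P"
proof -
  have Ps: "subgroup P G" using P psub_def by blast
  have "card P > 0" using Ps card_subgroup_pos by blast
  then have "card ((\<lambda>k. k <# P) ` K) = card K div card P"
    using card_lcosets [OF Ps K P(2)] by (metis nonzero_mult_div_cancel_right less_numeral_extra(3))
  then have "card ((\<lambda>k. k <# P) ` K) mod p \<noteq> 0" using P by (simp add: mod_eq_0_iff_dvd)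
  then have "(\<lambda>k. k <# P) ` {k \<in> K. \<forall>b\<in>B. cj (inv k) b \<in> P} \<noteq> {}"
    using lcosets_fixed_points [OF B(1) Ps K P(2) B(2)] by force
  then obtain k where k: "k \<in> K" "\<forall>b\<in>B. cj (inv k) b \<in> P" by blast
  then have "inv k \<in> K" "cj (inv k) ` B \<subseteq> P" using K by (auto simp: subgroup.m_inv_closed)
  then show ?thesis using that by blast
qed

text \<open>A acts on its own cosets in B. Their number is divisible by p, hence so is the number of
  fixed ones. The coset A is fixed, so there is another fixed coset, and its representatives
  normalise A without lying in A.\<close>

lemma psub_normalizer_grows:
  assumes "psub B" "subgroup A G" "A \<subset> B"
  obtains t where "t \<in> B" "t \<notin> A" "\<forall>a\<in>A. cj t a \<in> A"
proof -
  let ?N = "{k \<in> B. \<forall>a\<in>A. cj (inv k) a \<in> A}"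
  have Bs: "subgroup B G" using assms psub_def by blast
  have pA: "psub A" using psub_sub assms by blast
  have Apos: "card A > 0" using assms card_subgroup_pos by blast
  have "card ((\<lambda>k. k <# A) ` B) * card A = card B" using card_lcosets assms Bs by blast
  moreover have "p * card A dvd card B" using psub_index_dvd assms by blast
  ultimately have "p dvd card ((\<lambda>k. k <# A) ` B)" using Apos by (metis dvd_times_right_cancel_iff less_numeral_extra(3))
  then have d: "p dvd card ((\<lambda>k. k <# A) ` ?N)"
    using lcosets_fixed_points [OF pA assms(2) Bs] assms(3) unfolding dvd_eq_mod_eq_0 by auto
  have one: "\<one> \<in> ?N" using assms Bs by (auto simp: subgroup.one_closed subgroup.mem_carrier)
  have "\<exists>t\<in>?N. t \<notin> A"
  proof (rule ccontr)
    assume "\<not> ?thesis"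
    then have "?N \<subseteq> A" by blast
    moreover have "k <# A = \<one> <# A" if "k \<in> A" for k
      using lcos_eq_iff [OF assms(2), of k \<one>] that assms(2)
      by (simp add: subgroup.mem_carrier subgroup.m_inv_closed)
    ultimately have "(\<lambda>k. k <# A) ` ?N \<subseteq> {\<one> <# A}" by blast
    then have "(\<lambda>k. k <# A) ` ?N = {\<one> <# A}" using one by blast
    then show False using d p_gt_1 by simp
  qed
  then obtain t where t: "t \<in> B" "t \<notin> A" "\<forall>a\<in>A. cj (inv t) a \<in> A" by blast
  have "t \<in> carrier G" using t Bs subgroup.mem_carrier by metis
  then have "inv t \<in> B" "inv t \<notin> A"
    using t subgroup.m_inv_closed [OF Bs, of t] subgroup.m_inv_closed [OF assms(2), of "inv t"] by auto
  then show ?thesis using t that by blast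
qed

text \<open>Supplies the elements that \<open>adj_card\<close> asks for: outside A, with p-th power
  in A. Such a power exists because t has p-power order.\<close>

lemma last_power_outside:
  assumes "psub R" "t \<in> R" "t \<notin> A" "subgroup A G"
  obtains i where "t [^] (p ^ i) \<notin> A" "(t [^] (p ^ i)) [^] p \<in> A"
proof -
  let ?Q = "\<lambda>i. t [^] (p ^ i) \<in> A"
  have tc: "t \<in> carrier G" using assms psub_carrier by blast
  obtain m where m: "?Q m" using psub_pow_eq_one assms subgroup.one_closed by metis
  define l where "l = (LEAST i. ?Q i)"
  have l: "?Q l" unfolding l_def using m by (rule LeastI)
  have "l \<noteq> 0" using l assms tc by (metis nat_pow_eone power_0)
  then obtain i where i: "l = Suc i" using not0_implies_Suc by blast
  have "\<not> ?Q i" using i not_less_Least[of i ?Q] unfolding l_def by simp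
  moreover have "(t [^] (p ^ i)) [^] p \<in> A" using l i tc by (simp add: nat_pow_pow mult.commute)
  ultimately show ?thesis using that by blast
qed

lemma psub_extend:
  assumes "psub B" "subgroup A G" "A \<subset> B"
  obtains A' where "subgroup A' G" "A \<subseteq> A'" "A' \<subseteq> B" "card A' = p * card A"
proof -
  obtain t0 where t0: "t0 \<in> B" "t0 \<notin> A" "\<forall>a\<in>A. cj t0 a \<in> A"
    using psub_normalizer_grows assms by blast
  obtain i where i: "t0 [^] (p ^ i) \<notin> A" "(t0 [^] (p ^ i)) [^] p \<in> A"
    using last_power_outside assms t0 by blast
  let ?t = "t0 [^] (p ^ i)"
  have "t0 \<in> nrm A" using t0 assms psub_carrier by (auto simp: nrm_def)
  then have "?t \<in> nrm A" using nrm_subgroup subgroup_pow_closed subgroup.subset[OF assms(2)] by blast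
  then have t: "?t \<in> carrier G" "\<And>a. a \<in> A \<Longrightarrow> cj ?t a \<in> A" by (auto simp: nrm_def)
  have tB: "?t \<in> B" using t0 subgroup_pow_closed assms psub_def by blast
  show ?thesis
  proof (rule that)
    show "subgroup (adj A ?t) G" using adj_subgroup assms t by blast
    show "A \<subseteq> adj A ?t" using adj_contains assms t by blast
    show "adj A ?t \<subseteq> B" using adj_least assms tB psub_def by blast
    show "card (adj A ?t) = p * card A" using adj_card assms t i by blast
  qed
qed

text \<open>Iterates \<open>psub_extend\<close>: as long as the order is below \<open>p ^ n\<close>,
  the subgroup is proper in B and its order can be multiplied by p.\<close>

lemma psub_extend_to:
  assumes "psub B" "subgroup A G" "A \<subseteq> B" "card A dvd p ^ n" "p ^ n dvd card B"
  obtains A' where "subgroup A' G" "A \<subseteq> A'" "A' \<subseteq> B" "card A' = p ^ n"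
proof -
  obtain a where a: "card A = p ^ a" using psub_sub assms psub_def by blast
  have "a \<le> n" using a assms p_gt_1 by (simp add: dvd_power_iff_le power_dvd_imp_le)
  have "\<exists>A'. subgroup A' G \<and> A \<subseteq> A' \<and> A' \<subseteq> B \<and> card A' = p ^ k" if "a \<le> k" "k \<le> n" for k
    using that
  proof (induction k rule: dec_induct)
    case base
    then show ?case using assms a by blast
  next
    case (step k)
    then obtain A' where A': "subgroup A' G" "A \<subseteq> A'" "A' \<subseteq> B" "card A' = p ^ k" by auto
    have "p ^ k < p ^ n" using step p_gt_1 by simp
    moreover have "p ^ n \<le> card B" using assms(1,5) fin_sub psub_def
      by (metis dvd_imp_le card_gt_0_iff empty_iff subgroup.one_closed)
    ultimately have "A' \<noteq> B" using A' by auto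
    then obtain A'' where "subgroup A'' G" "A' \<subseteq> A''" "A'' \<subseteq> B" "card A'' = p * card A'"
      using psub_extend [OF assms(1) A'(1)] A' by blast
    then show ?case using A' by (intro exI[of _ A'']) auto
  qed
  then show ?thesis using that \<open>a \<le> n\<close> by blast
qed

end

section \<open>Chains of stable subgroups\<close>

context finite_group_prime
begin

section \<open>Congruence modulo a subgroup and factors of order p\<close>

definition cong_mod :: "'a set \<Rightarrow> 'a \<Rightarrow> 'a \<Rightarrow> bool" where
  "cong_mod A x y \<longleftrightarrow> inv x \<otimes> y \<in> A"

lemma cong_mod_refl: "subgroup A G \<Longrightarrow> x \<in> carrier G \<Longrightarrow> cong_mod A x x"
  by (simp add: cong_mod_def subgroup.one_closed)

text \<open>\<open>cong_mod A\<close> is equality of the left cosets xA and yA. A need not be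
  normal; compatibility with products, powers and conjugation instead asks that the elements
  concerned lie in \<open>nrm A\<close>.\<close>

lemma cong_mod_sym:
  assumes "subgroup A G" "x \<in> carrier G" "y \<in> carrier G" "cong_mod A x y"
  shows "cong_mod A y x"
proof -
  have "inv (inv x \<otimes> y) \<in> A" using assms by (simp add: cong_mod_def subgroup.m_inv_closed)
  then show ?thesis using assms by (simp add: cong_mod_def inv_mult_group)
qed

lemma cong_mod_trans:
  assumes "subgroup A G" "x \<in> carrier G" "y \<in> carrier G" "z \<in> carrier G" "cong_mod A x y" "cong_mod A y z"
  shows "cong_mod A x z"
proof -
  have "(inv x \<otimes> y) \<otimes> (inv y \<otimes> z) \<in> A" using assms by (simp add: cong_mod_def subgroup.m_closed)
  moreover have "(inv x \<otimes> y) \<otimes> (inv y \<otimes> z) = inv x \<otimes> z"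
  proof -
    have "y \<otimes> (inv y \<otimes> z) = z" using assms by (simp add: m_assoc[symmetric])
    then show ?thesis using assms by (simp add: m_assoc)
  qed
  ultimately show ?thesis by (simp add: cong_mod_def)
qed

lemma nrm_inv: "A \<subseteq> carrier G \<Longrightarrow> g \<in> nrm A \<Longrightarrow> inv g \<in> nrm A"
  by (rule subgroup.m_inv_closed [OF nrm_subgroup])

lemma cong_mod_mult:
  assumes A: "subgroup A G" and "x \<in> carrier G" "x' \<in> carrier G" "y \<in> nrm A" "y' \<in> carrier G"
    "cong_mod A x x'" "cong_mod A y y'"
  shows "cong_mod A (x \<otimes> y) (x' \<otimes> y')"
proof -
  have y: "y \<in> carrier G" using assms nrm_carrier by blast
  have "inv y \<in> nrm A" using assms nrm_inv subgroup.subset by blast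
  then have "cj (inv y) (inv x \<otimes> x') \<in> A" using assms by (simp add: nrm_def cong_mod_def)
  then have "cj (inv y) (inv x \<otimes> x') \<otimes> (inv y \<otimes> y') \<in> A"
    using assms by (simp add: cong_mod_def subgroup.m_closed)
  moreover have "cj (inv y) (inv x \<otimes> x') \<otimes> (inv y \<otimes> y') = inv (x \<otimes> y) \<otimes> (x' \<otimes> y')"
  proof -
    have "y \<otimes> (inv y \<otimes> y') = y'" using y assms by (simp add: m_assoc[symmetric])
    then show ?thesis using y assms by (simp add: cj_def m_assoc inv_mult_group)
  qed
  ultimately show ?thesis by (simp add: cong_mod_def)
qed

lemma cong_mod_pow:
  assumes A: "subgroup A G" and "x \<in> nrm A" "x' \<in> carrier G" "cong_mod A x x'"
  shows "cong_mod A (x [^] (n::nat)) (x' [^] n)"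
proof (induction n)
  case 0
  then show ?case using A by (simp add: cong_mod_refl)
next
  case (Suc n)
  have "x \<in> carrier G" using assms nrm_carrier by blast
  then show ?case using Suc assms by (simp add: cong_mod_mult)
qed

lemma cong_mod_cj:
  assumes A: "subgroup A G" and "g \<in> nrm A" "x \<in> carrier G" "x' \<in> carrier G" "cong_mod A x x'"
  shows "cong_mod A (cj g x) (cj g x')"
proof -
  have g: "g \<in> carrier G" using assms nrm_carrier by blast
  have "cj g (inv x \<otimes> x') \<in> A" using assms by (simp add: nrm_def cong_mod_def)
  then show ?thesis using assms g by (simp add: cong_mod_def cj_mult cj_inv)
qed

lemma index_p_adj:
  assumes B: "psub B" and A: "subgroup A G" and "A \<subseteq> B" "card B = p * card A" and t: "t \<in> B" "t \<notin> A" "t [^] p \<in> A"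
  shows "adj A t = B"
proof (rule card_subset_eq)
  have Bs: "subgroup B G" using B psub_def by blast
  show "finite B" using Bs fin_sub by blast
  show "adj A t \<subseteq> B" using adj_least Bs assms by blast
  have "t \<in> carrier G" using t B psub_carrier by blast
  then show "card (adj A t) = card B" using adj_card assms by simp
qed

text \<open>The normaliser of A in B is strictly larger than A, and index p leaves no room below
  B.\<close>

lemma index_p_normal:
  assumes B: "psub B" and A: "subgroup A G" and "A \<subseteq> B" "card B = p * card A"
  shows "B \<subseteq> nrm A"
proof -
  have Bs: "subgroup B G" using B psub_def by blast
  have Apos: "card A > 0" using A card_subgroup_pos by blast
  then have "card A \<noteq> card B" using assms p_gt_1 by simp
  then have "A \<subset> B" using assms by blast
  then obtain t where t: "t \<in> B" "t \<notin> A" "\<forall>a\<in>A. cj t a \<in> A"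
    using psub_normalizer_grows B A by blast
  have sub: "subgroup (nrm A \<inter> B) G" using nrm_subgroup subgroup.subset[OF A] Bs by (intro subgroups_Inter_pair)
  have Asub: "A \<subseteq> nrm A" using subset_nrm_iff stable_self A subgroup.subset by blast
  have "t \<in> nrm A \<inter> B" using t B psub_carrier by (auto simp: nrm_def)
  then have "A \<subset> nrm A \<inter> B" using Asub assms t by blast
  then have "p * card A dvd card (nrm A \<inter> B)"
    using psub_index_dvd psub_sub[OF B sub] A by blast
  then have "card B \<le> card (nrm A \<inter> B)"
    using assms card_subgroup_pos sub by (simp add: dvd_imp_le)
  then have "nrm A \<inter> B = B" using fin_sub Bs by (intro card_seteq) auto
  then show ?thesis by blast
qed

text \<open>The last power \<open>b [^] (p ^ i)\<close> outside A generates B modulo A, so b is a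
  power of it modulo A. For i > 0 this puts a power of b with exponent coprime to p into A, and then
  b itself, which is excluded; so i = 0.\<close>

lemma index_p_pow:
  assumes B: "psub B" and A: "subgroup A G" and "A \<subseteq> B" "card B = p * card A" and b: "b \<in> B"
  shows "b [^] p \<in> A"
proof (cases "b \<in> A")
  case True
  then show ?thesis using A subgroup_pow_closed by blast
next
  case False
  have bc: "b \<in> carrier G" using b B psub_carrier by blast
  obtain i where i: "b [^] (p ^ i) \<notin> A" "(b [^] (p ^ i)) [^] p \<in> A"
    using last_power_outside B b False A by blast
  have "b [^] (p ^ i) \<in> B" using b B psub_subgroup subgroup_pow_closed by blast
  then have "adj A (b [^] (p ^ i)) = B" using index_p_adj assms i by blast
  then obtain j a where ja: "b = (b [^] (p ^ i)) [^] (j::nat) \<otimes> a" "a \<in> A"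
    using b unfolding adj_def by blast
  have ac: "a \<in> carrier G" using ja A subgroup.mem_carrier by metis
  have "i = 0"
  proof (rule ccontr)
    assume i0: "i \<noteq> 0"
    have "j \<noteq> 0" using ja False ac by (metis l_one nat_pow_0)
    then have pos: "0 < p ^ i * j" using p_gt_0 by simp
    have "b = b [^] (p ^ i * j) \<otimes> a" using ja(1) bc by (simp add: nat_pow_pow)
    also have "b [^] (p ^ i * j) = b \<otimes> b [^] (p ^ i * j - 1)"
      using pos bc by (metis Suc_diff_1 nat_pow_Suc2)
    finally have "b \<otimes> (b [^] (p ^ i * j - 1) \<otimes> a) = b \<otimes> \<one>" using bc ac by (simp add: m_assoc)
    then have "b [^] (p ^ i * j - 1) \<otimes> a = \<one>" using bc ac l_cancel [of b _ \<one>] by simp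
    then have "b [^] (p ^ i * j - 1) = inv a" using bc ac by (metis inv_equality inv_inv nat_pow_closed)
    then have 1: "b [^] (p ^ i * j - 1) \<in> A" using ja A by (simp add: subgroup.m_inv_closed)
    obtain m where m: "b [^] (p ^ m) \<in> A" using psub_pow_eq_one[OF B b] A subgroup.one_closed by metis
    have "coprime (p ^ i * j - 1) (p ^ m)"
    proof -
      have "\<not> p dvd p ^ i * j - 1"
      proof
        assume h: "p dvd p ^ i * j - 1"
        have "p dvd p ^ i * j" using i0 by (simp add: dvd_power)
        then have "p dvd p ^ i * j - (p ^ i * j - 1)" using h dvd_diff_nat by blast
        then show False using pos p_gt_1 by simp
      qed
      then show ?thesis using prime_imp_coprime [OF prime_p] coprime_commute coprime_power_right_iff by blast
    qed
    then show False using pow_mem_coprime[OF A bc 1 m] False by blast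
  qed
  then show ?thesis using i bc by simp
qed

text \<open>An element acting on a factor of order \<open>p\<close> as a scalar of \<open>p\<close>-power order acts trivially,
  since \<open>k ^ p ^ m\<close> and \<open>k\<close> agree modulo \<open>p\<close>.\<close>

lemma index_p_trivial_action:
  assumes B: "psub B" and A: "subgroup A G" and AB: "A \<subseteq> B" "card B = p * card A"
    and g: "g \<in> nrm A" "g \<in> nrm B" and triv: "\<And>b. b \<in> B \<Longrightarrow> cong_mod A b (cj (g [^] (p ^ m)) b)" and b: "b \<in> B"
  shows "cong_mod A b (cj g b)"
proof -
  have gc: "g \<in> carrier G" using g nrm_carrier by blast
  have bc: "b \<in> carrier G" using b B psub_carrier by blast
  have Bs: "subgroup B G" using B psub_def by blast
  have BN: "B \<subseteq> nrm A" using index_p_normal assms by blast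
  have cjB: "cj g x \<in> B" if "x \<in> B" for x using g that by (simp add: nrm_def)
  show ?thesis
  proof (cases "b \<in> A")
    case True
    then have "cj g b \<in> A" using g by (simp add: nrm_def)
    then show ?thesis using True A by (simp add: cong_mod_def subgroup.m_closed subgroup.m_inv_closed)
  next
    case False
    have bp: "b [^] p \<in> A" using index_p_pow B A AB b by blast
    have "adj A b = B" using index_p_adj B A AB b False bp by blast
    \<comment> \<open>b generates B modulo A, so its image determines a scalar k for the action of g
      on B / A.\<close>
    then obtain k a where ka: "cj g b = b [^] (k::nat) \<otimes> a" "a \<in> A" using cjB[OF b] unfolding adj_def by blast
    have ac: "a \<in> carrier G" using ka A subgroup.mem_carrier by metis
    have sc: "cong_mod A (b [^] k) (cj g b)"
      using ka ac bc by (simp add: cong_mod_def m_assoc[symmetric])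
    have powN: "b [^] (n::nat) \<in> nrm A" for n using b BN Bs subgroup_pow_closed by blast
    have it: "cong_mod A (b [^] (k ^ j)) (cj (g [^] j) b)" for j :: nat
    proof (induction j)
      case 0
      then show ?case using bc A by (simp add: cong_mod_refl)
    next
      case (Suc j)
      have "cong_mod A (cj g (b [^] (k ^ j))) (cj g (cj (g [^] j) b))"
        using cong_mod_cj A g Suc gc bc by simp
      moreover have "cong_mod A ((b [^] k) [^] (k ^ j)) (cj g (b [^] (k ^ j)))"
        using cong_mod_pow [OF A powN _ sc] gc bc by (simp add: cj_pow)
      moreover have "(b [^] k) [^] (k ^ j) = b [^] (k ^ Suc j)" using bc by (simp add: nat_pow_pow)
      moreover have "cj g (cj (g [^] j) b) = cj (g [^] Suc j) b" using gc bc nat_pow_Suc2[of g j] by (simp add: cj_cj)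
      ultimately show ?case using cong_mod_trans A gc bc
        by (metis cj_closed nat_pow_closed)
    qed
    have "cong_mod A (cj (g [^] (p ^ m)) b) b"
      using cong_mod_sym triv b A gc bc by simp
    then have fin: "cong_mod A (b [^] (k ^ (p ^ m))) b"
      using it cong_mod_trans A gc bc by (metis cj_closed nat_pow_closed)
    \<comment> \<open>This keeps the natural-number subtractions \<open>k ^ (p ^ m) - 1\<close> and
      \<open>k - 1\<close> below exact.\<close>
    have k0: "k \<noteq> 0"
    proof
      assume "k = 0"
      then have "cj g b \<in> A" using ka ac by simp
      moreover have "inv g \<in> nrm A" using nrm_inv g A subgroup.subset by blast
      ultimately have "cj (inv g) (cj g b) \<in> A" by (simp add: nrm_def)
      then show False using gc bc False by simp
    qed
    have pdiff: "b [^] (n - 1) \<in> A" if "cong_mod A (b [^] n) b" "n > 0" for n :: nat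
    proof -
      have "b [^] n = b [^] (n - 1) \<otimes> b" using that by (metis Suc_diff_1 nat_pow_Suc)
      then have "inv b \<otimes> inv (b [^] (n - 1)) \<otimes> b \<in> A" using that bc by (simp add: cong_mod_def inv_mult_group)
      then have "cj (inv b) (inv (b [^] (n - 1))) \<in> A" using bc by (simp add: cj_def)
      then have "cj b (cj (inv b) (inv (b [^] (n - 1)))) \<in> A" using BN b by (auto simp: nrm_def)
      then have "inv (b [^] (n - 1)) \<in> A" using bc by simp
      from subgroup.m_inv_closed[OF A this] show ?thesis using bc by simp
    qed
    have "b [^] (k ^ (p ^ m) - 1) \<in> A" using pdiff fin k0 by simp
    then have "\<not> coprime (k ^ (p ^ m) - 1) p" using pow_mem_coprime A bc bp False by blast
    then have 1: "p dvd k ^ (p ^ m) - 1"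
      using prime_imp_coprime [OF prime_p] coprime_commute by blast
    have "[k ^ (p ^ m) = k] (mod p)"
    proof (induction m)
      case (Suc m)
      have "[(k ^ (p ^ m)) ^ p = k ^ p] (mod p)" using Suc cong_pow by blast
      moreover have "[k ^ p = k] (mod p)"
      proof (cases "p dvd k")
        case True
        moreover have "p dvd k ^ p" using True p_gt_0 by (meson dvd_power dvd_trans)
        ultimately show ?thesis by (simp add: cong_def mod_eq_0_iff_dvd)
      next
        case False
        then have "[k ^ (p - 1) * k = 1 * k] (mod p)" using fermat_theorem prime_p cong_scalar_right by blast
        then show ?thesis using power_minus_mult[OF p_gt_0, of k] by (metis mult_1)
      qed
      ultimately have "[(k ^ (p ^ m)) ^ p = k] (mod p)" by (rule cong_trans)
      moreover have "(k ^ (p ^ m)) ^ p = k ^ (p ^ Suc m)" by (simp add: power_mult[symmetric] mult.commute)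
      ultimately show ?case by simp
    qed simp
    moreover have "[k ^ (p ^ m) = 1] (mod p)"
      using 1 k0 by (simp add: cong_altdef_nat Suc_leI)
    ultimately have "[k = 1] (mod p)" using cong_sym cong_trans by blast
    then have "p dvd k - 1" using k0 by (simp add: cong_altdef_nat)
    then obtain l where l: "k - 1 = p * l" by blast
    have "b [^] k = b \<otimes> b [^] (k - 1)" using k0 bc by (metis Suc_diff_1 nat_pow_Suc2 neq0_conv)
    also have "b [^] (k - 1) = (b [^] p) [^] l" using l bc by (simp add: nat_pow_pow)
    finally have "inv b \<otimes> b [^] k = (b [^] p) [^] l" using bc by (simp add: m_assoc[symmetric])
    then have "cong_mod A b (b [^] k)" using bp A subgroup_pow_closed by (simp add: cong_mod_def)
    then show ?thesis using sc cong_mod_trans A gc bc by (metis cj_closed nat_pow_closed)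
  qed
qed

text \<open>Only the top of the chain is recorded, so a statement about all its steps is proved by
  rule induction. Normality of each step and p-power orders are consequences of the indices
  (\<open>index_p_normal\<close>, \<open>pchain_psub_stable\<close>).\<close>

inductive pchain :: "'a set \<Rightarrow> 'a set \<Rightarrow> bool" for N where
  pchain_one: "pchain N {\<one>}"
| pchain_step: "pchain N A \<Longrightarrow> subgroup B G \<Longrightarrow> A \<subseteq> B \<Longrightarrow> card B = p * card A \<Longrightarrow> stable N B \<Longrightarrow> pchain N B"

lemma pchain_psub_stable:
  assumes "pchain N A" "N \<subseteq> carrier G"
  shows "psub A \<and> stable N A"
  using assms
proof (induction rule: pchain.induct)
  case pchain_one
  have "card {\<one>} = p ^ 0" by simp
  then show ?case using pchain_one triv_subgroup unfolding psub_def stable_def by (auto simp del: power_0)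
next
  case (pchain_step A B)
  then obtain j where "card A = p ^ j" unfolding psub_def by blast
  then have "card B = p ^ Suc j" using pchain_step by simp
  then show ?case using pchain_step unfolding psub_def by blast
qed

lemma pchain_psub: "pchain N A \<Longrightarrow> N \<subseteq> carrier G \<Longrightarrow> psub A"
  and pchain_stable: "pchain N A \<Longrightarrow> N \<subseteq> carrier G \<Longrightarrow> stable N A"
  using pchain_psub_stable by blast+

text \<open>If N stabilises A, these are the elements of N that induce on A an automorphism of
  p-power order.\<close>

definition pcent :: "'a set \<Rightarrow> 'a set \<Rightarrow> 'a set" where
  "pcent N A = {g \<in> N. \<exists>m. g [^] (p ^ m) \<in> cent A}"

text \<open>A p-power order action on a factor of order p is trivial, which gives one inclusion.
  Conversely let z be a p-power of g that centralises A, and let g act trivially on B / A. Then z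
  sends b to b a with a in A fixed by z, so z^n sends b to b a^n, and z^|A| centralises B.\<close>

lemma pcent_step:
  assumes N: "subgroup N G" and A: "psub A" "stable N A" and B: "psub B" "stable N B" and AB: "A \<subseteq> B" "card B = p * card A"
  shows "pcent N B = {g \<in> pcent N A. \<forall>b\<in>B. cong_mod A b (cj g b)}"
proof
  have As: "subgroup A G" and Bs: "subgroup B G" using A B psub_def by auto
  have Nc: "N \<subseteq> carrier G" using N subgroup.subset by blast
  have NA: "N \<subseteq> nrm A" and NB: "N \<subseteq> nrm B" using subset_nrm_iff Nc A B by auto
  have Bc: "b \<in> carrier G" if "b \<in> B" for b using that Bs subgroup.mem_carrier by metis
  show "pcent N B \<subseteq> {g \<in> pcent N A. \<forall>b\<in>B. cong_mod A b (cj g b)}"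
  proof
    fix g assume "g \<in> pcent N B"
    then obtain m where g: "g \<in> N" and m: "g [^] (p ^ m) \<in> cent B" unfolding pcent_def by blast
    have "g \<in> pcent N A" using g m cent_mono[OF AB(1)] unfolding pcent_def by blast
    moreover have "cong_mod A b (cj g b)" if "b \<in> B" for b
    proof (rule index_p_trivial_action [OF B(1) As AB _ _ _ that])
      show "cong_mod A b (cj (g [^] (p ^ m)) b)" if "b \<in> B" for b
        using m that Bc As by (simp add: centD cong_mod_refl)
    qed (use g NA NB in auto)
    ultimately show "g \<in> {g \<in> pcent N A. \<forall>b\<in>B. cong_mod A b (cj g b)}" by blast
  qed
  show "{g \<in> pcent N A. \<forall>b\<in>B. cong_mod A b (cj g b)} \<subseteq> pcent N B"
  proof
    fix g assume g0: "g \<in> {g \<in> pcent N A. \<forall>b\<in>B. cong_mod A b (cj g b)}"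
    then obtain m where g: "g \<in> N" and m: "g [^] (p ^ m) \<in> cent A" unfolding pcent_def by blast
    have gc: "g \<in> carrier G" using g Nc by blast
    have triv: "cong_mod A b (cj (g [^] (n::nat)) b)" if b: "b \<in> B" for b n
    proof (induction n)
      case 0
      then show ?case using b Bc As by (simp add: cong_mod_refl)
    next
      case (Suc n)
      have "cong_mod A (cj g b) (cj g (cj (g [^] n) b))"
        using cong_mod_cj[OF As _ _ _ Suc] g NA gc Bc b by auto
      moreover have "cong_mod A b (cj g b)" using g0 b by blast
      moreover have "cj g (cj (g [^] n) b) = cj (g [^] Suc n) b" using gc Bc b nat_pow_Suc2[of g n] by (simp add: cj_cj)
      ultimately show ?case
        using cong_mod_trans[OF As, of b "cj g b" "cj (g [^] Suc n) b"] gc Bc[OF b] by simp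
    qed
    let ?z = "g [^] (p ^ m)"
    have zc: "?z \<in> carrier G" using gc by simp
    obtain j where j: "card A = p ^ j" using A psub_def by blast
    have "?z [^] (p ^ j) \<in> cent B"
    proof -
      have "cj (?z [^] (p ^ j)) b = b" if b: "b \<in> B" for b
      proof -
        define a where "a = inv b \<otimes> cj ?z b"
        have aA: "a \<in> A" using triv[OF b] unfolding a_def cong_mod_def by blast
        have ac: "a \<in> carrier G" using aA As subgroup.mem_carrier by metis
        have za: "cj ?z b = b \<otimes> a" unfolding a_def using b Bc zc by (simp add: m_assoc[symmetric])
        have "cj (?z [^] (n::nat)) b = b \<otimes> a [^] n" for n
        proof (induction n)
          case 0
          then show ?case using b Bc by simp
        next
          case (Suc n)
          have "cj (?z [^] Suc n) b = cj ?z (cj (?z [^] n) b)" using zc b Bc nat_pow_Suc2[of ?z n] by (simp add: cj_cj)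
          also have "\<dots> = cj ?z b \<otimes> cj ?z (a [^] n)" unfolding Suc using zc b Bc ac by (simp add: cj_mult)
          also have "cj ?z (a [^] n) = a [^] n" using m aA As subgroup_pow_closed centD by blast
          finally show ?case using za b Bc ac nat_pow_Suc2[of a n] by (simp add: m_assoc)
        qed
        then show ?thesis using pow_card_eq_one[OF As aA] j b Bc by simp
      qed
      then show ?thesis using zc by (simp add: cent_def)
    qed
    then have "g [^] (p ^ (m + j)) \<in> cent B" using gc by (simp add: nat_pow_pow power_add)
    then show "g \<in> pcent N B" using g unfolding pcent_def by blast
  qed
qed

text \<open>Products of p-elements need not be p-elements, but acting trivially on every factor of
  the chain is inherited by products; \<open>pcent_step\<close> translates one condition into the
  other.\<close>

lemma pcent_subgroup:
  assumes "pchain N A" and N: "subgroup N G"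
  shows "subgroup (pcent N A) G"
proof -
  have Nc: "N \<subseteq> carrier G" using N subgroup.subset by blast
  have "\<forall>g\<in>pcent N A. \<forall>h\<in>pcent N A. g \<otimes> h \<in> pcent N A"
    using assms(1)
  proof (induction rule: pchain.induct)
    case pchain_one
    have "g \<in> cent {\<one>}" if "g \<in> N" for g using that Nc by (auto simp: cent_def)
    then have "pcent N {\<one>} = N" unfolding pcent_def using N subgroup_pow_closed by blast
    then show ?case using N subgroup.m_closed by auto
  next
    case (pchain_step A B)
    have A: "psub A" "stable N A" using pchain_step pchain_psub_stable Nc by auto
    have B: "psub B" "stable N B" using pchain.pchain_step[OF pchain_step(1-5)] pchain_psub_stable Nc by auto
    have As: "subgroup A G" using A psub_def by blast
    have Bc: "b \<in> carrier G" if "b \<in> B" for b using that B psub_carrier by blast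
    note eq = pcent_step [OF N A B pchain_step(3,4)]
    show ?case
    proof (intro ballI)
      fix g h assume g: "g \<in> pcent N B" and h: "h \<in> pcent N B"
      then have "g \<otimes> h \<in> pcent N A" using pchain_step eq by auto
      moreover have "cong_mod A b (cj (g \<otimes> h) b)" if b: "b \<in> B" for b
      proof -
        have gh: "g \<in> N" "h \<in> N" using g h by (auto simp: pcent_def)
        then have c: "g \<in> carrier G" "h \<in> carrier G" using Nc by auto
        have "g \<in> nrm A" using gh subset_nrm_iff Nc A by blast
        then have "cong_mod A (cj g b) (cj g (cj h b))"
          using cong_mod_cj[OF As] c Bc b h eq by auto
        moreover have "cong_mod A b (cj g b)" using g b eq by blast
        ultimately have "cong_mod A b (cj g (cj h b))"
          using cong_mod_trans[OF As, of b "cj g b" "cj g (cj h b)"] c Bc b by blast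
        then show ?thesis using c Bc b by (simp add: cj_cj)
      qed
      ultimately show "g \<otimes> h \<in> pcent N B" using eq by blast
    qed
  qed
  moreover have "\<one> \<in> pcent N A"
  proof -
    have "A \<subseteq> carrier G" using pchain_psub assms(1) Nc psub_carrier by blast
    then have "\<one> \<in> cent A" using cent_subgroup subgroup.one_closed by blast
    then show ?thesis using N subgroup.one_closed by (auto simp: pcent_def)
  qed
  ultimately show ?thesis using Nc by (intro subgroup_mult_closedI) (auto simp: pcent_def)
qed

section \<open>Conjugation of p-subgroups inside a p-extension\<close>

lemma prod_subgroup:
  assumes "subgroup P G" "subgroup C G" "stable P C"
  shows "subgroup {u \<otimes> c | u c. u \<in> P \<and> c \<in> C} G"
proof (rule subgroup_mult_closedI)
  have Pc: "P \<subseteq> carrier G" "C \<subseteq> carrier G" using assms subgroup.subset by auto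
  show "{u \<otimes> c | u c. u \<in> P \<and> c \<in> C} \<subseteq> carrier G" using Pc by auto
  show "{u \<otimes> c | u c. u \<in> P \<and> c \<in> C} \<noteq> {}" using assms subgroup.one_closed by blast
  fix x y assume "x \<in> {u \<otimes> c | u c. u \<in> P \<and> c \<in> C}" "y \<in> {u \<otimes> c | u c. u \<in> P \<and> c \<in> C}"
  then obtain u c v d where x: "x = u \<otimes> c" "u \<in> P" "c \<in> C" and y: "y = v \<otimes> d" "v \<in> P" "d \<in> C" by blast
  have cc: "u \<in> carrier G" "c \<in> carrier G" "v \<in> carrier G" "d \<in> carrier G" using x y Pc by auto
  have "cj (inv v) c \<in> C" using cj_inv_mem assms x y by blast
  then have "cj (inv v) c \<otimes> d \<in> C" using y assms by (simp add: subgroup.m_closed)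
  moreover have "u \<otimes> v \<in> P" using x y assms by (simp add: subgroup.m_closed)
  moreover have "x \<otimes> y = (u \<otimes> v) \<otimes> (cj (inv v) c \<otimes> d)"
  proof -
    have "v \<otimes> (inv v \<otimes> w) = w" if "w \<in> carrier G" for w using cc that by (simp add: m_assoc[symmetric])
    from this[of "c \<otimes> (v \<otimes> d)"]
    have "v \<otimes> (inv v \<otimes> (c \<otimes> (v \<otimes> d))) = c \<otimes> (v \<otimes> d)" using cc by simp
    then show ?thesis using x y cc by (simp add: cj_def m_assoc)
  qed
  ultimately show "x \<otimes> y \<in> {u \<otimes> c | u c. u \<in> P \<and> c \<in> C}" by blast
qed

text \<open>\<open>K / C\<close> is a \<open>p\<close>-group, so a Sylow subgroup \<open>P\<close> of \<open>K\<close> satisfies \<open>K = P C\<close>, and conjugation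
  into \<open>P\<close> can be achieved inside \<open>C\<close>.\<close>

lemma conj_in_p_extension:
  assumes K: "subgroup K G" and C: "subgroup C G" "C \<subseteq> K" "stable K C"
    and pK: "\<And>k. k \<in> K \<Longrightarrow> \<exists>m. k [^] (p ^ m) \<in> C"
    and A: "psub A" "A \<subseteq> K" and B: "psub B" "B \<subseteq> K"
  obtains c P where "c \<in> C" "psub P" "A \<subseteq> P" "cj c ` B \<subseteq> P"
proof -
  have Kc: "K \<subseteq> carrier G" using K subgroup.subset by blast
  have Kpos: "card K \<noteq> 0" using card_subgroup_pos K by fastforce
  obtain P0 where P0: "psub P0" "P0 \<subseteq> K" "card P0 = p ^ multiplicity p (card K)" using sylow_exists K by blast
  have np: "\<not> p dvd card K div card P0"
    using P0 Kpos multiplicity_decompose[of "card K" p] p_gt_1 by simp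
  obtain k1 where k1: "k1 \<in> K" "cj k1 ` A \<subseteq> P0" using conj_into_sylow[OF K P0(1,2) np A] by blast
  have k1c: "k1 \<in> carrier G" using k1 Kc by blast
  have ik1: "inv k1 \<in> K" using k1 K by (simp add: subgroup.m_inv_closed)
  \<comment> \<open>The Sylow subgroup is moved so as to contain A; from here on only B has to be
    conjugated.\<close>
  define P where "P = cj (inv k1) ` P0"
  have P: "psub P" unfolding P_def using psub_cj P0 k1c by simp
  have Ps: "subgroup P G" using P psub_def by blast
  have AP: "A \<subseteq> P"
  proof -
    have "cj (inv k1) ` cj k1 ` A \<subseteq> P" unfolding P_def using k1 by blast
    then show ?thesis using A psub_carrier k1c by simp
  qed
  have PK: "P \<subseteq> K" unfolding P_def using P0 ik1 stableD[OF stable_self[OF K]] by blast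
  have cP: "card P = p ^ multiplicity p (card K)" unfolding P_def using P0 k1c psub_carrier by simp
  obtain k where k: "k \<in> K" "cj k ` B \<subseteq> P" using conj_into_sylow[OF K P PK _ B] np cP P0 by metis
  define Q where "Q = {u \<otimes> c | u c. u \<in> P \<and> c \<in> C}"
  have Q: "subgroup Q G" unfolding Q_def using prod_subgroup Ps C stable_mono PK by blast
  have QK: "Q \<subseteq> K" unfolding Q_def using PK C K by (auto intro!: subgroup.m_closed[OF K])
  have PQ: "P \<subseteq> Q"
  proof
    fix u assume u: "u \<in> P"
    then have "u = u \<otimes> \<one>" using PK Kc by auto
    then show "u \<in> Q" unfolding Q_def using u C subgroup.one_closed by blast
  qed
  have CQ: "C \<subseteq> Q"
  proof
    fix u assume u: "u \<in> C"
    then have "u = \<one> \<otimes> u" using C Kc by auto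
    then show "u \<in> Q" unfolding Q_def using u Ps subgroup.one_closed by blast
  qed
  have Qpos: "card Q \<noteq> 0" using card_subgroup_pos Q by fastforce
  \<comment> \<open>Checked prime by prime. The p-part comes from P. For another prime q, an element
    t of a Sylow q-subgroup has a p-power in C and a q-power equal to \<open>\<one>\<close>, so t
    lies in C.\<close>
  have "card K dvd card Q"
  proof (rule multiplicity_le_imp_dvd[OF Kpos])
    fix q :: nat assume q: "Factorial_Ring.prime q"
    show "multiplicity q (card K) \<le> multiplicity q (card Q)"
    proof (cases "q = p")
      case True
      have "p ^ multiplicity p (card K) dvd card Q" using card_subgroup_dvd[OF Ps Q PQ] cP by simp
      then show ?thesis using True Qpos prime_p by (intro multiplicity_geI) auto
    next
      case False
      interpret q: finite_group_prime G q by unfold_locales (use fin q in auto)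
      obtain T where T: "q.psub T" "T \<subseteq> K" "card T = q ^ multiplicity q (card K)" using q.sylow_exists K by blast
      have Ts: "subgroup T G" using T q.psub_def by blast
      have "T \<subseteq> C"
      proof
        fix t assume t: "t \<in> T"
        obtain m where m: "t [^] (p ^ m) \<in> C" using pK t T by blast
        obtain n where n: "t [^] (q ^ n) = \<one>" using q.psub_pow_eq_one T t by blast
        have "coprime (p ^ m) (q ^ n)"
          using False prime_p q primes_coprime coprime_power_left_iff coprime_power_right_iff by blast
        then show "t \<in> C" using pow_mem_coprime[OF C(1) _ m, of "q ^ n"] n C t T Kc subgroup.one_closed[OF C(1)] by (metis subsetD)
      qed
      then have "q ^ multiplicity q (card K) dvd card Q" using card_subgroup_dvd[OF Ts Q] CQ T by auto
      then show ?thesis using Qpos q by (intro multiplicity_geI) auto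
    qed
  qed
  then have "card K \<le> card Q" using Qpos dvd_imp_le by blast
  then have "Q = K" using QK fin_sub K card_seteq by blast
  \<comment> \<open>The factor u lies in P and so normalises it; dropping u leaves a conjugating
    element of C.\<close>
  then obtain u c where uc: "k = u \<otimes> c" "u \<in> P" "c \<in> C" using k unfolding Q_def by blast
  have ucc: "u \<in> carrier G" "c \<in> carrier G" using uc PK C Kc by auto
  have "cj c ` B \<subseteq> P"
  proof
    fix x assume "x \<in> cj c ` B"
    then obtain b where b: "b \<in> B" "x = cj c b" by blast
    have bc: "b \<in> carrier G" using b B psub_carrier by blast
    have "cj k b \<in> P" using k b by blast
    then have "cj (inv u) (cj k b) \<in> P" using cj_inv_mem[OF Ps stable_self[OF Ps] uc(2)] by blast
    moreover have "cj k b = cj u (cj c b)" using uc ucc bc by (simp add: cj_cj)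
    ultimately show "x \<in> P" using b ucc bc by simp
  qed
  then show ?thesis using that uc P AP by blast
qed

section \<open>Chains in abelian p-groups\<close>

lemma adj_stable:
  assumes N: "subgroup N G" and A: "subgroup A G" "stable N A" and t: "t \<in> carrier G"
    and sub: "subgroup (adj A t) G" and mem: "\<And>g. g \<in> N \<Longrightarrow> cj g t \<in> adj A t"
  shows "stable N (adj A t)"
  unfolding stable_def
proof (intro ballI)
  fix g x assume g: "g \<in> N" and "x \<in> adj A t"
  then obtain i a where x: "x = t [^] (i::nat) \<otimes> a" "a \<in> A" unfolding adj_def by blast
  have gc: "g \<in> carrier G" "a \<in> carrier G" using g x N A subgroup.mem_carrier by metis+
  have "cj g x = cj g t [^] i \<otimes> cj g a" using x gc t by (simp add: cj_mult cj_pow)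
  moreover have "cj g t [^] i \<in> adj A t" using mem[OF g] sub subgroup_pow_closed by blast
  moreover have "cj g a \<in> adj A t" using A(2) g x adj_contains[OF A(1) t] by (auto simp: stable_def)
  ultimately show "cj g x \<in> adj A t" using sub by (simp add: subgroup.m_closed)
qed

lemma cj_commute: "x \<in> carrier G \<Longrightarrow> y \<in> carrier G \<Longrightarrow> x \<otimes> y = y \<otimes> x \<Longrightarrow> cj x y = y"
  by (simp add: cj_fix_iff)

text \<open>If \<open>i\<close> is largest with \<open>V ^ (p ^ i)\<close> not inside the stable subgroup \<open>A\<close>, then \<open>N\<close> acts on
  \<open>V ^ (p ^ i) A / A\<close> by scalars, so adjoining any \<open>x ^ (p ^ i)\<close> keeps \<open>A\<close> stable.\<close>

lemma pchain_abelian: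
  assumes N: "subgroup N G" and V: "psub V" "stable N V"
    and comm: "\<And>x y. x \<in> V \<Longrightarrow> y \<in> V \<Longrightarrow> x \<otimes> y = y \<otimes> x"
    and act: "\<And>g x. g \<in> N \<Longrightarrow> x \<in> V \<Longrightarrow> \<exists>k y. y \<in> V \<and> cj g x = x [^] (k::nat) \<otimes> y [^] p"
  shows "pchain N V"
proof -
  have Vs: "subgroup V G" using V psub_def by blast
  have Vc: "x \<in> carrier G" if "x \<in> V" for x using that V psub_carrier by blast
  have Nc: "N \<subseteq> carrier G" using N subgroup.subset by blast
  have step: "\<exists>A'. pchain N A' \<and> A' \<subseteq> V \<and> card A < card A'" if A: "pchain N A" "A \<subset> V" for A
  proof -
    have As: "subgroup A G" using pchain_psub A Nc psub_def by blast
    let ?Q = "\<lambda>i. \<forall>x\<in>V. x [^] (p ^ i) \<in> A"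
    obtain v where v: "card V = p ^ v" using V psub_def by blast
    have "?Q v" using pow_card_eq_one[OF Vs] v As subgroup.one_closed by metis
    define l where "l = (LEAST i. ?Q i)"
    have l: "?Q l" unfolding l_def by (rule LeastI[of ?Q]) fact
    have "\<not> ?Q 0" using A Vc by auto
    then have "l \<noteq> 0" using l by metis
    then obtain i where i: "l = Suc i" using not0_implies_Suc by blast
    have "\<not> ?Q i" using i not_less_Least[of i ?Q] unfolding l_def by simp
    then obtain x where x: "x \<in> V" "x [^] (p ^ i) \<notin> A" by blast
    let ?t = "x [^] (p ^ i)"
    have tV: "?t \<in> V" using x Vs subgroup_pow_closed by blast
    have tc: "?t \<in> carrier G" using tV Vc by blast
    have tp: "?t [^] p \<in> A" using l i x Vc by (simp add: nat_pow_pow mult.commute)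
    have sub: "subgroup (adj A ?t) G"
    proof (rule adj_subgroup[OF As tc])
      fix a assume "a \<in> A"
      moreover from this have "a \<in> V" using A by blast
      ultimately show "cj ?t a \<in> A" using cj_commute[OF tc Vc comm[OF tV]] by simp
    qed
    have card: "card (adj A ?t) = p * card A" using adj_card As tc x tp by blast
    have cont: "A \<subseteq> adj A ?t" "?t \<in> adj A ?t" using adj_contains As tc by blast+
    have "stable N (adj A ?t)"
    proof (rule adj_stable[OF N As pchain_stable[OF A(1) Nc] tc sub])
      fix g assume g: "g \<in> N"
      have gc: "g \<in> carrier G" using g Nc by blast
      obtain k y where y: "y \<in> V" "cj g x = x [^] (k::nat) \<otimes> y [^] p" using act[OF g x(1)] by blast
      have "cj g ?t = (x [^] k \<otimes> y [^] p) [^] (p ^ i)" using gc x Vc y by (simp add: cj_pow)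
      also have "\<dots> = (x [^] k) [^] (p ^ i) \<otimes> (y [^] p) [^] (p ^ i)"
        using x y Vc comm Vs subgroup_pow_closed by (intro pow_mult_distrib) auto
      also have "\<dots> = ?t [^] k \<otimes> y [^] (p ^ l)"
        using x y Vc i by (simp add: nat_pow_pow mult.commute)
      also have "\<dots> \<in> adj A ?t"
        using l y cont subgroup_pow_closed[OF sub cont(2)] by (intro subgroup.m_closed[OF sub]) auto
      finally show "cj g ?t \<in> adj A ?t" .
    qed
    then have "pchain N (adj A ?t)" by (rule pchain_step[OF A(1) sub cont(1) card])
    moreover have "adj A ?t \<subseteq> V" using adj_least Vs A tV by blast
    moreover have "card A < card (adj A ?t)" using card card_subgroup_pos[OF As] p_gt_1 by simp
    ultimately show ?thesis by blast
  qed
  let ?P = "\<lambda>A. pchain N A \<and> A \<subseteq> V"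
  have 1: "?P {\<one>}" using pchain_one subgroup.one_closed[OF Vs] by simp
  have 2: "\<forall>A. ?P A \<longrightarrow> card A < Suc (card V)" using fin_sub[OF Vs] by (simp add: card_mono le_imp_less_Suc)
  obtain A where A: "?P A" "\<forall>B. ?P B \<longrightarrow> card B \<le> card A"
    using ex_has_greatest_nat[OF 1 2] by blast
  then have "A = V" using step[of A] by (meson leD psubsetI)
  then show ?thesis using A by blast
qed

end

section \<open>Orders of chief factors\<close>

text \<open>Q / M is a chief factor for the action of N. Since Q lies in N, elements of Q act on the
  chain of M as well, and M is normal in Q.\<close>

locale chief_step = finite_group_prime +
  fixes N Q M
  assumes N: "subgroup N G" and Q: "psub Q" "Q \<subseteq> N" "stable N Q" and M: "pchain N M" "M \<subset> Q"
    and minimal: "\<And>L. subgroup L G \<Longrightarrow> stable N L \<Longrightarrow> M \<subseteq> L \<Longrightarrow> L \<subseteq> Q \<Longrightarrow> L = M \<or> L = Q"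
begin

lemma Nc: "N \<subseteq> carrier G" using N subgroup.subset by blast
lemma Qs: "subgroup Q G" using Q(1) by (rule psub_subgroup)
lemma Qc: "x \<in> Q \<Longrightarrow> x \<in> carrier G" using Q psub_carrier by blast
lemma Mp: "psub M" using M pchain_psub Nc by blast
lemma Ms: "subgroup M G" using Mp psub_def by blast
lemma Mst: "stable N M" using M pchain_stable Nc by blast
lemma MQ: "x \<in> M \<Longrightarrow> x \<in> Q" using M by blast
lemma QN: "x \<in> Q \<Longrightarrow> x \<in> N" using Q by blast
lemma N_nrm: "stable N A \<Longrightarrow> x \<in> N \<Longrightarrow> x \<in> nrm A" using subset_nrm_iff Nc by blast
lemma N_inv: "x \<in> N \<Longrightarrow> inv x \<in> N" using N by (simp add: subgroup.m_inv_closed)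

lemma psub_trivial_action:
  assumes "subgroup A G" "A \<subseteq> B" "psub B" "card B = p * card A" "stable N A" "stable N B" "x \<in> Q" "b \<in> B"
  shows "cong_mod A b (cj x b)"
proof -
  obtain m where m: "x [^] (p ^ m) = \<one>" using psub_pow_eq_one Q assms by blast
  show ?thesis
  proof (rule index_p_trivial_action[OF assms(3,1,2,4), of x m])
    show "cong_mod A b (cj (x [^] (p ^ m)) b)" if "b \<in> B" for b
      using m that assms(1) psub_carrier[OF assms(3)] by (auto simp: cong_mod_refl)
  qed (use assms N_nrm QN in auto)
qed

text \<open>N permutes the subgroups of index p in Q that contain M, so their intersection is stable
  and, by minimality, equal to M. Each of them contains all p-th powers and commutators of Q. Thus Q
  / M is elementary abelian.\<close>

lemma frattini_factor:
  shows "x \<in> Q \<Longrightarrow> x [^] p \<in> M" and "x \<in> Q \<Longrightarrow> y \<in> Q \<Longrightarrow> cong_mod M x (cj y x)"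
proof -
  let ?F = "{A. subgroup A G \<and> M \<subseteq> A \<and> A \<subseteq> Q \<and> card Q = p * card A}"
  have ne: "?F \<noteq> {}"
  proof -
    obtain n where n: "card Q = p ^ n" using Q psub_def by blast
    have d: "p * card M dvd p ^ n" using psub_index_dvd[OF Q(1) Ms] M n by simp
    have n0: "n \<noteq> 0" using d p_gt_1 by (intro notI) simp
    then obtain n' where n': "n = Suc n'" using not0_implies_Suc by blast
    have d1: "card M dvd p ^ n'" using d n' p_gt_0 by simp
    have d2: "p ^ n' dvd card Q" using n n' by simp
    obtain A where "subgroup A G" "M \<subseteq> A" "A \<subseteq> Q" "card A = p ^ n'"
      by (rule psub_extend_to[OF Q(1) Ms psubset_imp_subset[OF M(2)] d1 d2])
    moreover from this have "card Q = p * card A" using n n' by simp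
    ultimately have "A \<in> ?F" by (intro CollectI conjI)
    then show ?thesis by (metis empty_iff)
  qed
  have I: "subgroup (\<Inter>?F) G" by (rule subgroups_Inter) (use ne in auto)
  have "stable N (\<Inter>?F)"
    unfolding stable_def
  proof (intro ballI InterI)
    fix g x A assume g: "g \<in> N" and x: "x \<in> \<Inter>?F" and A: "A \<in> ?F"
    have gc: "g \<in> carrier G" using g Nc by blast
    have Ac: "A \<subseteq> carrier G" using A subgroup.subset by blast
    have "cj (inv g) ` A \<in> ?F"
    proof (intro CollectI conjI)
      show "subgroup (cj (inv g) ` A) G" using A gc cj_image_subgroup by simp
      show "cj (inv g) ` A \<subseteq> Q" using A Q(3) N_inv[OF g] by (auto simp: stable_def)
      show "card Q = p * card (cj (inv g) ` A)" using A Ac gc by simp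
      show "M \<subseteq> cj (inv g) ` A"
      proof
        fix m assume m: "m \<in> M"
        then have "cj g m \<in> A" using Mst g A by (auto simp: stable_def)
        moreover have "m = cj (inv g) (cj g m)" using m gc Ms subgroup.mem_carrier by (metis cj_inv_cj)
        ultimately show "m \<in> cj (inv g) ` A" by blast
      qed
    qed
    then have "x \<in> cj (inv g) ` A" using x by blast
    then show "cj g x \<in> A" using gc Ac by auto
  qed
  moreover have "M \<subseteq> \<Inter>?F" by blast
  moreover have "\<Inter>?F \<subseteq> Q" "\<Inter>?F \<noteq> Q"
  proof -
    obtain A where A: "A \<in> ?F" using ne by blast
    then have "card A \<noteq> card Q" using p_gt_1 card_subgroup_pos[of A] by auto
    then have "A \<subset> Q" using A by auto
    then show "\<Inter>?F \<subseteq> Q" "\<Inter>?F \<noteq> Q" using A by blast+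
  qed
  ultimately have eq: "\<Inter>?F = M" using minimal[OF I] by blast
  show "x [^] p \<in> M" if x: "x \<in> Q"
  proof -
    have "x [^] p \<in> A" if "A \<in> ?F" for A using index_p_pow[OF Q(1)] that x by blast
    then have "x [^] p \<in> \<Inter>?F" by blast
    then show ?thesis using eq by simp
  qed
  show "cong_mod M x (cj y x)" if x: "x \<in> Q" "y \<in> Q"
  proof -
    have "inv x \<otimes> cj y x \<in> A" if A: "A \<in> ?F" for A
    proof -
      obtain m where m: "y [^] (p ^ m) = \<one>" using psub_pow_eq_one Q x by blast
      have As: "subgroup A G" "A \<subseteq> Q" "card Q = p * card A" using A by auto
      have "cong_mod A x (cj y x)"
      proof (rule index_p_trivial_action[OF Q(1) As(1,2,3), of y m])
        show "y \<in> nrm A" using index_p_normal[OF Q(1) As] x by blast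
        show "cong_mod A b (cj (y [^] (p ^ m)) b)" if "b \<in> Q" for b
          using m that As(1) Qc by (simp add: cong_mod_refl)
      qed (use x N_nrm QN Q in auto)
      then show ?thesis unfolding cong_mod_def .
    qed
    then have "inv x \<otimes> cj y x \<in> \<Inter>?F" by blast
    then show ?thesis unfolding cong_mod_def eq .
  qed
qed

text \<open>The product L M is stable and strictly larger than M, so minimality makes it Q.\<close>

lemma complement_factor:
  assumes L: "subgroup L G" "stable N L" "L \<subseteq> Q" "\<not> L \<subseteq> M" and q: "q \<in> Q"
  obtains l m where "l \<in> L" "m \<in> M" "q = l \<otimes> m"
proof -
  let ?P = "{u \<otimes> c | u c. u \<in> L \<and> c \<in> M}"
  have Lc: "l \<in> carrier G" if "l \<in> L" for l using that L Qc by blast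
  have Mc: "m \<in> carrier G" if "m \<in> M" for m using that MQ Qc by blast
  have P: "subgroup ?P G"
    by (rule prod_subgroup[OF L(1) Ms]) (use Mst L Q stable_mono in blast)
  moreover have "stable N ?P"
    unfolding stable_def
  proof (intro ballI)
    fix g x assume g: "g \<in> N" and "x \<in> ?P"
    then obtain u c where x: "x = u \<otimes> c" "u \<in> L" "c \<in> M" by blast
    have "cj g x = cj g u \<otimes> cj g c" using x g Lc Mc Nc by (auto intro: cj_mult)
    moreover have "cj g u \<in> L" "cj g c \<in> M" using x g L(2) Mst by (auto simp: stable_def)
    ultimately show "cj g x \<in> ?P" by blast
  qed
  moreover have "M \<subseteq> ?P"
  proof
    fix m assume m: "m \<in> M"
    then have "m = \<one> \<otimes> m" using Mc by simp
    then show "m \<in> ?P" using m L subgroup.one_closed by blast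
  qed
  moreover have "?P \<subseteq> Q" using L MQ by (auto intro!: subgroup.m_closed[OF Qs])
  moreover have "L \<subseteq> ?P"
  proof
    fix l assume l: "l \<in> L"
    then have "l = l \<otimes> \<one>" using Lc by simp
    then show "l \<in> ?P" using l Ms subgroup.one_closed by blast
  qed
  ultimately have "?P = Q" using minimal[of ?P] L by blast
  then show ?thesis using q that by blast
qed

text \<open>L meets every coset of M in Q, and f separates these cosets by cosets of A in B; hence
  |Q / M| is at most |B / A| = p. Only cosets are counted, so f may be any map.\<close>

lemma index_bound:
  assumes L: "subgroup L G" "stable N L" "L \<subseteq> Q" "\<not> L \<subseteq> M"
    and AB: "subgroup A G" "subgroup B G" "A \<subseteq> B" "card B = p * card A"
    and f: "\<And>x. x \<in> L \<Longrightarrow> f x \<in> B"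
    and inj: "\<And>x y. x \<in> L \<Longrightarrow> y \<in> L \<Longrightarrow> cong_mod A (f x) (f y) \<Longrightarrow> cong_mod M x y"
  shows "card Q = p * card M"
proof -
  have Lc: "l \<in> carrier G" if "l \<in> L" for l using that L Qc by blast
  have fc: "f l \<in> carrier G" if "l \<in> L" for l using f[OF that] AB subgroup.mem_carrier by metis
  have QL: "(\<lambda>k. k <# M) ` Q \<subseteq> (\<lambda>k. k <# M) ` L"
  proof
    fix Y assume "Y \<in> (\<lambda>k. k <# M) ` Q"
    then obtain q where q: "q \<in> Q" "Y = q <# M" by blast
    obtain l m where lm: "l \<in> L" "m \<in> M" "q = l \<otimes> m" using complement_factor[OF L q(1)] by blast
    have "inv l \<otimes> q = m" using lm Lc MQ Qc by (simp add: m_assoc[symmetric])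
    then have "l <# M = q <# M" using lcos_eq_iff[OF Ms Lc[OF lm(1)] Qc[OF q(1)]] lm by simp
    then show "Y \<in> (\<lambda>k. k <# M) ` L" using q lm by blast
  qed
  \<comment> \<open>\<open>?h\<close> sends a coset of A to the coset of M of some preimage in L; by
    \<open>inj\<close> the choice of preimage does not matter, so all cosets of M are
    reached.\<close>
  let ?h = "\<lambda>Y. (SOME x. x \<in> L \<and> f x <# A = Y) <# M"
  have "(\<lambda>k. k <# M) ` L \<subseteq> ?h ` ((\<lambda>x. f x <# A) ` L)"
  proof
    fix Y assume "Y \<in> (\<lambda>k. k <# M) ` L"
    then obtain x where x: "x \<in> L" "Y = x <# M" by blast
    define y where "y = (SOME y. y \<in> L \<and> f y <# A = f x <# A)"
    have y: "y \<in> L \<and> f y <# A = f x <# A" unfolding y_def by (rule someI[of _ x]) (use x in simp)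
    then have "cong_mod A (f y) (f x)"
      using lcos_eq_iff[OF AB(1)] fc x unfolding cong_mod_def by blast
    then have "cong_mod M y x" using inj x y by blast
    then have "y <# M = x <# M" using lcos_eq_iff[OF Ms] Lc x y unfolding cong_mod_def by blast
    then have "Y = ?h (f x <# A)" using x y_def by simp
    then show "Y \<in> ?h ` ((\<lambda>x. f x <# A) ` L)" using x by blast
  qed
  moreover have "(\<lambda>x. f x <# A) ` L \<subseteq> (\<lambda>k. k <# A) ` B" using f by auto
  then have "?h ` ((\<lambda>x. f x <# A) ` L) \<subseteq> ?h ` ((\<lambda>k. k <# A) ` B)" by (rule image_mono)
  ultimately have "(\<lambda>k. k <# M) ` Q \<subseteq> ?h ` ((\<lambda>k. k <# A) ` B)" using QL by (meson subset_trans)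
  then have "card ((\<lambda>k. k <# M) ` Q) \<le> card ((\<lambda>k. k <# A) ` B)"
    by (rule surj_card_le[OF finite_imageI[OF fin_sub[OF AB(2)]]])
  moreover have "card ((\<lambda>k. k <# A) ` B) = p"
    using card_lcosets[OF AB(1-3)] AB(4) card_subgroup_pos[OF AB(1)] by simp
  moreover have "card ((\<lambda>k. k <# M) ` Q) * card M = card Q" using card_lcosets[OF Ms Qs] M by blast
  ultimately have "card Q \<le> p * card M" by (metis mult_le_mono1)
  moreover have "p * card M dvd card Q" using psub_index_dvd[OF Q(1) Ms M(2)] .
  ultimately show ?thesis using card_subgroup_pos[OF Qs] by (simp add: dvd_imp_le le_antisym)
qed

text \<open>L attaches a stable subgroup of Q to each member of the chain of T. As
  \<open>L {\<one>}\<close> lies in M and \<open>L T\<close> does not, some chain step A < B has L A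
  inside M and L B not inside M; there the map of \<open>step\<close> feeds
  \<open>index_bound\<close>.\<close>

lemma chain_transfer:
  assumes T: "pchain N T"
    and L: "\<And>J. pchain N J \<Longrightarrow> J \<subseteq> T \<Longrightarrow> subgroup (L J) G \<and> stable N (L J) \<and> L J \<subseteq> Q"
    and bot: "L {\<one>} \<subseteq> M" and top: "\<not> L T \<subseteq> M"
    and step: "\<And>A B. pchain N A \<Longrightarrow> pchain N B \<Longrightarrow> A \<subseteq> B \<Longrightarrow> B \<subseteq> T \<Longrightarrow> card B = p * card A \<Longrightarrow>
      \<exists>f. (\<forall>x\<in>L B. f x \<in> B) \<and> (\<forall>x\<in>L B. \<forall>y\<in>L B. cong_mod A (f x) (f y) \<longrightarrow> inv x \<otimes> y \<in> L A)"
  shows "card Q = p * card M"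
proof -
  have "J \<subseteq> T \<longrightarrow> \<not> L J \<subseteq> M \<longrightarrow> card Q = p * card M" if "pchain N J" for J
    using that
  proof (induction rule: pchain.induct)
    case pchain_one
    then show ?case using bot by blast
  next
    case (pchain_step A B)
    show ?case
    proof (intro impI)
      assume BT: "B \<subseteq> T" and nB: "\<not> L B \<subseteq> M"
      have cB: "pchain N B" using pchain.pchain_step pchain_step by blast
      show "card Q = p * card M"
      proof (cases "L A \<subseteq> M")
        case False
        then show ?thesis using pchain_step BT by blast
      next
        case True
        obtain f where f: "\<forall>x\<in>L B. f x \<in> B" "\<forall>x\<in>L B. \<forall>y\<in>L B. cong_mod A (f x) (f y) \<longrightarrow> inv x \<otimes> y \<in> L A"
          using step[OF pchain_step(1) cB pchain_step(3) BT pchain_step(4)] by blast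
        have LB: "subgroup (L B) G" "stable N (L B)" "L B \<subseteq> Q" using L[OF cB BT] by auto
        have As: "subgroup A G" using pchain_psub[OF pchain_step(1) Nc] psub_def by blast
        show ?thesis
          by (rule index_bound[OF LB nB As pchain_step(2-4), of f]) (use f True in \<open>auto simp: cong_mod_def\<close>)
      qed
    qed
  qed
  then show ?thesis using T top by blast
qed

section \<open>Two embeddings of the chief factor into factors of the chain\<close>

lemma cent_stable:
  assumes "psub A" "stable N A"
  shows "subgroup (cent A \<inter> Q) G" "stable N (cent A \<inter> Q)"
proof -
  have Ac: "A \<subseteq> carrier G" using assms psub_carrier by blast
  show "subgroup (cent A \<inter> Q) G" using cent_subgroup[OF Ac] Qs by (intro subgroups_Inter_pair)
  show "stable N (cent A \<inter> Q)"
    unfolding stable_def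
  proof (intro ballI IntI)
    fix g x assume g: "g \<in> N" and x: "x \<in> cent A \<inter> Q"
    show "cj g x \<in> cent A"
      using cent_cj[OF Ac N_nrm[OF assms(2) g] _ N_nrm[OF assms(2) N_inv[OF g]]] x by blast
    show "cj g x \<in> Q" using Q(3) g x by (auto simp: stable_def)
  qed
qed

text \<open>Here \<open>[a, _]\<close> embeds a section of \<open>Q\<close> into \<open>A\<close>, compatibly with the actions of \<open>N\<close>.\<close>

lemma card_if_self_centralizing_step:
  assumes A: "pchain N A" and B: "subgroup B G" "A \<subseteq> B" "card B = p * card A" "stable N B" "B \<subseteq> M"
    and nA: "\<not> cent A \<inter> Q \<subseteq> M" and cB: "cent B \<inter> Q \<subseteq> M"
  shows "card Q = p * card M"
proof -
  have pB: "psub B" using pchain_psub[OF pchain_step[OF A B(1-4)] Nc] .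
  have Ap: "psub A" and Ast: "stable N A" using pchain_psub_stable[OF A Nc] by auto
  have As: "subgroup A G" using Ap psub_def by blast
  have "card A \<noteq> card B" using B(3) p_gt_1 card_subgroup_pos[OF As] by simp
  then have "A \<noteq> B" by blast
  then obtain a where a: "a \<in> B" "a \<notin> A" using B(2) by blast
  have aQ: "a \<in> Q" using a B MQ by blast
  have ac: "a \<in> carrier G" using aQ Qc by blast
  have Beq: "adj A a = B" using index_p_adj[OF pB As B(2,3) a index_p_pow[OF pB As B(2,3) a(1)]] .
  let ?D = "cent A \<inter> Q"
  note D = cent_stable[OF Ap Ast]
  \<comment> \<open>The x in C_Q(A) whose commutator with a lies in J. Since A and a generate B,
    \<open>L {\<one>}\<close> lies in C_Q(B) and hence in M; since x acts trivially on B / A,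
    \<open>L A\<close> is all of C_Q(A).\<close>
  define L where "L J = {x \<in> ?D. cong_mod J a (cj x a)}" for J
  have nrmJ: "x \<in> nrm J" if "pchain N J" "x \<in> N" for x J
    using N_nrm[OF pchain_stable[OF that(1) Nc] that(2)] .
  have Jsub: "subgroup J G" if "pchain N J" for J using pchain_psub[OF that Nc] psub_def by blast
  show ?thesis
  proof (rule chain_transfer[OF A, of L])
    fix J assume J: "pchain N J" "J \<subseteq> A"
    note Js = Jsub[OF J(1)]
    have sub: "subgroup (L J) G"
    proof (rule subgroup_mult_closedI)
      show "L J \<subseteq> carrier G" using Qc by (auto simp: L_def)
      have "\<one> \<in> L J" using subgroup.one_closed[OF D(1)] ac cong_mod_refl[OF Js ac] by (simp add: L_def)
      then show "L J \<noteq> {}" by blast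
      fix x y assume x: "x \<in> L J" and y: "y \<in> L J"
      have xy: "x \<in> Q" "y \<in> Q" "x \<otimes> y \<in> ?D"
        using x y subgroup.m_closed[OF D(1), of x y] by (auto simp: L_def)
      have "cong_mod J (cj x a) (cj x (cj y a))"
        using cong_mod_cj[OF Js nrmJ[OF J(1) QN[OF xy(1)]]] ac y Qc[OF xy(2)] by (simp add: L_def)
      then have "cong_mod J a (cj x (cj y a))"
        using cong_mod_trans[OF Js, of a "cj x a"] x ac xy Qc by (simp add: L_def)
      then show "x \<otimes> y \<in> L J" using xy ac Qc by (simp add: L_def cj_cj)
    qed
    have "stable N (L J)"
      unfolding stable_def
    proof (intro ballI)
      fix g x assume g: "g \<in> N" and x: "x \<in> L J"
      have gc: "g \<in> carrier G" using g Nc by blast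
      have xQ: "x \<in> Q" and xD: "x \<in> ?D" using x by (auto simp: L_def)
      have xc: "x \<in> carrier G" using xQ Qc by blast
      \<comment> \<open>The defining condition of L J concerns the single element a. Conjugation by
        \<open>inv g\<close> turns a into a^k b with b in A, and x fixes b, so the condition passes
        to the conjugate of a and then, applying g, to the conjugate of x.\<close>
      have "cj (inv g) a \<in> B" using cj_inv_mem[OF N B(4) g a(1)] .
      then obtain k b where kb: "cj (inv g) a = a [^] (k::nat) \<otimes> b" "b \<in> A"
        unfolding Beq[symmetric] adj_def by blast
      have bN: "b \<in> N" using kb B MQ QN by blast
      have bc: "b \<in> carrier G" using bN Nc by blast
      have "cj x b = b" using xD kb centD by blast
      then have xa: "cj x (cj (inv g) a) = (cj x a) [^] k \<otimes> b"
        using kb xc ac bc by (simp add: cj_mult cj_pow)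
      have "cong_mod J (a [^] k) ((cj x a) [^] k)"
        using cong_mod_pow[OF Js nrmJ[OF J(1) QN[OF aQ]]] x xc ac by (simp add: L_def)
      then have "cong_mod J (cj (inv g) a) (cj x (cj (inv g) a))"
        unfolding xa unfolding kb(1)
        using cong_mod_mult[OF Js _ _ nrmJ[OF J(1) bN]] ac bc xc cong_mod_refl[OF Js bc] by simp
      then have "cong_mod J (cj g (cj (inv g) a)) (cj g (cj x (cj (inv g) a)))"
        by (rule cong_mod_cj[OF Js nrmJ[OF J(1) g], rotated 2]) (use ac gc xc in simp_all)
      moreover have "cj g (cj x (cj (inv g) a)) = cj (cj g x) a"
        using gc xc ac by (simp add: cj_cj m_assoc) (simp add: cj_def m_assoc)
      ultimately have "cong_mod J a (cj (cj g x) a)" using gc ac by simp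
      moreover have "cj g x \<in> ?D" using D(2) g xD by (rule stableD)
      ultimately show "cj g x \<in> L J" by (simp add: L_def)
    qed
    then show "subgroup (L J) G \<and> stable N (L J) \<and> L J \<subseteq> Q" using sub by (auto simp: L_def)
  next
    show "L {\<one>} \<subseteq> M"
    proof
      fix x assume x: "x \<in> L {\<one>}"
      have xc: "x \<in> carrier G" using x Qc by (auto simp: L_def)
      have "inv a \<otimes> cj x a = \<one>" using x by (simp add: L_def cong_mod_def)
      then have xa: "cj x a = a" using xc ac inv_solve_left'[of \<one> a "cj x a"] by simp
      have "cj x y = y" if y: "y \<in> B" for y
      proof -
        obtain k b where kb: "y = a [^] (k::nat) \<otimes> b" "b \<in> A" using y unfolding Beq[symmetric] adj_def by blast
        have bc: "b \<in> carrier G" using kb As subgroup.mem_carrier by metis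
        have "cj x b = b" using x kb centD by (auto simp: L_def)
        then show ?thesis using kb xa xc ac bc by (simp add: cj_mult cj_pow)
      qed
      then have "x \<in> cent B \<inter> Q" using x xc by (simp add: L_def cent_def)
      then show "x \<in> M" using cB by blast
    qed
    have "L A = ?D"
      using psub_trivial_action[OF As B(2) pB B(3) Ast B(4) _ a(1)] by (auto simp: L_def)
    then show "\<not> L A \<subseteq> M" using nA by simp
  next
    fix J J' assume J: "pchain N J" "pchain N J'" "J \<subseteq> J'" "J' \<subseteq> A"
    note Js = Jsub[OF J(1)]
    show "\<exists>f. (\<forall>x\<in>L J'. f x \<in> J') \<and> (\<forall>x\<in>L J'. \<forall>y\<in>L J'. cong_mod J (f x) (f y) \<longrightarrow> inv x \<otimes> y \<in> L J)"
    proof (intro exI[of _ "\<lambda>x. inv a \<otimes> cj x a"] conjI ballI impI)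
      show "inv a \<otimes> cj x a \<in> J'" if "x \<in> L J'" for x using that by (simp add: L_def cong_mod_def)
      fix x y assume x: "x \<in> L J'" and y: "y \<in> L J'" and c: "cong_mod J (inv a \<otimes> cj x a) (inv a \<otimes> cj y a)"
      have xy: "x \<in> ?D" "y \<in> ?D" using x y by (auto simp: L_def)
      have c': "x \<in> carrier G" "y \<in> carrier G" using xy Qc by auto
      have ix: "inv x \<in> N" using xy QN N_inv by blast
      have "a \<otimes> (inv a \<otimes> cj y a) = cj y a" using ac c' by (simp add: m_assoc[symmetric])
      then have "cong_mod J (cj x a) (cj y a)"
        using c ac c' by (simp add: cong_mod_def inv_mult_group m_assoc)
      then have "cong_mod J (cj (inv x) (cj x a)) (cj (inv x) (cj y a))"
        by (rule cong_mod_cj[OF Js nrmJ[OF J(1) ix], rotated 2]) (use ac c' in simp_all)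
      then have "cong_mod J a (cj (inv x \<otimes> y) a)" using ac c' by (simp add: cj_cj)
      moreover have "inv x \<otimes> y \<in> ?D" using xy D(1) by (meson subgroup.m_closed subgroup.m_inv_closed)
      ultimately show "inv x \<otimes> y \<in> L J" by (simp add: L_def)
    qed
  qed
qed

text \<open>C_Q(1) = Q is not inside M but C_Q(M) is, so somewhere along the chain of M the
  centraliser first falls into M; the preceding lemma applies to that step.\<close>

lemma card_if_self_centralizing:
  assumes "cent M \<inter> Q \<subseteq> M"
  shows "card Q = p * card M"
proof -
  have "A \<subseteq> M \<longrightarrow> cent A \<inter> Q \<subseteq> M \<longrightarrow> card Q = p * card M" if "pchain N A" for A
    using that
  proof (induction rule: pchain.induct)
    case pchain_one
    have "Q \<subseteq> cent {\<one>}" using Qc by (auto simp: cent_def)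
    then show ?case using M by blast
  next
    case (pchain_step A B)
    then show ?case using card_if_self_centralizing_step by blast
  qed
  then show ?thesis using M assms by blast
qed

text \<open>Here \<open>x \<mapsto> x ^ p\<close> embeds \<open>C / Z\<close> into \<open>Z / Z ^ p U\<close>, compatibly with the actions of \<open>N\<close>.\<close>

lemma card_if_power_map:
  assumes nC: "\<not> cent M \<inter> Q \<subseteq> M"
    and U: "subgroup U G" "stable N U" "U \<subseteq> cent M \<inter> M"
    and hom: "\<And>x y. x \<in> cent M \<inter> Q \<Longrightarrow> y \<in> cent M \<inter> Q \<Longrightarrow> \<exists>u\<in>U. (x \<otimes> y) [^] p = x [^] p \<otimes> y [^] p \<otimes> u"
    and ker: "\<And>t. t \<in> cent M \<inter> Q \<Longrightarrow> t [^] p \<in> U \<Longrightarrow> t \<in> M"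
  shows "card Q = p * card M"
proof -
  let ?C = "cent M \<inter> Q"
  let ?Z = "cent M \<inter> M"
  note C = cent_stable[OF Mp Mst]
  have Mc: "M \<subseteq> carrier G" using Mp psub_carrier by blast
  have ZC: "?Z \<subseteq> ?C" using M by blast
  have Cc: "x \<in> carrier G" if "x \<in> ?C" for x using that Qc by blast
  have comm: "x \<otimes> z = z \<otimes> x" if "x \<in> ?C" "z \<in> ?Z" for x z using cent_commute[OF Mc] that by blast
  have Z: "subgroup ?Z G" using cent_subgroup[OF Mc] Ms by (intro subgroups_Inter_pair)
  have Zst: "stable N ?Z"
  proof -
    have "?Z = ?C \<inter> M" using M by blast
    then show ?thesis using stable_Int[OF C(2) Mst] by simp
  qed
  have Zc: "z \<in> carrier G" if "z \<in> ?Z" for z using that ZC Cc by blast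
  have pZ: "x [^] p \<in> ?Z" if "x \<in> ?C" for x
    using frattini_factor(1)[of x] that subgroup_pow_closed[OF C(1) that] by blast
  have triv_stable: "stable P Y" if "P \<subseteq> ?Z" "Y \<subseteq> ?Z" for P Y
    unfolding stable_def
  proof (intro ballI)
    fix g h assume gh: "g \<in> P" "h \<in> Y"
    then have "cj g h = h" using cj_commute[of g h] comm[of g h] that ZC Zc by blast
    then show "cj g h \<in> Y" using gh by simp
  qed
  define Zp where "Zp = (\<lambda>z. z [^] p) ` ?Z"
  have Zps: "subgroup Zp G"
  proof (rule subgroup_mult_closedI)
    show "Zp \<subseteq> carrier G" using Zc by (auto simp: Zp_def)
    show "Zp \<noteq> {}" using Z subgroup.one_closed by (auto simp: Zp_def)
    fix x y assume "x \<in> Zp" "y \<in> Zp"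
    then obtain z w where zw: "z \<in> ?Z" "w \<in> ?Z" "x = z [^] p" "y = w [^] p" unfolding Zp_def by blast
    have "x \<otimes> y = (z \<otimes> w) [^] p" using zw pow_mult_distrib[of z w p] comm[of z w] ZC Zc by auto
    moreover have "z \<otimes> w \<in> ?Z" using zw subgroup.m_closed[OF Z] by blast
    ultimately show "x \<otimes> y \<in> Zp" by (simp add: Zp_def)
  qed
  have ZpZ: "Zp \<subseteq> ?Z" using subgroup_pow_closed[OF Z] by (auto simp: Zp_def)
  have Zpst: "stable N Zp" unfolding stable_def
  proof (intro ballI)
    fix g x assume g: "g \<in> N" and "x \<in> Zp"
    then obtain z where z: "z \<in> ?Z" "x = z [^] p" unfolding Zp_def by blast
    have "cj g x = cj g z [^] p" using z Zc g Nc by (auto intro!: cj_pow)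
    then show "cj g x \<in> Zp" using stableD[OF Zst g z(1)] by (simp add: Zp_def)
  qed
  define E where "E = {u \<otimes> c | u c. u \<in> Zp \<and> c \<in> U}"
  have E: "subgroup E G" unfolding E_def using prod_subgroup[OF Zps U(1) triv_stable[OF ZpZ U(3)]] .
  have EZ: "E \<subseteq> ?Z" unfolding E_def using ZpZ U(3) subgroup.m_closed[OF Z] by blast
  have prod_stable: "stable N {u \<otimes> c | u c. u \<in> A \<and> c \<in> B}"
    if AB: "stable N A" "stable N B" "A \<subseteq> ?Z" "B \<subseteq> ?Z" for A B
    unfolding stable_def
  proof (intro ballI)
    fix g x assume g: "g \<in> N" and "x \<in> {u \<otimes> c | u c. u \<in> A \<and> c \<in> B}"
    then obtain u c where uc: "x = u \<otimes> c" "u \<in> A" "c \<in> B" by blast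
    have "u \<in> carrier G" "c \<in> carrier G" "g \<in> carrier G" using uc AB Zc g Nc by blast+
    then have "cj g x = cj g u \<otimes> cj g c" using uc by (simp add: cj_mult)
    then show "cj g x \<in> {u \<otimes> c | u c. u \<in> A \<and> c \<in> B}"
      using stableD[OF AB(1) g uc(2)] stableD[OF AB(2) g uc(3)] by blast
  qed
  have Est: "stable N E" unfolding E_def using prod_stable[OF Zpst U(2) ZpZ U(3)] .
  \<comment> \<open>With Z = Z(M) and E = Z^p U, the chain of M induces a filtration of Z above E,
    and L J is its preimage under the p-th power map on C. Dividing out Z^p accounts for the
    elements of C that already lie in M.\<close>
  define EJ where "EJ J = {u \<otimes> c | u c. u \<in> E \<and> c \<in> J \<inter> ?Z}" for J
  define L where "L J = {x \<in> ?C. x [^] p \<in> EJ J}" for J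
  have JZ: "subgroup (J \<inter> ?Z) G" "stable N (J \<inter> ?Z)" if "pchain N J" for J
    using pchain_psub_stable[OF that Nc] Z Zst stable_Int unfolding psub_def
    by (auto intro!: subgroups_Inter_pair)
  have EJ: "subgroup (EJ J) G" "stable N (EJ J)" if "pchain N J" for J
    unfolding EJ_def using prod_subgroup[OF E JZ(1)[OF that] triv_stable[OF EZ]] prod_stable[OF Est JZ(2)[OF that] EZ]
    by auto
  have EEJ: "E \<subseteq> EJ J" and JEJ: "J \<inter> ?Z \<subseteq> EJ J" if J: "pchain N J" for J
  proof -
    show "E \<subseteq> EJ J"
    proof
      fix e assume e: "e \<in> E"
      then have "e \<in> carrier G" using EZ Zc by blast
      then have "e = e \<otimes> \<one>" by simp
      then show "e \<in> EJ J" unfolding EJ_def using e subgroup.one_closed[OF JZ(1)[OF J]] by blast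
    qed
    show "J \<inter> ?Z \<subseteq> EJ J"
    proof
      fix e assume e: "e \<in> J \<inter> ?Z"
      then have "e = \<one> \<otimes> e" using Zc by auto
      then show "e \<in> EJ J" unfolding EJ_def using e subgroup.one_closed[OF E] by blast
    qed
  qed
  have UE: "U \<subseteq> E"
  proof
    fix e assume e: "e \<in> U"
    then have "e \<in> carrier G" using U Zc by blast
    then have "e = \<one> \<otimes> e" by simp
    then show "e \<in> E" unfolding E_def using e subgroup.one_closed[OF Zps] by blast
  qed
  have powEJ: "(x \<otimes> y) [^] p \<in> EJ J" if xy: "x \<in> ?C" "y \<in> ?C" "x [^] p \<otimes> y [^] p \<in> EJ J" "pchain N J" for x y J
  proof -
    obtain u where u: "u \<in> U" "(x \<otimes> y) [^] p = x [^] p \<otimes> y [^] p \<otimes> u" using hom xy by blast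
    have "u \<in> EJ J" using u UE EEJ xy by blast
    then show ?thesis using u xy subgroup.m_closed[OF EJ(1)] by simp
  qed
  show ?thesis
  proof (rule chain_transfer[OF M(1), of L])
    fix J assume J: "pchain N J" "J \<subseteq> M"
    have "subgroup (L J) G"
    proof (rule subgroup_mult_closedI)
      show "L J \<subseteq> carrier G" using Cc by (auto simp: L_def)
      have "\<one> \<in> L J" using subgroup.one_closed[OF C(1)] subgroup.one_closed[OF EJ(1)[OF J(1)]] by (simp add: L_def)
      then show "L J \<noteq> {}" by blast
      fix x y assume xy: "x \<in> L J" "y \<in> L J"
      then have "x [^] p \<otimes> y [^] p \<in> EJ J" using subgroup.m_closed[OF EJ(1)[OF J(1)]] by (simp add: L_def)
      then have "(x \<otimes> y) [^] p \<in> EJ J" using powEJ xy J by (simp add: L_def)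
      moreover have "x \<otimes> y \<in> ?C" using xy subgroup.m_closed[OF C(1)] unfolding L_def by blast
      ultimately show "x \<otimes> y \<in> L J" by (simp add: L_def)
    qed
    moreover have "stable N (L J)"
      unfolding stable_def
    proof (intro ballI)
      fix g x assume g: "g \<in> N" and x: "x \<in> L J"
      have xC: "x \<in> ?C" "x [^] p \<in> EJ J" using x by (auto simp: L_def)
      have "cj g x [^] p = cj g (x [^] p)" using xC Cc g Nc cj_pow[of g x p] by auto
      then have "cj g x [^] p \<in> EJ J" using stableD[OF EJ(2)[OF J(1)] g xC(2)] by simp
      then show "cj g x \<in> L J" using stableD[OF C(2) g xC(1)] by (simp add: L_def)
    qed
    ultimately show "subgroup (L J) G \<and> stable N (L J) \<and> L J \<subseteq> Q" by (auto simp: L_def)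
  next
    show "L {\<one>} \<subseteq> M"
    proof
      fix x assume "x \<in> L {\<one>}"
      then have x: "x \<in> ?C" "x [^] p \<in> EJ {\<one>}" by (auto simp: L_def)
      then obtain z u where zu: "z \<in> ?Z" "u \<in> U" "x [^] p = z [^] p \<otimes> u \<otimes> \<one>"
        unfolding EJ_def E_def Zp_def by auto
      have c: "x \<in> carrier G" "z \<in> carrier G" "u \<in> carrier G" using x zu Cc Zc U by auto
      have iz: "inv z \<in> ?Z" using subgroup.m_inv_closed[OF Z zu(1)] .
      \<comment> \<open>z commutes with all of C, so correcting x by z leaves the p-th power u in U,
        where \<open>ker\<close> applies.\<close>
      have "(x \<otimes> inv z) [^] p = x [^] p \<otimes> inv z [^] p"
        using pow_mult_distrib[OF comm[OF x(1) iz]] c by simp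
      also have "\<dots> = inv z [^] p \<otimes> x [^] p"
        using comm[of "x [^] p" "inv z [^] p"] subgroup_pow_closed[OF C(1) x(1)] subgroup_pow_closed[OF Z iz] by blast
      also have "\<dots> = inv (z [^] p) \<otimes> (z [^] p \<otimes> u)" using zu c by (simp add: nat_pow_inv)
      also have "\<dots> = u" using c by (simp add: m_assoc[symmetric])
      finally have "(x \<otimes> inv z) [^] p \<in> U" using zu by simp
      moreover have "x \<otimes> inv z \<in> ?C" using x iz ZC subgroup.m_closed[OF C(1)] by blast
      ultimately have "x \<otimes> inv z \<in> M" using ker by blast
      then have "x \<otimes> inv z \<otimes> z \<in> M" using zu subgroup.m_closed[OF Ms] by blast
      then show "x \<in> M" using c by (simp add: m_assoc)
    qed
    have "x \<in> L M" if "x \<in> ?C" for x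
      using pZ[OF that] JEJ[OF M(1)] that by (auto simp: L_def)
    then show "\<not> L M \<subseteq> M" using nC by blast
  next
    fix J J' assume J: "pchain N J" "pchain N J'" "J \<subseteq> J'" "J' \<subseteq> M"
    \<comment> \<open>f x is a chosen J'-component of x^p, determined up to E only. If the
      components of x and y agree modulo J, then x^-p y^p lies in \<open>EJ J\<close>, whatever the
      choices.\<close>
    have "\<forall>x\<in>L J'. \<exists>j. j \<in> J' \<inter> ?Z \<and> (\<exists>e\<in>E. x [^] p = e \<otimes> j)"
      by (auto simp: L_def EJ_def)
    then obtain f where f: "\<And>x. x \<in> L J' \<Longrightarrow> f x \<in> J' \<inter> ?Z \<and> (\<exists>e\<in>E. x [^] p = e \<otimes> f x)" by metis
    show "\<exists>f. (\<forall>x\<in>L J'. f x \<in> J') \<and> (\<forall>x\<in>L J'. \<forall>y\<in>L J'. cong_mod J (f x) (f y) \<longrightarrow> inv x \<otimes> y \<in> L J)"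
    proof (intro exI[of _ f] conjI ballI impI)
      show "f x \<in> J'" if "x \<in> L J'" for x using f[OF that] by blast
      fix x y assume x: "x \<in> L J'" and y: "y \<in> L J'" and c: "cong_mod J (f x) (f y)"
      have xC: "x \<in> ?C" "y \<in> ?C" using x y by (auto simp: L_def)
      obtain e where e: "e \<in> E" "x [^] p = e \<otimes> f x" using f[OF x] by blast
      obtain e' where e': "e' \<in> E" "y [^] p = e' \<otimes> f y" using f[OF y] by blast
      have fz: "f x \<in> ?Z" "f y \<in> ?Z" using f x y by blast+
      have cc: "x \<in> carrier G" "y \<in> carrier G" "e \<in> carrier G" "e' \<in> carrier G" "f x \<in> carrier G" "f y \<in> carrier G"
        using xC Cc e e' EZ fz Zc by blast+
      have d: "inv (f x) \<otimes> f y \<in> J \<inter> ?Z"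
        using c subgroup.m_closed[OF Z subgroup.m_inv_closed[OF Z fz(1)] fz(2)] unfolding cong_mod_def by blast
      have ie: "inv e \<otimes> e' \<in> E" using subgroup.m_closed[OF E subgroup.m_inv_closed[OF E e(1)] e'(1)] .
      have "inv x [^] p \<otimes> y [^] p = inv (f x) \<otimes> (inv e \<otimes> e') \<otimes> f y"
        using e e' cc by (simp add: nat_pow_inv inv_mult_group m_assoc)
      also have "inv (f x) \<otimes> (inv e \<otimes> e') = (inv e \<otimes> e') \<otimes> inv (f x)"
        using comm[of "inv (f x)" "inv e \<otimes> e'"] ie EZ ZC fz subgroup.m_inv_closed[OF Z fz(1)] by blast
      also have "(inv e \<otimes> e') \<otimes> inv (f x) \<otimes> f y = (inv e \<otimes> e') \<otimes> (inv (f x) \<otimes> f y)"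
        using cc by (simp add: m_assoc)
      also have "\<dots> \<in> EJ J" unfolding EJ_def using ie d by blast
      finally have "(inv x \<otimes> y) [^] p \<in> EJ J"
        using powEJ[OF subgroup.m_inv_closed[OF C(1) xC(1)] xC(2) _ J(1)] by blast
      moreover have "inv x \<otimes> y \<in> ?C" using subgroup.m_closed[OF C(1) subgroup.m_inv_closed[OF C(1) xC(1)] xC(2)] .
      ultimately show "inv x \<otimes> y \<in> L J" by (simp add: L_def)
    qed
  qed
qed

text \<open>Conjugates of t under N stay in H and so in M<t>, which makes M<t> stable and hence
  equal to Q; its index over M is p because t^p lies in M.\<close>

lemma card_if_stable_element:
  assumes t: "t \<in> Q" "t \<notin> M" and H: "t \<in> H" "H \<subseteq> adj M t" "stable N H"
  shows "card Q = p * card M"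
proof -
  have tc: "t \<in> carrier G" using t Qc by blast
  have sub: "subgroup (adj M t) G"
    by (rule adj_subgroup[OF Ms tc]) (use Mst QN[OF t(1)] in \<open>auto simp: stable_def\<close>)
  have st: "stable N (adj M t)"
    by (rule adj_stable[OF N Ms Mst tc sub]) (use H stableD in blast)
  have "M \<subseteq> adj M t" "t \<in> adj M t" using adj_contains[OF Ms tc] by blast+
  moreover have "adj M t \<subseteq> Q" using adj_least[OF Qs _ t(1)] M by blast
  ultimately have "adj M t = Q" using minimal[OF sub st] t by blast
  then show ?thesis using adj_card[OF Ms tc t(2) frattini_factor(1)[OF t(1)]] by simp
qed

text \<open>Collecting the x to the left takes \<open>n choose 2\<close> interchanges of a y with an
  x, and each costs one factor k, which commutes with x and y.\<close>

lemma pow_class_two: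
  assumes c: "x \<in> carrier G" "y \<in> carrier G" "k \<in> carrier G"
    and yx: "y \<otimes> x = x \<otimes> y \<otimes> k" and kx: "k \<otimes> x = x \<otimes> k" and ky: "k \<otimes> y = y \<otimes> k"
  shows "(x \<otimes> y) [^] n = x [^] n \<otimes> y [^] n \<otimes> k [^] (n choose 2)"
proof (induction n)
  case (Suc n)
  have kpx: "k [^] m \<otimes> x = x \<otimes> k [^] m" for m :: nat
    using group_commutes_pow[OF kx c(3,1)] .
  have kpy: "k [^] m \<otimes> y = y \<otimes> k [^] m" for m :: nat
    using group_commutes_pow[OF ky c(3,2)] .
  have ynx: "y [^] n \<otimes> x = x \<otimes> y [^] n \<otimes> k [^] n" for n :: nat
  proof (induction n)
    case (Suc n)
    have "y [^] Suc n \<otimes> x = y [^] n \<otimes> (y \<otimes> x)" using c by (simp add: m_assoc)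
    also have "\<dots> = (y [^] n \<otimes> x) \<otimes> (y \<otimes> k)" using c yx by (simp add: m_assoc)
    also have "\<dots> = x \<otimes> y [^] n \<otimes> (k [^] n \<otimes> y) \<otimes> k" using Suc c by (simp add: m_assoc)
    also have "\<dots> = x \<otimes> y [^] Suc n \<otimes> k [^] Suc n" using kpy c by (simp add: m_assoc)
    finally show ?case .
  qed (use c in simp)
  have "(x \<otimes> y) [^] Suc n = x [^] n \<otimes> y [^] n \<otimes> (k [^] (n choose 2) \<otimes> x) \<otimes> y"
    using Suc c by (simp add: m_assoc)
  also have "\<dots> = x [^] n \<otimes> (y [^] n \<otimes> x) \<otimes> (k [^] (n choose 2) \<otimes> y)"
    using kpx c by (simp add: m_assoc)
  also have "\<dots> = x [^] n \<otimes> (x \<otimes> y [^] n \<otimes> k [^] n) \<otimes> (y \<otimes> k [^] (n choose 2))"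
    using kpy ynx by simp
  also have "\<dots> = x [^] n \<otimes> x \<otimes> y [^] n \<otimes> (k [^] n \<otimes> y) \<otimes> k [^] (n choose 2)"
    using c by (simp add: m_assoc)
  also have "\<dots> = x [^] Suc n \<otimes> y [^] Suc n \<otimes> (k [^] n \<otimes> k [^] (n choose 2))"
    using kpy c by (simp add: m_assoc)
  also have "k [^] n \<otimes> k [^] (n choose 2) = k [^] (Suc n choose 2)"
    using c by (simp add: nat_pow_mult numeral_2_eq_2)
  finally show ?case .
qed (use c in \<open>simp add: binomial_eq_0\<close>)

text \<open>If the order were different, C_Q(M) would not lie in M, while all t in Q with t^p = 1
  would. This leaves the power map on C_Q(M), where the commutators control the failure of
  multiplicativity.\<close>

lemma chief_factor_order:
  assumes ord_p: "\<And>t. t \<in> Q \<Longrightarrow> t \<notin> M \<Longrightarrow> t [^] p = \<one> \<Longrightarrow> \<exists>H. t \<in> H \<and> H \<subseteq> adj M t \<and> stable N H"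
    and ord_4: "\<And>t. p = 2 \<Longrightarrow> \<not> (\<forall>x\<in>Q. \<forall>y\<in>Q. x \<otimes> y = y \<otimes> x) \<Longrightarrow> t \<in> Q \<Longrightarrow> t \<notin> M \<Longrightarrow> t [^] (4::nat) = \<one> \<Longrightarrow>
      \<exists>H. t \<in> H \<and> H \<subseteq> adj M t \<and> stable N H"
  shows "card Q = p * card M"
proof (rule ccontr)
  assume n: "card Q \<noteq> p * card M"
  have nC: "\<not> cent M \<inter> Q \<subseteq> M" using n card_if_self_centralizing by blast
  have kp: "t \<in> M" if "t \<in> Q" "t [^] p = \<one>" for t
    using that n ord_p card_if_stable_element by blast
  let ?C = "cent M \<inter> Q"
  let ?Z = "cent M \<inter> M"
  have Mc: "M \<subseteq> carrier G" using Mp psub_carrier by blast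
  have Z: "subgroup ?Z G" using cent_subgroup[OF Mc] Ms by (intro subgroups_Inter_pair)
  have Zc: "z \<in> carrier G" if "z \<in> ?Z" for z using that Mc by blast
  note C = cent_stable[OF Mp Mst]
  have comm: "x \<otimes> z = z \<otimes> x" if "x \<in> ?C" "z \<in> M" for x z using cent_commute[OF Mc] that by blast
  have formula: "\<exists>k\<in>?Z. k [^] p = \<one> \<and> y \<otimes> x = x \<otimes> y \<otimes> k \<and> (x \<otimes> y) [^] p = x [^] p \<otimes> y [^] p \<otimes> k [^] (p choose 2)"
    if xy: "x \<in> ?C" "y \<in> ?C" for x y
  proof -
    \<comment> \<open>k lies in M because Q / M is abelian, hence is central for C_Q(M). Since x^p
      lies in M it commutes with y, and comparing x^p with its conjugate gives k^p = 1.\<close>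
    define k where "k = inv x \<otimes> cj y x"
    have c: "x \<in> carrier G" "y \<in> carrier G" using xy Qc by auto
    have kM: "k \<in> M" using frattini_factor(2)[of x y] xy unfolding k_def cong_mod_def by blast
    have "cj y x \<in> ?C" using stableD[OF C(2) _ xy(1)] xy QN by blast
    then have kC: "k \<in> ?C"
      unfolding k_def using subgroup.m_closed[OF C(1) subgroup.m_inv_closed[OF C(1) xy(1)]] by blast
    have kc: "k \<in> carrier G" using kC Qc by blast
    have kx: "k \<otimes> x = x \<otimes> k" and ky: "k \<otimes> y = y \<otimes> k" using comm[OF _ kM] xy by auto
    have cjy: "cj y x = x \<otimes> k" unfolding k_def using c by (simp add: m_assoc[symmetric])
    have "y \<otimes> x = cj y x \<otimes> y" using c by (simp add: cj_def m_assoc)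
    also have "\<dots> = x \<otimes> y \<otimes> k" using c kc ky by (simp add: cjy m_assoc)
    finally have yx: "y \<otimes> x = x \<otimes> y \<otimes> k" .
    have "x [^] p \<in> M" using frattini_factor(1) xy by blast
    then have "cj y (x [^] p) = x [^] p" using comm[OF xy(2)] c cj_fix_iff[of y "x [^] p"] by simp
    moreover have "cj y (x [^] p) = x [^] p \<otimes> k [^] p"
      using c kc kx by (simp add: cj_pow cjy pow_mult_distrib)
    ultimately have "x [^] p \<otimes> k [^] p = x [^] p \<otimes> \<one>" using c by simp
    then have "k [^] p = \<one>" using c kc l_cancel[of "x [^] p" "k [^] p" \<one>] by simp
    then show ?thesis using pow_class_two[OF c kc yx kx ky, of p] yx kC kM by blast
  qed
  show False
  proof (cases "p \<noteq> 2 \<or> (\<forall>x\<in>Q. \<forall>y\<in>Q. x \<otimes> y = y \<otimes> x)")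
    case True
    \<comment> \<open>Here the error factor k^(p choose 2) is trivial: p divides
      \<open>p choose 2\<close> if p is odd, and k = 1 if Q is abelian. So U can be trivial.\<close>
    have "card Q = p * card M"
    proof (rule card_if_power_map[OF nC, of "{\<one>}"])
      show "subgroup {\<one>} G" by (rule triv_subgroup)
      show "stable N {\<one>}" using Nc by (auto simp: stable_def)
      show "{\<one>} \<subseteq> ?Z" using subgroup.one_closed[OF Z] by simp
      show "t \<in> M" if "t \<in> ?C" "t [^] p \<in> {\<one>}" for t using kp that by blast
      fix x y assume xy: "x \<in> ?C" "y \<in> ?C"
      have c: "x \<in> carrier G" "y \<in> carrier G" using xy Qc by auto
      obtain k where k: "k \<in> ?Z" "k [^] p = \<one>" "y \<otimes> x = x \<otimes> y \<otimes> k"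
        "(x \<otimes> y) [^] p = x [^] p \<otimes> y [^] p \<otimes> k [^] (p choose 2)" using formula[OF xy] by blast
      have kc: "k \<in> carrier G" using k Zc by blast
      have "k [^] (p choose 2) = \<one>"
      proof (cases "p = 2")
        case True
        then have "x \<otimes> y = y \<otimes> x" using \<open>p \<noteq> 2 \<or> _\<close> xy by blast
        then have "x \<otimes> y \<otimes> \<one> = x \<otimes> y \<otimes> k" using k c by simp
        then have "k = \<one>" using c kc l_cancel[of "x \<otimes> y" \<one> k] by simp
        then show ?thesis by simp
      next
        case False
        then have "p dvd (p choose 2)" using prime_p p_gt_1 by (intro dvd_choose_prime) auto
        then obtain j where "p choose 2 = p * j" by blast
        then show ?thesis using k kc by (simp add: nat_pow_pow[symmetric])
      qed
      then show "\<exists>u\<in>{\<one>}. (x \<otimes> y) [^] p = x [^] p \<otimes> y [^] p \<otimes> u" using k by simp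
    qed
    then show False using n by simp
  next
    case False
    then have p2: "p = 2" and nab: "\<not> (\<forall>x\<in>Q. \<forall>y\<in>Q. x \<otimes> y = y \<otimes> x)" by auto
    \<comment> \<open>For p = 2 the error factor is k itself, which lies in this subgroup. The price
      is that \<open>ker\<close> now concerns elements with t^4 = 1, which \<open>ord_4\<close>
      handles.\<close>
    let ?U = "{z \<in> ?Z. z [^] p = \<one>}"
    have "card Q = p * card M"
    proof (rule card_if_power_map[OF nC, of ?U])
      show "subgroup ?U G"
      proof (rule subgroup_mult_closedI)
        show "?U \<subseteq> carrier G" using Zc by blast
        show "?U \<noteq> {}" using subgroup.one_closed[OF Z] by (auto intro!: exI[of _ \<one>])
        fix a b assume ab: "a \<in> ?U" "b \<in> ?U"
        have "a \<otimes> b = b \<otimes> a" using comm[of a b] ab M by blast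
        then have "(a \<otimes> b) [^] p = \<one>" using ab Zc by (simp add: pow_mult_distrib)
        then show "a \<otimes> b \<in> ?U" using subgroup.m_closed[OF Z, of a b] ab by blast
      qed
      show "stable N ?U"
        unfolding stable_def
      proof (intro ballI)
        fix g h assume g: "g \<in> N" and h: "h \<in> ?U"
        have gc: "g \<in> carrier G" "h \<in> carrier G" using g Nc h Zc by blast+
        have "cj g h \<in> ?C \<inter> M" using stableD[OF C(2) g, of h] stableD[OF Mst g, of h] h M by blast
        moreover have "cj g h [^] p = \<one>" using h gc by (simp add: cj_pow[symmetric])
        ultimately show "cj g h \<in> ?U" by blast
      qed
      show "t \<in> M" if t: "t \<in> ?C" "t [^] p \<in> ?U" for t
      proof -
        have tc: "t \<in> carrier G" using t Qc by blast
        have "(t [^] p) [^] p = \<one>" using t by blast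
        then have "t [^] (4::nat) = \<one>" using tc p2 by (simp add: nat_pow_pow)
        then show ?thesis using ord_4[OF p2 nab, of t] card_if_stable_element[of t] n t by blast
      qed
      fix x y assume xy: "x \<in> ?C" "y \<in> ?C"
      obtain k where k: "k \<in> ?Z" "k [^] p = \<one>"
        "(x \<otimes> y) [^] p = x [^] p \<otimes> y [^] p \<otimes> k [^] (p choose 2)" using formula[OF xy] by blast
      have "k [^] (p choose 2) = k" using p2 k Zc by simp
      then show "\<exists>u\<in>?U. (x \<otimes> y) [^] p = x [^] p \<otimes> y [^] p \<otimes> u" using k by auto
    qed (use M in blast)
    then show False using n by simp
  qed
qed

end

section \<open>Subgroups of fixed order stable under normalisers\<close>

context finite_group_prime
begin

lemma gen_eq: "h \<in> carrier G \<Longrightarrow> generate G {h} = {h [^] k | k. k \<in> (UNIV :: nat set)}"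
  by (rule generate_pow_on_finite_carrier[OF fin])

lemma gen_subgroup: "h \<in> carrier G \<Longrightarrow> subgroup (generate G {h}) G"
  by (rule generate_is_subgroup) simp

lemma gen_least: "subgroup H G \<Longrightarrow> h \<in> H \<Longrightarrow> generate G {h} \<subseteq> H"
  by (rule generate_subgroup_incl) simp_all

lemma gen_mem: "h \<in> generate G {h}"
  by (rule generate.incl) simp

lemma sylow_subgroup_iff: "sylow_subgroup G p P \<longleftrightarrow> psub P \<and> card P = p ^ multiplicity p (order G)"
  by (auto simp: sylow_subgroup_def psub_def)

lemma sylow_subgroup_psub: "sylow_subgroup G p P \<Longrightarrow> psub P"
  by (simp add: sylow_subgroup_iff)

lemma sylow_subgroup_cj: "sylow_subgroup G p P \<Longrightarrow> g \<in> carrier G \<Longrightarrow> sylow_subgroup G p (cj g ` P)"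
  by (simp add: sylow_subgroup_iff psub_cj psub_carrier)

lemma psub_in_sylow:
  assumes "sylow_subgroup G p S" "psub P"
  obtains g where "g \<in> carrier G" "cj g ` P \<subseteq> S"
proof -
  have "order G \<noteq> 0" using fin order_gt_0_iff_finite by auto
  then have "\<not> p dvd card (carrier G) div card S"
    using assms multiplicity_decompose[of "order G" p] p_gt_1 by (simp add: sylow_subgroup_iff order_def)
  then show ?thesis
    using conj_into_sylow[OF subgroup_self sylow_subgroup_psub[OF assms(1)] _ _ assms(2)] psub_carrier assms sylow_subgroup_psub that by metis
qed

end

text \<open>The hypotheses freed from the choice of S: they are stated for every p-subgroup of G, so
  they can be used for any R and for several Sylow subgroups at once.\<close>

locale normal_order_hyp = finite_group_prime +
  fixes d :: nat
  assumes d_gt_1: "1 < d" and d_power: "\<exists>k. d = p ^ k" and order: "p * d dvd order G"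
    and stable_d: "\<And>R H. psub R \<Longrightarrow> subgroup H G \<Longrightarrow> H \<subseteq> R \<Longrightarrow> card H = d \<Longrightarrow> stable (nrm R) H"
    and comm_pd: "\<And>H x y. psub H \<Longrightarrow> card H = p * d \<Longrightarrow> x \<in> H \<Longrightarrow> y \<in> H \<Longrightarrow> x \<otimes> y = y \<otimes> x"
    and stable_4: "\<And>R h. p = 2 \<Longrightarrow> d = 2 \<Longrightarrow> psub R \<Longrightarrow> \<not> (\<forall>x\<in>R. \<forall>y\<in>R. x \<otimes> y = y \<otimes> x) \<Longrightarrow>
      h \<in> R \<Longrightarrow> card (generate G {h}) = 4 \<Longrightarrow> stable (nrm R) (generate G {h})"
begin

text \<open>Each x in V generates a proper subgroup, which extends to a subgroup of order d inside
  V. Thus V is a union of stable subgroups.\<close>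

lemma noncyclic_stable:
  assumes N: "N \<subseteq> nrm R" and R: "psub R" and V: "subgroup V G" "V \<subseteq> R" "card V = p * d"
    and nc: "\<And>h. h \<in> V \<Longrightarrow> generate G {h} \<noteq> V"
  shows "stable N V"
  unfolding stable_def
proof (intro ballI)
  fix g x assume g: "g \<in> N" and x: "x \<in> V"
  have Vp: "psub V" using psub_sub R V by blast
  have xc: "x \<in> carrier G" using x Vp psub_carrier by blast
  let ?X = "generate G {x}"
  have Xs: "subgroup ?X G" "?X \<subset> V" using gen_subgroup xc gen_least V x nc by blast+
  have "p * card ?X dvd p * d" using psub_index_dvd[OF Vp Xs] V by simp
  then have d1: "card ?X dvd d" using p_gt_0 by simp
  obtain k where k: "d = p ^ k" using d_power by blast
  have "card ?X dvd p ^ k" "p ^ k dvd card V" using d1 k V by simp_all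
  then obtain A where A: "subgroup A G" "?X \<subseteq> A" "A \<subseteq> V" "card A = p ^ k"
    using psub_extend_to[OF Vp Xs(1) psubset_imp_subset[OF Xs(2)]] by blast
  have "stable (nrm R) A" using stable_d[OF R A(1)] A V k by auto
  moreover have "x \<in> A" using A(2) gen_mem by blast
  ultimately have "cj g x \<in> A" using g N by (auto simp: stable_def)
  then show "cj g x \<in> V" using A by blast
qed

text \<open>The p-th power of a generator of V would have order d.\<close>

lemma noncyclic_if_no_cyclic_maximal:
  assumes V: "subgroup V G" "card V = p * d" and nd: "\<And>h. h \<in> V \<Longrightarrow> card (generate G {h}) \<noteq> d" and h: "h \<in> V"
  shows "generate G {h} \<noteq> V"
proof
  assume eq: "generate G {h} = V"
  have hc: "h \<in> carrier G" using h V subgroup.mem_carrier by metis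
  have "ord h = p * d" using generate_pow_card[OF hc] eq V by simp
  then have "ord (h [^] p) = d" using ord_pow[OF hc, of p] p_gt_0 by simp
  moreover have "h [^] p \<in> V" using h V subgroup_pow_closed by blast
  ultimately show False using nd generate_pow_card[of "h [^] p"] hc by simp
qed

text \<open>The \<open>N\<close>-stable maximal subgroups of the abelian group \<open>V\<close> intersect in its Frattini subgroup
  \<open>V ^ p\<close>, so \<open>N\<close> stabilises every subgroup between \<open>V ^ p\<close> and \<open>V\<close>.\<close>

lemma scalar_action:
  assumes V: "psub V" "stable N V" and comm: "\<And>x y. x \<in> V \<Longrightarrow> y \<in> V \<Longrightarrow> x \<otimes> y = y \<otimes> x"
    and max: "\<And>A. subgroup A G \<Longrightarrow> A \<subseteq> V \<Longrightarrow> card V = p * card A \<Longrightarrow> stable N A"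
    and g: "g \<in> N" and x: "x \<in> V"
  shows "\<exists>k y. y \<in> V \<and> cj g x = x [^] (k::nat) \<otimes> y [^] p"
proof -
  have Vs: "subgroup V G" using V psub_def by blast
  have Vc: "x \<in> carrier G" if "x \<in> V" for x using that V psub_carrier by blast
  have triv: "cj t a = a" if "t \<in> V" "a \<in> V" for t a using cj_commute Vc comm that by blast
  define Vp where "Vp = (\<lambda>y. y [^] p) ` V"
  have Vps: "subgroup Vp G"
  proof (rule subgroup_mult_closedI)
    show "Vp \<subseteq> carrier G" using Vc by (auto simp: Vp_def)
    show "Vp \<noteq> {}" using subgroup.one_closed[OF Vs] by (auto simp: Vp_def)
    fix a b assume "a \<in> Vp" "b \<in> Vp"
    then obtain y z where yz: "y \<in> V" "z \<in> V" "a = y [^] p" "b = z [^] p" unfolding Vp_def by blast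
    have "a \<otimes> b = (y \<otimes> z) [^] p" using yz pow_mult_distrib[OF comm[OF yz(1,2)]] Vc by simp
    then show "a \<otimes> b \<in> Vp" using subgroup.m_closed[OF Vs yz(1,2)] by (simp add: Vp_def)
  qed
  have VpV: "Vp \<subseteq> V" using subgroup_pow_closed[OF Vs] by (auto simp: Vp_def)
  let ?W = "adj Vp x"
  let ?w = "cj g x"
  have wV: "?w \<in> V" using stableD[OF V(2) g x] .
  have adjs: "subgroup (adj A t) G" if "subgroup A G" "A \<subseteq> V" "t \<in> V" for A t
    by (rule adj_subgroup[OF that(1) Vc[OF that(3)]]) (use triv that in auto)
  have W: "subgroup ?W G" "Vp \<subseteq> ?W" "x \<in> ?W" "?W \<subseteq> V"
    using adjs[OF Vps VpV x] adj_contains[OF Vps Vc[OF x]] adj_least[OF Vs VpV x] by auto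
  have "?w \<in> ?W"
  proof (rule ccontr)
    assume nw: "?w \<notin> ?W"
    \<comment> \<open>Take A largest with x in A and its conjugate w outside. For y outside A,
      maximality gives w = y^i a, and p does not divide i because w is not in A; so y lies in A<w>.
      Hence V = A<w>, A is a maximal subgroup and stable, yet it contains x and not w.\<close>
    let ?P = "\<lambda>A. subgroup A G \<and> ?W \<subseteq> A \<and> A \<subseteq> V \<and> ?w \<notin> A"
    have 1: "?P ?W" using W nw by blast
    have 2: "\<forall>A. ?P A \<longrightarrow> card A < Suc (card V)"
      using fin_sub[OF Vs] by (simp add: card_mono le_imp_less_Suc)
    obtain A where A: "?P A" "\<forall>B. ?P B \<longrightarrow> card B \<le> card A"
      using ex_has_greatest_nat[OF 1 2] by blast
    have As: "subgroup A G" "?W \<subseteq> A" "A \<subseteq> V" "?w \<notin> A" using A by auto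
    have pA: "y [^] p \<in> A" if "y \<in> V" for y using that W As by (auto simp: Vp_def)
    have "V \<subseteq> adj A ?w"
    proof
      fix y assume y: "y \<in> V"
      note Aw = adj_contains[OF As(1) Vc[OF wV]]
      note Ay = adj_contains[OF As(1) Vc[OF y]]
      show "y \<in> adj A ?w"
      proof (cases "y \<in> A")
        case True
        then show ?thesis using Aw by blast
      next
        case False
        have "card A < card (adj A y)"
          using adj_card[OF As(1) Vc[OF y] False pA[OF y]] card_subgroup_pos[OF As(1)] p_gt_1 by simp
        then have "\<not> ?P (adj A y)" using A(2) by (meson leD)
        moreover have "?W \<subseteq> adj A y" using As(2) Ay by (meson subset_trans)
        ultimately have "?w \<in> adj A y"
          using adjs[OF As(1,3) y] adj_least[OF Vs As(3) y] by blast
        then obtain i a where ia: "?w = y [^] (i::nat) \<otimes> a" "a \<in> A" unfolding adj_def by blast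
        have ac: "a \<in> carrier G" using ia As Vc by blast
        have "\<not> p dvd i"
        proof
          assume "p dvd i"
          then obtain l where "i = p * l" by blast
          then have "y [^] i = (y [^] p) [^] l" using Vc[OF y] by (simp add: nat_pow_pow)
          then have "y [^] i \<in> A" using subgroup_pow_closed[OF As(1) pA[OF y]] by simp
          then show False using ia As subgroup.m_closed[OF As(1)] by simp
        qed
        then have cop: "coprime i p" using prime_imp_coprime[OF prime_p] coprime_commute by blast
        have "y [^] i = ?w \<otimes> inv a" using ia ac Vc[OF y] by (simp add: m_assoc)
        moreover have "?w \<otimes> inv a \<in> adj A ?w"
          using Aw subgroup.m_inv_closed[OF As(1) ia(2)] by (intro subgroup.m_closed[OF adjs[OF As(1,3) wV]]) auto
        ultimately have "y [^] i \<in> adj A ?w" by simp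
        moreover have "y [^] p \<in> adj A ?w" using pA[OF y] Aw by blast
        ultimately show ?thesis using pow_mem_coprime[OF adjs[OF As(1,3) wV] Vc[OF y]] cop by blast
      qed
    qed
    then have "adj A ?w = V" using adj_least[OF Vs As(3) wV] by blast
    then have "card V = p * card A" using adj_card[OF As(1) Vc[OF wV] As(4) pA[OF wV]] by simp
    then have "stable N A" using max As by blast
    moreover have "x \<in> A" using W As by blast
    ultimately show False using As(4) g by (auto simp: stable_def)
  qed
  then show ?thesis unfolding adj_def Vp_def by blast
qed

text \<open>The condition \<open>d dvd card M\<close> is what makes the chain extendable: every M<t>
  then has room for a subgroup of order d containing a given smaller one. In the noncyclic case the
  maximal subgroups of V have order d, so \<open>scalar_action\<close> applies.\<close>

lemma chain_start:
  assumes R: "psub R" "p * d dvd card R"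
  shows "\<exists>M. pchain (nrm R) M \<and> M \<subseteq> R \<and> d dvd card M"
proof -
  let ?N = "nrm R"
  have Rc: "R \<subseteq> carrier G" using R psub_carrier by blast
  have N: "subgroup ?N G" using nrm_subgroup Rc by blast
  obtain k where k: "d = p ^ k" using d_power by blast
  show ?thesis
  proof (cases "\<exists>h\<in>R. card (generate G {h}) = d")
    case True
    then obtain h where h: "h \<in> R" "card (generate G {h}) = d" by blast
    have hc: "h \<in> carrier G" using h Rc by blast
    let ?H = "generate G {h}"
    note Hs = gen_subgroup[OF hc]
    have HR: "?H \<subseteq> R" using gen_least R h psub_def by blast
    have st: "stable ?N ?H" using stable_d[OF R(1) Hs HR h(2)] .
    have "pchain ?N ?H"
    proof (rule pchain_abelian[OF N _ st])
      show "psub ?H" using psub_sub R Hs HR by blast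
      show "x \<otimes> y = y \<otimes> x" if "x \<in> ?H" "y \<in> ?H" for x y
        using that hc unfolding gen_eq[OF hc] by (auto simp: nat_pow_mult add.commute)
      show "\<exists>k y. y \<in> ?H \<and> cj g x = x [^] (k::nat) \<otimes> y [^] p" if gx: "g \<in> ?N" "x \<in> ?H" for g x
      proof -
        obtain i where i: "x = h [^] (i::nat)" using gx gen_eq[OF hc] by blast
        \<comment> \<open>The exponent for the generator h serves all of its powers; the p-th power
          term can be taken trivial.\<close>
        obtain j where j: "cj g h = h [^] (j::nat)" using stableD[OF st gx(1) gen_mem] gen_eq[OF hc] by blast
        have "cj g x = x [^] j \<otimes> \<one> [^] p"
          using i j hc gx nrm_carrier by (auto simp: cj_pow nat_pow_pow mult.commute subset_iff)
        then show ?thesis using subgroup.one_closed[OF Hs] by blast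
      qed
    qed
    then show ?thesis using HR h by auto
  next
    case False
    have "subgroup {\<one>} G" "{\<one>} \<subseteq> R" using triv_subgroup R psub_def subgroup.one_closed by blast+
    moreover have "card {\<one>} dvd p ^ Suc k" "p ^ Suc k dvd card R" using R k by simp_all
    ultimately obtain V where V: "subgroup V G" "V \<subseteq> R" "card V = p ^ Suc k"
      using psub_extend_to[OF R(1)] by metis
    have cV: "card V = p * d" using V k by simp
    have Vp: "psub V" using psub_sub R V by blast
    have comm: "x \<otimes> y = y \<otimes> x" if "x \<in> V" "y \<in> V" for x y using comm_pd[OF Vp cV that] .
    have st: "stable ?N V"
      by (rule noncyclic_stable[OF subset_refl R(1) V(1,2) cV])
        (rule noncyclic_if_no_cyclic_maximal[OF V(1) cV], use False V(2) in blast)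
    have "pchain ?N V"
    proof (rule pchain_abelian[OF N Vp st comm])
      show "\<exists>k y. y \<in> V \<and> cj g x = x [^] (k::nat) \<otimes> y [^] p" if "g \<in> ?N" "x \<in> V" for g x
      proof (rule scalar_action[OF Vp st comm _ that])
        fix A assume "subgroup A G" "A \<subseteq> V" "card V = p * card A"
        then show "stable ?N A" using stable_d[OF R(1), of A] V(2) cV p_gt_0 by auto
      qed
    qed
    then show ?thesis using V cV by auto
  qed
qed

lemma chain_extend:
  assumes R: "psub R" and M: "pchain (nrm R) M" "M \<subset> R" "d dvd card M"
  shows "\<exists>Q. pchain (nrm R) Q \<and> Q \<subseteq> R \<and> card Q = p * card M"
proof -
  let ?N = "nrm R"
  have Rs: "subgroup R G" using R psub_def by blast
  have Rc: "R \<subseteq> carrier G" using R psub_carrier by blast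
  have N: "subgroup ?N G" using nrm_subgroup Rc by blast
  have Nc: "?N \<subseteq> carrier G" using nrm_carrier .
  have RN: "R \<subseteq> ?N" using subset_nrm_iff[OF Rc] stable_self[OF Rs] by blast
  have Ms: "subgroup M G" using pchain_psub[OF M(1) Nc] psub_def by blast
  let ?P = "\<lambda>Q. subgroup Q G \<and> stable ?N Q \<and> M \<subset> Q \<and> Q \<subseteq> R"
  have "?P R" using Rs stable_nrm M by blast
  then obtain Q where Q: "?P Q" "\<forall>L. ?P L \<longrightarrow> card Q \<le> card L"
    using ex_has_least_nat[of ?P R card] by blast
  have Qp: "psub Q" using psub_sub R Q by blast
  have Qs: "subgroup Q G" using Q by blast
  interpret C: chief_step G p ?N Q M
  proof (rule chief_step.intro[OF finite_group_prime_axioms], rule chief_step_axioms.intro)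
    show "subgroup ?N G" "psub Q" "Q \<subseteq> ?N" "stable ?N Q" "pchain ?N M" "M \<subset> Q"
      using N Qp Q RN M by blast+
    fix L assume L: "subgroup L G" "stable ?N L" "M \<subseteq> L" "L \<subseteq> Q"
    show "L = M \<or> L = Q"
    proof (cases "L = M")
      case False
      then have "M \<subset> L" "L \<subseteq> R" using L Q by auto
      then have "card Q \<le> card L" using Q(2) L(1,2) by simp
      then show ?thesis using card_seteq[OF fin_sub[OF Qs] L(4)] by blast
    qed simp
  qed
  obtain k where k: "d = p ^ k" using d_power by blast
  have k0: "k \<noteq> 0" using k d_gt_1 by (intro notI) simp
  have adjM: "subgroup (adj M t) G" "psub (adj M t)" "adj M t \<subseteq> R" "d dvd card (adj M t)" "M \<subseteq> adj M t" "t \<in> adj M t"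
    if t: "t \<in> Q" "t \<notin> M" for t
  proof -
    have tc: "t \<in> carrier G" using t C.Qc by blast
    show s: "subgroup (adj M t) G"
      by (rule adj_subgroup[OF Ms tc]) (use C.Mst C.QN[OF t(1)] in \<open>auto simp: stable_def\<close>)
    have "adj M t \<subseteq> Q" using adj_least[OF Qs _ t(1)] Q by blast
    then show "adj M t \<subseteq> R" using Q by blast
    then show "psub (adj M t)" using psub_sub R s by blast
    show "d dvd card (adj M t)"
      using adj_card[OF Ms tc t(2) C.frattini_factor(1)[OF t(1)]] M by simp
    show "M \<subseteq> adj M t" "t \<in> adj M t" using adj_contains[OF Ms tc] by auto
  qed
  \<comment> \<open>The stable set wanted by \<open>chief_factor_order\<close> is a subgroup of
    order d between T and M<t>. It need not contain M.\<close>
  have enlarge: "\<exists>H. t \<in> H \<and> H \<subseteq> adj M t \<and> stable ?N H"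
    if t: "t \<in> Q" "t \<notin> M" and T: "subgroup T G" "t \<in> T" "T \<subseteq> adj M t" "card T dvd d" for t T
  proof -
    have "card T dvd p ^ k" "p ^ k dvd card (adj M t)" using adjM(4)[OF t] T k by simp_all
    then obtain H where H: "subgroup H G" "T \<subseteq> H" "H \<subseteq> adj M t" "card H = p ^ k"
      using psub_extend_to[OF adjM(2)[OF t] T(1,3)] by blast
    have "stable ?N H" using stable_d[OF R H(1)] H adjM(3)[OF t] k by auto
    then show ?thesis using H T by blast
  qed
  have order_p: "subgroup (adj {\<one>} t) G" "card (adj {\<one>} t) = p" "t \<in> adj {\<one>} t"
    if t: "t \<in> carrier G" "t \<noteq> \<one>" "t [^] p = \<one>" for t
    using adj_subgroup[OF triv_subgroup t(1)] adj_card[OF triv_subgroup t(1)] adj_contains[OF triv_subgroup t(1)] t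
    by auto
  have p_case: "\<exists>H. t \<in> H \<and> H \<subseteq> adj M t \<and> stable ?N H"
    if t: "t \<in> Q" "t \<notin> M" "t [^] p = \<one>" for t
  proof -
    have tc: "t \<in> carrier G" using t C.Qc by blast
    have t1: "t \<noteq> \<one>" using t subgroup.one_closed[OF Ms] by blast
    note T = order_p[OF tc t1 t(3)]
    have "adj {\<one>} t \<subseteq> adj M t"
      using adj_least[OF adjM(1)[OF t(1,2)] _ adjM(6)[OF t(1,2)]] subgroup.one_closed[OF adjM(1)[OF t(1,2)]] by blast
    moreover have "card (adj {\<one>} t) dvd d" using T k k0 by (simp add: dvd_power)
    ultimately show ?thesis using enlarge[OF t(1,2) T(1,3)] by blast
  qed
  have "card Q = p * card M"
  proof (rule C.chief_factor_order[OF p_case])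
    fix t assume p2: "p = 2" and nab: "\<not> (\<forall>x\<in>Q. \<forall>y\<in>Q. x \<otimes> y = y \<otimes> x)"
      and t: "t \<in> Q" "t \<notin> M" and t4: "t [^] (4::nat) = \<one>"
    have tc: "t \<in> carrier G" using t C.Qc by blast
    show "\<exists>H. t \<in> H \<and> H \<subseteq> adj M t \<and> stable ?N H"
    proof (cases "t [^] p = \<one>")
      case True
      then show ?thesis using p_case t by blast
    next
      case False
      let ?T = "generate G {t}"
      have "ord t dvd 4" using t4 pow_eq_id[OF tc] by blast
      moreover have "\<not> ord t dvd 2" using False p2 pow_eq_id[OF tc] by blast
      moreover have "ord t \<le> 4" using \<open>ord t dvd 4\<close> by (rule dvd_imp_le) simp
      then have "ord t = 0 \<or> ord t = 1 \<or> ord t = 2 \<or> ord t = 3 \<or> ord t = 4" by arith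
      ultimately have "ord t = 4"
        by (elim disjE) auto
      then have c4: "card ?T = 4" using generate_pow_card[OF tc] by simp
      have TM: "?T \<subseteq> adj M t" using gen_least[OF adjM(1)[OF t] adjM(6)[OF t]] .
      show ?thesis
      proof (cases "d = 2")
        case True
        \<comment> \<open>A cyclic group of order 4 does not fit into a subgroup of order 2, so here
          the extra hypothesis is used; for larger d, 4 divides d and \<open>enlarge\<close>
          works.\<close>
        have "stable ?N ?T"
          by (rule stable_4[OF p2 True R _ _ c4]) (use nab Q t in blast)+
        then show ?thesis using TM gen_mem by blast
      next
        case False
        then have "k \<ge> 2" using k p2 k0 by (cases k) (auto simp: le_less Suc_le_eq)
        then have "p ^ 2 dvd d" unfolding k by (rule le_imp_power_dvd)
        then have "card ?T dvd d" using c4 p2 by simp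
        then show ?thesis using enlarge[OF t gen_subgroup[OF tc] gen_mem TM] by blast
      qed
    qed
  qed
  then have "pchain ?N Q" using pchain_step[OF M(1) Qs] Q by blast
  then show ?thesis using Q \<open>card Q = p * card M\<close> by blast
qed

lemma chain_exists:
  assumes R: "psub R" "p * d dvd card R"
  shows "pchain (nrm R) R"
proof -
  have Rs: "subgroup R G" using R psub_def by blast
  let ?P = "\<lambda>A. pchain (nrm R) A \<and> A \<subseteq> R \<and> d dvd card A"
  obtain M0 where 1: "?P M0" using chain_start[OF R] by blast
  have 2: "\<forall>A. ?P A \<longrightarrow> card A < Suc (card R)"
    using fin_sub[OF Rs] by (simp add: card_mono le_imp_less_Suc)
  obtain A where A: "?P A" "\<forall>B. ?P B \<longrightarrow> card B \<le> card A"
    using ex_has_greatest_nat[OF 1 2] by blast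
  have "A = R"
  proof (rule ccontr)
    assume "A \<noteq> R"
    then obtain Q where Q: "pchain (nrm R) Q" "Q \<subseteq> R" "card Q = p * card A"
      using chain_extend[OF R(1), of A] A by blast
    have "card A \<noteq> 0" using A fin_sub[OF Rs] pchain_psub[OF _ nrm_carrier] card_subgroup_pos psub_def by fastforce
    then have "card A < card Q" using Q p_gt_1 by simp
    moreover have "?P Q" using Q A by simp
    ultimately show False using A(2) by (meson leD)
  qed
  then show ?thesis using A by blast
qed

section \<open>Control of fusion by the normaliser of a Sylow subgroup\<close>

lemma order_dvd_sylow: "sylow_subgroup G p S \<Longrightarrow> p * d dvd card S"
proof -
  assume S: "sylow_subgroup G p S"
  obtain k where k: "d = p ^ k" using d_power by blast
  have "order G \<noteq> 0" using fin order_gt_0_iff_finite by auto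
  then have "Suc k \<le> multiplicity p (order G)"
    using order k p_gt_1 by (intro multiplicity_geI) auto
  then have "p ^ Suc k dvd card S" using S by (simp add: sylow_subgroup_iff le_imp_power_dvd del: power_Suc)
  then show ?thesis using k by simp
qed

text \<open>One enlargement step for Burnside's induction: after conjugation by an element
  centralising R, subgroups of S and T strictly above R lie in a common p-subgroup, hence in a
  common Sylow subgroup.\<close>

lemma common_overgroups:
  assumes S: "sylow_subgroup G p S" "sylow_subgroup G p T" and R: "psub R" "R \<subset> S" "R \<subset> T"
  obtains A B c P where "subgroup A G" "R \<subset> A" "A \<subseteq> S" "subgroup B G" "R \<subset> B" "B \<subseteq> T"
    "c \<in> cent R" "psub P" "A \<subseteq> P" "cj c ` B \<subseteq> P"
proof -
  have Rs: "subgroup R G" using R psub_def by blast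
  have Rc: "R \<subseteq> carrier G" using R psub_carrier by blast
  have C: "subgroup (cent R) G" using cent_subgroup[OF Rc] .
  obtain k where k: "d = p ^ k" using d_power by blast
  show ?thesis
  proof (cases "p * d dvd card R")
    case False
    obtain r where r: "card R = p ^ r" using R psub_def by blast
    have "\<not> Suc k \<le> r"
    proof
      assume "Suc k \<le> r"
      then have "p ^ Suc k dvd p ^ r" by (rule le_imp_power_dvd)
      then show False using False k r by simp
    qed
    then have rk: "card R dvd p ^ Suc k" using r by (simp add: le_imp_power_dvd del: power_Suc)
    have ex: "\<exists>A. subgroup A G \<and> R \<subset> A \<and> A \<subseteq> S \<and> psub A \<and> A \<subseteq> cent R"
      if S: "sylow_subgroup G p S" "R \<subset> S" for S
    proof -
      have "p ^ Suc k dvd card S" using order_dvd_sylow[OF S(1)] k by simp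
      then obtain A where A: "subgroup A G" "R \<subseteq> A" "A \<subseteq> S" "card A = p ^ Suc k"
        using psub_extend_to[OF sylow_subgroup_psub[OF S(1)] Rs psubset_imp_subset[OF S(2)] rk] by blast
      have pA: "psub A" using psub_sub[OF sylow_subgroup_psub[OF S(1)]] A by blast
      have cA: "card A = p * d" using A k by simp
      have "R \<noteq> A" using cA False by auto
      moreover have "A \<subseteq> cent R"
      proof
        fix a assume a: "a \<in> A"
        have "cj a b = b" if "b \<in> R" for b
          using cj_commute comm_pd[OF pA cA a, of b] that A a psub_carrier[OF pA] by blast
        then show "a \<in> cent R" using a psub_carrier[OF pA] by (auto simp: cent_def)
      qed
      ultimately show ?thesis using A pA by blast
    qed
    obtain A where A: "subgroup A G" "R \<subset> A" "A \<subseteq> S" "psub A" "A \<subseteq> cent R" using ex[OF S(1) R(2)] by blast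
    obtain B where B: "subgroup B G" "R \<subset> B" "B \<subseteq> T" "psub B" "B \<subseteq> cent R" using ex[OF S(2) R(3)] by blast
    \<comment> \<open>A and B are abelian and contain R, so both lie in C_G(R); the extension lemma
      is used with K = C.\<close>
    have "\<exists>m. k [^] (p ^ m) \<in> cent R" if "k \<in> cent R" for k using subgroup_pow_closed[OF C that] by blast
    then obtain c P where "c \<in> cent R" "psub P" "A \<subseteq> P" "cj c ` B \<subseteq> P"
      using conj_in_p_extension[OF C C subset_refl stable_self[OF C] _ A(4,5) B(4,5)] by blast
    then show ?thesis using that A B by blast
  next
    case True
    let ?N = "nrm R"
    have N: "subgroup ?N G" using nrm_subgroup Rc by blast
    \<comment> \<open>K is a subgroup thanks to the chain of R. It contains every p-element of the
      normaliser, in particular the normalisers of R in S and in T, which exceed R.\<close>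
    define K where "K = pcent ?N R"
    have K: "subgroup K G" unfolding K_def using pcent_subgroup[OF chain_exists[OF R(1) True] N] .
    have KN: "K \<subseteq> ?N" by (auto simp: K_def pcent_def)
    have CK: "cent R \<subseteq> K"
      using cent_subset_nrm subgroup_pow_closed[OF C] by (auto simp: K_def pcent_def)
    have st: "stable K (cent R)"
      unfolding stable_def using cent_cj[OF Rc] KN nrm_inv[OF Rc] by blast
    have pK: "\<exists>m. k [^] (p ^ m) \<in> cent R" if "k \<in> K" for k using that by (auto simp: K_def pcent_def)
    have ex: "subgroup (?N \<inter> S) G \<and> R \<subset> ?N \<inter> S \<and> psub (?N \<inter> S) \<and> ?N \<inter> S \<subseteq> K"
      if S: "sylow_subgroup G p S" "R \<subset> S" for S
    proof -
      have pS: "psub S" using sylow_subgroup_psub S by blast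
      have s: "subgroup (?N \<inter> S) G" using N pS psub_def by (intro subgroups_Inter_pair) auto
      have p: "psub (?N \<inter> S)" using psub_sub[OF pS s] by blast
      obtain t where t: "t \<in> S" "t \<notin> R" "\<forall>a\<in>R. cj t a \<in> R" using psub_normalizer_grows[OF pS Rs S(2)] by blast
      have "t \<in> ?N \<inter> S" using t psub_carrier[OF pS] by (auto simp: nrm_def)
      moreover have "R \<subseteq> ?N" using subset_nrm_iff[OF Rc] stable_self[OF Rs] by blast
      ultimately have "R \<subset> ?N \<inter> S" using S t by blast
      moreover have "?N \<inter> S \<subseteq> K"
      proof
        fix x assume x: "x \<in> ?N \<inter> S"
        obtain m where "x [^] (p ^ m) = \<one>" using psub_pow_eq_one[OF p x] by blast
        then have "x [^] (p ^ m) \<in> cent R" using subgroup.one_closed[OF C] by simp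
        then show "x \<in> K" using x by (auto simp: K_def pcent_def)
      qed
      ultimately show ?thesis using s p by blast
    qed
    note A = ex[OF S(1) R(2)]
    note B = ex[OF S(2) R(3)]
    obtain c P where "c \<in> cent R" "psub P" "?N \<inter> S \<subseteq> P" "cj c ` (?N \<inter> T) \<subseteq> P"
      using conj_in_p_extension[OF K C CK st pK] A B by blast
    then show ?thesis using that[of "?N \<inter> S" "?N \<inter> T"] A B by blast
  qed
qed

text \<open>Burnside's fusion argument, by descending induction on \<open>R\<close>.\<close>

lemma sylow_conj_in_cent:
  assumes "sylow_subgroup G p S" "sylow_subgroup G p T" "psub R" "R \<subseteq> S" "R \<subseteq> T"
  shows "\<exists>c\<in>cent R. cj c ` S = T"
  using assms
proof (induction "card S - card R" arbitrary: S T R rule: less_induct)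
  case less
  have Rc: "R \<subseteq> carrier G" using less psub_carrier by blast
  have Sp: "psub S" "psub T" using less sylow_subgroup_psub by auto
  have Sc: "S \<subseteq> carrier G" "T \<subseteq> carrier G" using Sp psub_carrier by auto
  have C: "subgroup (cent R) G" using cent_subgroup[OF Rc] .
  have cST: "card S = card T" using less by (simp add: sylow_subgroup_iff)
  have fT: "finite S" "finite T" using Sp fin_sub psub_def by auto
  show ?case
  proof (cases "R = S \<or> R = T")
    case True
    then have "S = T" using less.prems cST fT by (metis card_subset_eq)
    moreover have "cj \<one> ` S = S" using Sc by (auto simp: image_iff subset_iff)
    ultimately show ?thesis using subgroup.one_closed[OF C] by blast
  next
    case False
    then have R: "R \<subset> S" "R \<subset> T" using less by auto
    obtain A B c P where AB: "subgroup A G" "R \<subset> A" "A \<subseteq> S" "subgroup B G" "R \<subset> B" "B \<subseteq> T"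
      "c \<in> cent R" "psub P" "A \<subseteq> P" "cj c ` B \<subseteq> P"
      using common_overgroups[OF less.prems(1-3) R] by blast
    have cc: "c \<in> carrier G" using AB cent_carrier by blast
    obtain k where k: "k \<in> carrier G" "cj k ` P \<subseteq> S" using psub_in_sylow[OF less.prems(1) AB(8)] by blast
    \<comment> \<open>U is a Sylow subgroup above P. It shares A with S, and it shares the conjugate
      of B with the conjugate of T. Both are larger than R, so the induction hypothesis conjugates
      each pair by an element centralising R.\<close>
    define U where "U = cj (inv k) ` S"
    have U: "sylow_subgroup G p U" unfolding U_def using sylow_subgroup_cj less k by simp
    have PU: "P \<subseteq> U"
    proof -
      have "cj (inv k) ` cj k ` P \<subseteq> U" unfolding U_def using k by blast
      then show ?thesis using k psub_carrier[OF AB(8)] by simp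
    qed
    have pA: "psub A" "psub B" using psub_sub[OF Sp(1)] psub_sub[OF Sp(2)] AB by auto
    have cardA: "card R < card A" "card A \<le> card S" "card R < card B" "card B \<le> card T"
      using AB fT fin_sub by (auto intro: psubset_card_mono card_mono)
    have "\<exists>c1\<in>cent A. cj c1 ` S = U"
      by (rule less.hyps) (use cardA less.prems U pA AB PU in auto)
    then obtain c1 where c1: "c1 \<in> cent A" "cj c1 ` S = U" by blast
    have B': "psub (cj c ` B)" "cj c ` B \<subseteq> cj c ` T" "card (cj c ` B) = card B" "card (cj c ` T) = card T"
      using pA cc AB(6) psub_cj psub_carrier Sc by auto
    have "\<exists>c2\<in>cent (cj c ` B). cj c2 ` cj c ` T = U"
      by (rule less.hyps) (use cardA less.prems U B' AB PU cST sylow_subgroup_cj[OF less.prems(2) cc] in auto)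
    then obtain c2 where c2: "c2 \<in> cent (cj c ` B)" "cj c2 ` cj c ` T = U" by blast
    have "R \<subseteq> cj c ` B"
    proof
      fix x assume x: "x \<in> R"
      then have "cj c x = x" using AB centD by blast
      then show "x \<in> cj c ` B" using x AB by (metis image_eqI psubsetD)
    qed
    then have "c2 \<in> cent R" "c1 \<in> cent R" using c1 c2 cent_mono AB by blast+
    then have mem: "inv (c2 \<otimes> c) \<otimes> c1 \<in> cent R"
      using AB(7) by (intro subgroup.m_closed[OF C] subgroup.m_inv_closed[OF C])
    have cs: "c1 \<in> carrier G" "c2 \<in> carrier G" using c1 c2 cent_carrier by blast+
    have "cj (inv (c2 \<otimes> c) \<otimes> c1) ` S = cj (inv (c2 \<otimes> c)) ` cj c1 ` S"
      using cs cc Sc by (subst cj_image_cj_image) auto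
    also have "\<dots> = cj (inv (c2 \<otimes> c)) ` cj c2 ` cj c ` T" using c1 c2 by simp
    also have "cj c2 ` cj c ` T = cj (c2 \<otimes> c) ` T" using cs cc Sc by (subst cj_image_cj_image) auto
    also have "cj (inv (c2 \<otimes> c)) ` \<dots> = T" using cs cc Sc by simp
    finally show ?thesis using mem by blast
  qed
qed

text \<open>Let y be the image of x under conjugation by g, with x and y in S. Then y lies in S and
  in the Sylow subgroup T that arises from S by the same conjugation. An element c centralising the
  intersection carries T back to S, so c g^-1 normalises S and still sends x to y.\<close>

lemma strongly_closed_if_stable:
  assumes S: "sylow_subgroup G p S" and H: "subgroup H G" "H \<subseteq> S" "stable (nrm S) H"
  shows "strongly_closed G S (group_fusion G S) H"
  unfolding strongly_closed_def
proof (intro conjI allI impI ballI H)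
  fix P \<phi> assume P: "subgroup P G" "P \<subseteq> H" and \<phi>: "\<phi> \<in> group_fusion G S P S"
  obtain g where g: "g \<in> carrier G" "\<phi> = (\<lambda>x\<in>P. inv g \<otimes> x \<otimes> g)" "\<phi> ` P \<subseteq> S"
    using \<phi> unfolding group_fusion_def by blast
  have Sc: "S \<subseteq> carrier G" using S sylow_subgroup_psub psub_carrier by blast
  show "\<phi> ` P \<subseteq> H"
  proof
    fix y assume "y \<in> \<phi> ` P"
    then obtain x where x: "x \<in> P" "y = cj (inv g) x" using g by (auto simp: cj_def)
    have yS: "y \<in> S" using \<open>y \<in> \<phi> ` P\<close> g by blast
    have xc: "x \<in> carrier G" using x P H Sc by blast
    let ?T = "cj (inv g) ` S"
    have T: "sylow_subgroup G p ?T" using sylow_subgroup_cj S g by simp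
    have "x \<in> S" using x P H by blast
    then have yT: "y \<in> ?T" using x by blast
    have sub: "subgroup (S \<inter> ?T) G"
      using sylow_subgroup_psub[OF S] sylow_subgroup_psub[OF T] unfolding psub_def by (intro subgroups_Inter_pair) auto
    have "psub (S \<inter> ?T)" using psub_sub[OF sylow_subgroup_psub[OF S] sub] by blast
    then obtain c where c: "c \<in> cent (S \<inter> ?T)" "cj c ` ?T = S"
      using sylow_conj_in_cent[OF T S] by blast
    have cc: "c \<in> carrier G" using c cent_carrier by blast
    have "cj (c \<otimes> inv g) ` S = S"
      using c cj_image_cj_image[of c "inv g" S] cc g Sc by simp
    then have "c \<otimes> inv g \<in> nrm S" using cc g by (auto simp: nrm_def)
    then have "cj (c \<otimes> inv g) x \<in> H" using H(3) x P by (auto simp: stable_def)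
    moreover have "cj (c \<otimes> inv g) x = cj c y" using x cc g xc by (simp add: cj_cj)
    moreover have "cj c y = y" using c yS yT centD by blast
    ultimately show "y \<in> H" by simp
  qed
qed

end

section \<open>Supersolvability\<close>

context finite_group_prime
begin

lemma pchain_series:
  assumes "pchain N A" "N \<subseteq> carrier G"
  shows "\<exists>(n::nat) s. s 0 = {\<one>} \<and> s n = A \<and> (\<forall>i<n. s i \<subseteq> s (Suc i) \<and> card (s (Suc i)) = p * card (s i)) \<and>
    (\<forall>i\<le>n. psub (s i) \<and> stable N (s i))"
  using assms
proof (induction rule: pchain.induct)
  case pchain_one
  then show ?case
    using pchain_psub_stable[OF pchain.pchain_one] by (intro exI[of _ 0] exI[of _ "\<lambda>_. {\<one>}"]) simp
next
  case (pchain_step A B)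
  then obtain n s where s: "s 0 = {\<one>}" "s n = A" "\<forall>i<n. s i \<subseteq> s (Suc i) \<and> card (s (Suc i)) = p * card (s i)"
    "\<forall>i\<le>n. psub (s i) \<and> stable N (s i)" by blast
  have B: "psub B \<and> stable N B"
    using pchain_psub_stable[OF pchain.pchain_step[OF pchain_step(1-5)]] pchain_step by blast
  show ?case
    by (rule exI[of _ "Suc n"], rule exI[of _ "s(Suc n := B)"]) (use s B pchain_step in \<open>auto simp: less_Suc_eq le_Suc_eq\<close>)
qed

lemma cyclic_factor:
  assumes B: "psub B" and A: "subgroup A G" and AB: "A \<subseteq> B" "card B = p * card A"
  shows "cyclic_group ((G\<lparr>carrier := B\<rparr>) Mod A)"
proof -
  let ?B = "G\<lparr>carrier := B\<rparr>"
  have Bs: "subgroup B G" using B psub_def by blast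
  interpret B: group ?B using Bs subgroup_imp_group by blast
  have sub: "subgroup A ?B" using subgroup_incl A Bs AB by blast
  have BN: "B \<subseteq> nrm A" using index_p_normal B A AB by blast
  have "A \<lhd> ?B"
    unfolding B.normal_inv_iff
  proof (intro conjI ballI sub)
    fix x h assume "x \<in> carrier ?B" "h \<in> A"
    then have "cj x h \<in> A" "inv\<^bsub>?B\<^esub> x = inv x" using BN m_inv_consistent[OF Bs] by (auto simp: nrm_def)
    then show "x \<otimes>\<^bsub>?B\<^esub> h \<otimes>\<^bsub>?B\<^esub> inv\<^bsub>?B\<^esub> x \<in> A" by (simp add: cj_def)
  qed
  then interpret A: normal A ?B .
  interpret Q: group "?B Mod A" by (rule A.factorgroup_is_group)
  have "card A \<noteq> card B" using AB p_gt_1 card_subgroup_pos[OF A] by simp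
  then have "A \<noteq> B" by blast
  then obtain b where b: "b \<in> B" "b \<notin> A" using AB by blast
  have bc: "b \<in> carrier G" using b Bs subgroup.mem_carrier by metis
  have adj: "adj A b = B" using index_p_adj[OF B A AB b index_p_pow[OF B A AB b(1)]] .
  have X: "A #>\<^bsub>?B\<^esub> b \<in> carrier (?B Mod A)" using b by (auto simp: FactGroup_def RCOSETS_def)
  have pow: "(A #>\<^bsub>?B\<^esub> b) [^]\<^bsub>?B Mod A\<^esub> (k::int) = A #>\<^bsub>?B\<^esub> (b [^] k)" for k
    using A.FactGroup_int_pow[of b k] b int_pow_consistent[OF Bs b(1)] by simp
  have "carrier (?B Mod A) \<subseteq> range (\<lambda>k::int. (A #>\<^bsub>?B\<^esub> b) [^]\<^bsub>?B Mod A\<^esub> k)"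
  proof
    fix c assume "c \<in> carrier (?B Mod A)"
    then obtain y where y: "y \<in> B" "c = A #>\<^bsub>?B\<^esub> y" by (auto simp: FactGroup_def RCOSETS_def)
    obtain i a where ia: "y = b [^] (i::nat) \<otimes> a" "a \<in> A" using y(1) unfolding adj[symmetric] adj_def by blast
    have ac: "a \<in> carrier G" using ia A subgroup.mem_carrier by metis
    have bi: "b [^] i \<in> B" using subgroup_pow_closed[OF Bs b(1)] .
    \<comment> \<open>\<open>Mod\<close> is built from right cosets, so the factor a has to be moved
      to the left of b^i.\<close>
    have "cj (b [^] i) a \<in> A" using BN bi ia by (auto simp: nrm_def)
    moreover have "y = cj (b [^] i) a \<otimes> b [^] i" using ia ac bc by (simp add: cj_def m_assoc)
    ultimately have "y \<in> A #>\<^bsub>?B\<^esub> (b [^] i)" by (auto simp: r_coset_def)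
    then have "c = A #>\<^bsub>?B\<^esub> (b [^] i)" using B.repr_independence[OF _ _ sub] bi y by simp
    also have "\<dots> = (A #>\<^bsub>?B\<^esub> b) [^]\<^bsub>?B Mod A\<^esub> (int i)" unfolding pow by (simp add: int_pow_int)
    finally show "c \<in> range (\<lambda>k::int. (A #>\<^bsub>?B\<^esub> b) [^]\<^bsub>?B Mod A\<^esub> k)" by blast
  qed
  moreover have "range (\<lambda>k::int. (A #>\<^bsub>?B\<^esub> b) [^]\<^bsub>?B Mod A\<^esub> k) \<subseteq> carrier (?B Mod A)"
    using Q.int_pow_closed[OF X] by blast
  ultimately show ?thesis unfolding Q.cyclic_group using X by blast
qed

section \<open>Transport of the hypotheses from S to arbitrary p-subgroups\<close>

lemma normalizer_eq_nrm:
  assumes "subgroup H G"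
  shows "normalizer G H = nrm H"
proof -
  have Hc: "H \<subseteq> carrier G" using assms subgroup.subset by blast
  have eq: "g <# H #> inv g = cj g ` H" for g by (auto simp: l_coset_def r_coset_def cj_def)
  have "cj g ` H = H \<longleftrightarrow> (\<forall>a\<in>H. cj g a \<in> H)" if "g \<in> carrier G" for g
  proof
    assume "\<forall>a\<in>H. cj g a \<in> H"
    then have "cj g ` H \<subseteq> H" by blast
    then show "cj g ` H = H" using card_subset_eq[OF fin_sub[OF assms]] card_cj_image[OF that Hc] by blast
  qed blast
  then show ?thesis using Hc by (auto simp: normalizer_def stabilizer_def nrm_def eq)
qed

text \<open>Conjugation by u carries \<open>nrm R\<close> into the normaliser of the conjugate of R,
  so a property established inside S can be pulled back to R.\<close>

lemma stable_nrm_cj: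
  assumes u: "u \<in> carrier G" and R: "R \<subseteq> carrier G" and H: "H \<subseteq> carrier G"
    and st: "stable (nrm (cj u ` R)) (cj u ` H)"
  shows "stable (nrm R) H"
  unfolding stable_def
proof (intro ballI)
  fix g h assume g: "g \<in> nrm R" and h: "h \<in> H"
  have gc: "g \<in> carrier G" using g nrm_carrier by blast
  have swap: "cj (cj u g) (cj u x) = cj u (cj g x)" if "x \<in> carrier G" for x
  proof -
    have "cj u g \<otimes> u = u \<otimes> g" using u gc by (simp add: cj_def m_assoc)
    then show ?thesis using u gc that by (simp add: cj_cj)
  qed
  have "cj u g \<in> nrm (cj u ` R)" using g gc u R swap by (auto simp: nrm_def subset_iff)
  then have "cj (cj u g) (cj u h) \<in> cj u ` H" using st h by (auto simp: stable_def)
  then have "cj u (cj g h) \<in> cj u ` H" using swap h H by auto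
  then obtain h' where "h' \<in> H" "cj u (cj g h) = cj u h'" by blast
  then show "cj g h \<in> H" using u gc h H cj_eq_iff by (metis cj_closed subsetD)
qed

lemma stable_if_subnormalizer_condition:
  assumes "subnormalizer_condition G S H" "subgroup H G" "subgroup R G" "H \<subseteq> R" "R \<subseteq> S"
  shows "stable (nrm R) H"
proof -
  have "normalizer G R \<subseteq> normalizer G H" using assms unfolding subnormalizer_condition_def by blast
  then have "nrm R \<subseteq> nrm H" using normalizer_eq_nrm assms by simp
  then show ?thesis using stable_nrm stable_mono by blast
qed

lemma comm_groupD:
  assumes "comm_group (G\<lparr>carrier := H\<rparr>)" "x \<in> H" "y \<in> H"
  shows "x \<otimes> y = y \<otimes> x"
proof -
  interpret H: comm_group "G\<lparr>carrier := H\<rparr>" by (rule assms)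
  show ?thesis using H.m_comm[of x y] assms by simp
qed

lemma commute_if_cj_commute:
  assumes "u \<in> carrier G" "x \<in> carrier G" "y \<in> carrier G" "cj u x \<otimes> cj u y = cj u y \<otimes> cj u x"
  shows "x \<otimes> y = y \<otimes> x"
proof -
  have "cj u (x \<otimes> y) = cj u (y \<otimes> x)" using assms by (simp add: cj_mult)
  then show ?thesis using assms by simp
qed

lemma cj_image_generate:
  assumes "u \<in> carrier G" "h \<in> carrier G"
  shows "cj u ` generate G {h} = generate G {cj u h}"
proof -
  have "cj u ` generate G {h} = {cj u (h [^] k) | k. k \<in> (UNIV :: nat set)}"
    using assms by (auto simp: gen_eq)
  also have "\<dots> = generate G {cj u h}" using assms by (simp add: gen_eq cj_pow)
  finally show ?thesis .
qed

lemma cyclic_group_generate: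
  assumes "h \<in> carrier G"
  shows "cyclic_group (G\<lparr>carrier := generate G {h}\<rparr>)"
proof -
  have s: "subgroup (generate G {h}) G" using gen_subgroup assms .
  interpret H: group "G\<lparr>carrier := generate G {h}\<rparr>" using subgroup_imp_group[OF s] .
  have eq: "h [^]\<^bsub>G\<lparr>carrier := generate G {h}\<rparr>\<^esub> (k::int) = h [^] k" for k
    using int_pow_consistent[OF s gen_mem] by simp
  have "carrier (G\<lparr>carrier := generate G {h}\<rparr>) =
    range (\<lambda>k::int. h [^]\<^bsub>G\<lparr>carrier := generate G {h}\<rparr>\<^esub> k)"
    unfolding eq using generate_pow[OF assms] by auto
  moreover have "h \<in> carrier (G\<lparr>carrier := generate G {h}\<rparr>)" using gen_mem by simp
  ultimately show ?thesis unfolding H.cyclic_group by blast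
qed

end

theorem corollary3p28:
  fixes G :: "('a, 'b) monoid_scheme" and p :: nat and S D :: "'a set"
  assumes "group G" and "finite (carrier G)" and "Factorial_Ring.prime p" and "sylow_subgroup G p S"
    and "subgroup D G" and "D \<subseteq> S" and "1 < card D" and "card D < card S"
    and "\<And>H. subgroup H G \<Longrightarrow> H \<subseteq> S \<Longrightarrow> card H = card D \<Longrightarrow>
           comm_group (G\<lparr>carrier := H\<rparr>) \<and> subnormalizer_condition G S H"
    and "\<And>H. subgroup H G \<Longrightarrow> H \<subseteq> S \<Longrightarrow> card H = p * card D \<Longrightarrow>
           comm_group (G\<lparr>carrier := H\<rparr>)"
    and "\<not> comm_group (G\<lparr>carrier := S\<rparr>) \<Longrightarrow> p = 2 \<Longrightarrow> card D = 2 \<Longrightarrow>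
           (\<forall>H. subgroup H G \<longrightarrow> H \<subseteq> S \<longrightarrow> cyclic_group (G\<lparr>carrier := H\<rparr>) \<longrightarrow> card H = 4 \<longrightarrow>
              subnormalizer_condition G S H)"
  shows "supersolvable_fusion G S (group_fusion G S)"
proof -
  interpret group G by (rule assms)
  interpret finite_group_prime G p by unfold_locales (use assms in auto)
  have S: "psub S" using assms sylow_subgroup_psub by blast
  have Ss: "subgroup S G" using S psub_def by blast
  have Sc: "S \<subseteq> carrier G" using S psub_carrier by blast
  have pD: "psub D" using psub_sub S assms by blast
  have "D \<subset> S" using assms by blast
  then have pdS: "p * card D dvd card S" using psub_index_dvd S assms by blast
  \<comment> \<open>Every p-subgroup has a conjugate inside S; each hypothesis is applied there and
    pulled back.\<close>
  interpret normal_order_hyp G p "card D"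
  proof unfold_locales
    show "1 < card D" by (rule assms)
    show "\<exists>k. card D = p ^ k" using pD psub_def by blast
    show "p * card D dvd order G"
      using pdS card_subgroup_dvd[OF Ss subgroup_self Sc] unfolding order_def by (rule dvd_trans)
  next
    fix R H assume R: "psub R" and H: "subgroup H G" "H \<subseteq> R" "card H = card D"
    obtain u where u: "u \<in> carrier G" "cj u ` R \<subseteq> S" using psub_in_sylow assms R by blast
    have c: "R \<subseteq> carrier G" "H \<subseteq> carrier G" using psub_carrier R H by blast+
    have H': "subgroup (cj u ` H) G" "cj u ` H \<subseteq> cj u ` R" using cj_image_subgroup H u by auto
    have "subnormalizer_condition G S (cj u ` H)" using assms(9)[OF H'(1)] H' H u c by auto
    then show "stable (nrm R) H"
      using stable_nrm_cj[OF u(1) c] stable_if_subnormalizer_condition[OF _ H'(1) _ H'(2) u(2)]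
        cj_image_subgroup[OF _ u(1)] R psub_def by blast
  next
    fix H x y assume H: "psub H" "card H = p * card D" and xy: "x \<in> H" "y \<in> H"
    obtain u where u: "u \<in> carrier G" "cj u ` H \<subseteq> S" using psub_in_sylow assms H by blast
    have c: "H \<subseteq> carrier G" using psub_carrier H by blast
    have "comm_group (G\<lparr>carrier := cj u ` H\<rparr>)"
      using assms(10)[of "cj u ` H"] cj_image_subgroup[of H u] H u c psub_def by simp
    then have "cj u x \<otimes>\<^bsub>G\<^esub> cj u y = cj u y \<otimes>\<^bsub>G\<^esub> cj u x" using comm_groupD xy by blast
    then show "x \<otimes>\<^bsub>G\<^esub> y = y \<otimes>\<^bsub>G\<^esub> x" using commute_if_cj_commute u xy c by blast
  next
    fix R h assume p2: "p = 2" "card D = 2" and R: "psub R" and nab: "\<not> (\<forall>x\<in>R. \<forall>y\<in>R. x \<otimes>\<^bsub>G\<^esub> y = y \<otimes>\<^bsub>G\<^esub> x)"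
      and h: "h \<in> R" "card (generate G {h}) = 4"
    obtain u where u: "u \<in> carrier G" "cj u ` R \<subseteq> S" using psub_in_sylow assms R by blast
    have c: "R \<subseteq> carrier G" using psub_carrier R by blast
    have hc: "h \<in> carrier G" using h c by blast
    let ?H = "generate G {h}"
    have HR: "?H \<subseteq> R" using gen_least h R psub_def by blast
    have Hc: "?H \<subseteq> carrier G" using HR c by blast
    have H': "subgroup (cj u ` ?H) G" "cj u ` ?H \<subseteq> cj u ` R"
      using cj_image_subgroup[OF gen_subgroup[OF hc] u(1)] HR by auto
    \<comment> \<open>A nonabelian R has a nonabelian conjugate in S, so the order-4 hypothesis is
      available whenever it is called upon.\<close>
    have "\<not> comm_group (G\<lparr>carrier := S\<rparr>)"
    proof
      assume cS: "comm_group (G\<lparr>carrier := S\<rparr>)"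
      have "x \<otimes>\<^bsub>G\<^esub> y = y \<otimes>\<^bsub>G\<^esub> x" if "x \<in> R" "y \<in> R" for x y
      proof (rule commute_if_cj_commute[OF u(1)])
        show "cj u x \<otimes>\<^bsub>G\<^esub> cj u y = cj u y \<otimes>\<^bsub>G\<^esub> cj u x" using comm_groupD[OF cS] u that by blast
      qed (use that c in auto)
      then show False using nab by blast
    qed
    moreover have "cyclic_group (G\<lparr>carrier := cj u ` ?H\<rparr>)"
      using cyclic_group_generate u hc by (simp add: cj_image_generate)
    moreover have "card (cj u ` ?H) = 4" using h u Hc by simp
    ultimately have "subnormalizer_condition G S (cj u ` ?H)" using assms(11) p2 H' u by blast
    then show "stable (nrm R) ?H"
      using stable_nrm_cj[OF u(1) c Hc] stable_if_subnormalizer_condition[OF _ H'(1) _ H'(2) u(2)]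
        cj_image_subgroup[OF _ u(1)] R psub_def by blast
  qed
  obtain n s where s: "s 0 = {\<one>\<^bsub>G\<^esub>}" "s n = S" "\<forall>i<n. s i \<subseteq> s (Suc i) \<and> card (s (Suc i)) = p * card (s i)"
    "\<forall>i\<le>n. psub (s i) \<and> stable (nrm S) (s i)"
    using pchain_series[OF chain_exists[OF S pdS] nrm_carrier] by blast
  have up: "s i \<subseteq> S" if "i \<le> n" for i
    using that by (induction rule: inc_induct) (use s in auto)
  show ?thesis
    unfolding supersolvable_fusion_def
  proof (intro exI conjI allI impI)
    show "s 0 = {\<one>\<^bsub>G\<^esub>}" "s n = S" by (rule s)+
    show "s i \<subseteq> s (Suc i)" if "i < n" for i using s that by blast
    show "strongly_closed G S (group_fusion G S) (s i)" if "i \<le> n" for i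
      using strongly_closed_if_stable[OF assms(4)] s up that psub_def by blast
    show "cyclic_group (G\<lparr>carrier := s (Suc i)\<rparr> Mod s i)" if "i < n" for i
    proof (rule cyclic_factor)
      have "psub (s i)" using s that by simp
      then show "subgroup (s i) G" by (rule psub_subgroup)
    qed (use s that in auto)
  qed
qed

end
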